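(* Let $\mathcal A$ be the complex vector space of functions on $\mathfrak H$ generated over $\mathbb C$ by all the functions $\phi^{+}_{r,s}(f;i,\cdot)$ and $\phi^{-}_{r,s}(f;i,\cdot)$, where $f$ ranges over $S_k$ with $k\ge 12$ even, $r,s$ range over all integers such that $r+s$ is even and $r+s>k$, and $0\le i\le k-2$. Then $\mathcal A$ is a subspace of the space $\mathcal{MI}'_2$ of extended modular iterated integrals of length $2$.
   Context: Let $\Gamma=\mathrm{SL}_2(\mathbb Z)$, $T=\left(\begin{smallmatrix}1&1\\0&1\end{smallmatrix}\right)$, $B=\{\pm T^n : n\in\mathbb Z\}$, $\mathfrak H$ the upper half-plane, $z=x+iy\in\mathfrak H$, $q=e^{2\pi i z}$. For $\gamma=\left(\begin{smallmatrix}a&b\\c&d\end{smallmatrix}\right)\in\Gamma$ put $j(\gamma,z)=cz+d$ (and likewise $j(\gamma,\bar z)=c\bar z+d$, $j(\gamma,X)=cX+d$). Let $\mathcal R$ be the set of real-analytic $f:\mathfrak H\to\mathbb C$ such that, for some $C>0$, $f(z)=O(y^C)$ as $y\to\infty$, uniformly in $x$. For integers $r,s$, let $\mathcal M_{r,s}$ be the space of $f\in\mathcal R$ such that (1) $f(\gamma z)=j(\gamma,z)^r j(\gamma,\bar z)^s f(z)$ for all $\gamma\in\Gamma$, $z\in\mathfrak H$; (2) for some $M\in\mathbb N$ and $a^{(j)}_{m,n}\in\mathbb C$, $f(z)=\sum_{|j|\le M}y^j\big(\sum_{m,n\ge 0}a^{(j)}_{m,n}q^m\bar q^n\big)$. Put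 $\mathcal M=\bigoplus_{r,s}\mathcal M_{r,s}$ (over all integers $r,s$). Let $S_k$ be the space of holomorphic cusp forms of weight $k$ for $\Gamma$, $S=\bigoplus_k S_k$, and $\overline S$ the space of complex conjugates of elements of $S$. The operators $\partial_r=2iy\frac{\partial}{\partial z}+r:\mathcal M_{r,s}\to\mathcal M_{r+1,s-1}$ and $\bar\partial_s=-2iy\frac{\partial}{\partial\bar z}+s:\mathcal M_{r,s}\to\mathcal M_{r-1,s+1}$ induce operators $\partial,\bar\partial$ on $\mathcal M$. For $r+s\ge4$ put $\mathcal E_{r,s}(z)=\sum_{\gamma\in B\backslash\Gamma} j(\gamma,z)^{-r}j(\gamma,\bar z)^{-s}$. The space $\mathcal{MI}'_2$ of extended modular iterated integrals of length $2$ is the largest subspace of $\mathcal M$ satisfying $$\partial\,\mathcal{MI}'_2\subset\mathcal{MI}'_2+\bigoplus_{j\in\mathbb Z;\ r,s\ge1,\ r+s\ge4}y^j\mathcal E_{r,s}S,\qquad \bar\partial\,\mathcal{MI}'_2\subset\mathcal{MI}'_2+\bigoplus_{j\in\mathbb Z;\ r,s\ge1,\ r+s\ge4}y^j\mathcal E_{r,s}\overline S .$$ For $f\in S_k$ define the polynomials in $X$ $$F_f^+(z,X)=\int_{i\infty}^z f(w)(w-X)^{k-2}\,dw,\qquad F_f^-(z,X)=\overline{\int_{i\infty}^z f(w)(w-X)^{k-2}\,dw},$$ where the bar is complex conjugation acting trivially on $X$ (i.e. on the coefficients only). For integers $r,s$ with $r+s$ even and $r+s>k$ set $$\phi^\pm_{r,s}(f;z,X)=\sum_{\gamma\in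 B\backslash\Gamma}\frac{F_f^\pm(\gamma z,\gamma X)}{j(\gamma,z)^r j(\gamma,\bar z)^s}\,j(\gamma,X)^{k-2},$$ which is an (absolutely convergent) polynomial in $X$ of degree at most $k-2$, and define the functions $\phi^\pm_{r,s}(f;i,z)$, $0\le i\le k-2$, by $$\phi^\pm_{r,s}(f;z,X)=\sum_{i=0}^{k-2}\phi^\pm_{r,s}(f;i,z)\,(X-z)^i(X-\bar z)^{k-2-i}.$$ *)

theory Defs
  imports
    "HOL-Analysis.Analysis"
    "HOL-Computational_Algebra.Polynomial"
    "HOL-Library.Function_Algebras"
begin

(* A function on the upper half-plane is represented by a function on the complex plane that
   vanishes off the upper half-plane, so that equality of such functions is equality in HOL and
   spaces of functions are honest complex subspaces of complex => complex. *)

definition upper_half_plane :: "complex set" where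
  "upper_half_plane = {z. Im z > 0}"

definition on_uhp :: "(complex \<Rightarrow> complex) \<Rightarrow> complex \<Rightarrow> complex" where
  "on_uhp f z = (if z \<in> upper_half_plane then f z else 0)"

interpretation cfun: vector_space "\<lambda>(c::complex) (f::complex \<Rightarrow> complex) z. c * f z"
  by unfold_locales (auto simp: fun_eq_iff algebra_simps)

definition nome :: "complex \<Rightarrow> complex" where
  "nome z = exp (2 * of_real pi * \<i> * z)"


type_synonym int_mat = "int ^ 2 ^ 2"

definition SL2Z :: "int_mat set" where
  "SL2Z = {\<gamma>. det \<gamma> = 1}"

definition T_power :: "int \<Rightarrow> int_mat" where
  "T_power n = vector [vector [1, n], vector [0, 1]]"

definition B_group :: "int_mat set" where
  "B_group = range T_power \<union> range (\<lambda>n. - T_power n)"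

definition B_cosets :: "int_mat set set" where
  "B_cosets = (\<lambda>\<gamma>. (\<lambda>b. b ** \<gamma>) ` B_group) ` SL2Z"

definition j_factor :: "int_mat \<Rightarrow> complex \<Rightarrow> complex" where
  "j_factor \<gamma> z = of_int (\<gamma> $ 2 $ 1) * z + of_int (\<gamma> $ 2 $ 2)"

definition moebius :: "int_mat \<Rightarrow> complex \<Rightarrow> complex" where
  "moebius \<gamma> z = (of_int (\<gamma> $ 1 $ 1) * z + of_int (\<gamma> $ 1 $ 2)) / j_factor \<gamma> z"

(* Intended for summands depending only on the coset of gamma; the choice of the
   representative is then immaterial. *)
definition coset_sum :: "(int_mat \<Rightarrow> complex) \<Rightarrow> complex" where
  "coset_sum g = (\<Sum>\<^sub>\<infinity>C\<in>B_cosets. g (SOME \<gamma>. \<gamma> \<in> C))"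


definition real_analytic_uhp :: "(complex \<Rightarrow> complex) \<Rightarrow> bool" where
  "real_analytic_uhp f \<longleftrightarrow>
     (\<forall>z0\<in>upper_half_plane. \<exists>\<epsilon>>0. \<exists>c :: nat \<Rightarrow> nat \<Rightarrow> complex.
        \<forall>z\<in>ball z0 \<epsilon>.
          ((\<lambda>(m, n). c m n * of_real (Re (z - z0)) ^ m * of_real (Im (z - z0)) ^ n)
             has_sum f z) UNIV)"

definition R_space :: "(complex \<Rightarrow> complex) set" where
  "R_space = {f. (\<forall>z. z \<notin> upper_half_plane \<longrightarrow> f z = 0) \<and> real_analytic_uhp f \<and>
     (\<exists>C>0. \<exists>K Y. \<forall>z\<in>upper_half_plane. Im z \<ge> Y \<longrightarrow> norm (f z) \<le> K * Im z powr C)}"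

definition M_weight :: "int \<Rightarrow> int \<Rightarrow> (complex \<Rightarrow> complex) set" where
  "M_weight r s = {f \<in> R_space.
     (\<forall>\<gamma>\<in>SL2Z. \<forall>z\<in>upper_half_plane.
        f (moebius \<gamma> z) = j_factor \<gamma> z powi r * j_factor \<gamma> (cnj z) powi s * f z) \<and>
     (\<exists>(M::nat) (a :: int \<Rightarrow> nat \<Rightarrow> nat \<Rightarrow> complex). \<forall>z\<in>upper_half_plane.
        (\<forall>j\<in>{- int M..int M}.
           (\<lambda>(m, n). a j m n * nome z ^ m * cnj (nome z) ^ n) summable_on UNIV) \<and>
        f z = (\<Sum>j\<in>{- int M..int M}. of_real (Im z) powi j *
                 (\<Sum>\<^sub>\<infinity>(m, n)\<in>UNIV. a j m n * nome z ^ m * cnj (nome z) ^ n)))}"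

definition M_space :: "(complex \<Rightarrow> complex) set" where
  "M_space = cfun.span (\<Union>r s. M_weight r s)"

(* The spaces of different weights are linearly independent inside the space of functions (for
   fixed z, the functions j(gamma,z)^r j(gamma,cnj z)^s of gamma are), so the sum is direct and
   the homogeneous components chosen here are the only ones. *)
definition weight_components ::
  "(complex \<Rightarrow> complex) \<Rightarrow> int \<times> int \<Rightarrow> complex \<Rightarrow> complex" where
  "weight_components f = (SOME F. finite {p. F p \<noteq> 0} \<and>
     (\<forall>r s. F (r, s) \<in> M_weight r s) \<and> f = (\<Sum>p | F p \<noteq> 0. F p))"


(* Wirtinger derivatives: frechet_derivative is the real-linear derivative, evaluated in the
   directions 1 (x-derivative) and i (y-derivative). *)

definition wirtinger_z :: "(complex \<Rightarrow> complex) \<Rightarrow> complex \<Rightarrow> complex" where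
  "wirtinger_z f z =
     (frechet_derivative f (at z) 1 - \<i> * frechet_derivative f (at z) \<i>) / 2"

definition wirtinger_zbar :: "(complex \<Rightarrow> complex) \<Rightarrow> complex \<Rightarrow> complex" where
  "wirtinger_zbar f z =
     (frechet_derivative f (at z) 1 + \<i> * frechet_derivative f (at z) \<i>) / 2"

definition del_weight :: "int \<Rightarrow> (complex \<Rightarrow> complex) \<Rightarrow> complex \<Rightarrow> complex" where
  "del_weight r f = on_uhp (\<lambda>z. 2 * \<i> * of_real (Im z) * wirtinger_z f z + of_int r * f z)"

definition delbar_weight :: "int \<Rightarrow> (complex \<Rightarrow> complex) \<Rightarrow> complex \<Rightarrow> complex" where
  "delbar_weight s f =
     on_uhp (\<lambda>z. - 2 * \<i> * of_real (Im z) * wirtinger_zbar f z + of_int s * f z)"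

definition del :: "(complex \<Rightarrow> complex) \<Rightarrow> complex \<Rightarrow> complex" where
  "del f = (let F = weight_components f in
     \<Sum>(r, s) | F (r, s) \<noteq> 0. del_weight r (F (r, s)))"

definition delbar :: "(complex \<Rightarrow> complex) \<Rightarrow> complex \<Rightarrow> complex" where
  "delbar f = (let F = weight_components f in
     \<Sum>(r, s) | F (r, s) \<noteq> 0. delbar_weight s (F (r, s)))"


definition cusp_forms :: "int \<Rightarrow> (complex \<Rightarrow> complex) set" where
  "cusp_forms k = {f. (\<forall>z. z \<notin> upper_half_plane \<longrightarrow> f z = 0) \<and>
     f holomorphic_on upper_half_plane \<and>
     (\<forall>\<gamma>\<in>SL2Z. \<forall>z\<in>upper_half_plane. f (moebius \<gamma> z) = j_factor \<gamma> z powi k * f z) \<and>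
     (\<exists>a :: nat \<Rightarrow> complex. a 0 = 0 \<and>
        (\<forall>z\<in>upper_half_plane. (\<lambda>n. a n * nome z ^ n) sums f z))}"

definition S_space :: "(complex \<Rightarrow> complex) set" where
  "S_space = cfun.span (\<Union>k. cusp_forms k)"

definition S_conj_space :: "(complex \<Rightarrow> complex) set" where
  "S_conj_space = (\<lambda>f z. cnj (f z)) ` S_space"

definition Eisenstein :: "int \<Rightarrow> int \<Rightarrow> complex \<Rightarrow> complex" where
  "Eisenstein r s = on_uhp (\<lambda>z.
     coset_sum (\<lambda>\<gamma>. j_factor \<gamma> z powi (- r) * j_factor \<gamma> (cnj z) powi (- s)))"

(* The sum of the spaces y^j E_{r,s} V. For r + s odd the summands of E_{r,s} change sign under
   gamma |-> -gamma, so that E_{r,s} is only defined for r + s even. *)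
definition Eisenstein_multiples :: "(complex \<Rightarrow> complex) set \<Rightarrow> (complex \<Rightarrow> complex) set" where
  "Eisenstein_multiples V = cfun.span
     {(\<lambda>z. of_real (Im z) powi j * Eisenstein r s z * g z) | j r s g.
        r \<ge> 1 \<and> s \<ge> 1 \<and> r + s \<ge> 4 \<and> even (r + s) \<and> g \<in> V}"

definition MI2' :: "(complex \<Rightarrow> complex) set" where
  "MI2' = (GREATEST V. cfun.subspace V \<and> V \<subseteq> M_space \<and>
     del ` V \<subseteq> {v + w | v w. v \<in> V \<and> w \<in> Eisenstein_multiples S_space} \<and>
     delbar ` V \<subseteq> {v + w | v w. v \<in> V \<and> w \<in> Eisenstein_multiples S_conj_space})"


(* The integral of a holomorphic g from i oo to z, taken along the vertical ray above z. *)
definition cusp_integral :: "(complex \<Rightarrow> complex) \<Rightarrow> complex \<Rightarrow> complex" where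
  "cusp_integral g z = - integral {0..} (\<lambda>t::real. g (z + \<i> * of_real t) * \<i>)"

(* Polynomials in X are elements of complex poly; [:w, -1:] is w - X, and the integral of a
   polynomial is taken coefficientwise. *)
definition F_plus :: "nat \<Rightarrow> (complex \<Rightarrow> complex) \<Rightarrow> complex \<Rightarrow> complex poly" where
  "F_plus k f z = (\<Sum>m\<le>k - 2.
     monom (cusp_integral (\<lambda>w. f w * coeff ([:w, -1:] ^ (k - 2)) m) z) m)"

definition F_minus :: "nat \<Rightarrow> (complex \<Rightarrow> complex) \<Rightarrow> complex \<Rightarrow> complex poly" where
  "F_minus k f z = map_poly cnj (F_plus k f z)"

(* P(gamma X) j(gamma,X)^n for P of degree at most n, as a polynomial. *)
definition poly_act :: "nat \<Rightarrow> complex poly \<Rightarrow> int_mat \<Rightarrow> complex poly" where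
  "poly_act n P \<gamma> = (\<Sum>m\<le>n. smult (coeff P m)
     ([:of_int (\<gamma> $ 1 $ 2), of_int (\<gamma> $ 1 $ 1):] ^ m *
      [:of_int (\<gamma> $ 2 $ 2), of_int (\<gamma> $ 2 $ 1):] ^ (n - m)))"

(* phi_{r,s}(f; z, X), with F = F_plus k f or F = F_minus k f; the series is summed
   coefficientwise. *)
definition phi_poly ::
  "nat \<Rightarrow> (complex \<Rightarrow> complex poly) \<Rightarrow> int \<Rightarrow> int \<Rightarrow> complex \<Rightarrow> complex poly" where
  "phi_poly k F r s z = (\<Sum>m\<le>k - 2. monom (coset_sum (\<lambda>\<gamma>.
     coeff (poly_act (k - 2) (F (moebius \<gamma> z)) \<gamma>) m /
       (j_factor \<gamma> z powi r * j_factor \<gamma> (cnj z) powi s))) m)"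

(* The coordinates in the basis (X - z)^i (X - cnj z)^(k-2-i), 0 <= i <= k - 2, of the
   polynomials of degree at most k - 2. *)
definition phi_coeff ::
  "nat \<Rightarrow> (complex \<Rightarrow> complex poly) \<Rightarrow> int \<Rightarrow> int \<Rightarrow> nat \<Rightarrow> complex \<Rightarrow> complex" where
  "phi_coeff k F r s i = on_uhp (\<lambda>z.
     (THE c :: nat \<Rightarrow> complex. (\<forall>i>k - 2. c i = 0) \<and>
        phi_poly k F r s z =
          (\<Sum>i\<le>k - 2. smult (c i) ([:- z, 1:] ^ i * [:- cnj z, 1:] ^ (k - 2 - i)))) i)"

definition phi_space :: "(complex \<Rightarrow> complex) set" where
  "phi_space = cfun.span
     {phi_coeff k F r s i | k f F r s i.
        k \<ge> 12 \<and> even k \<and> f \<in> cusp_forms (int k) \<and> F \<in> {F_plus k f, F_minus k f} \<and>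
        even (r + s) \<and> r + s > int k \<and> i \<le> k - 2}"

end

theory Submission
  imports Defs
begin

text \<open>
The raising and lowering operators map \<open>M_weight r s\<close> to \<open>M_weight (r + 1) (s - 1)\<close> and
\<open>M_weight (r - 1) (s + 1)\<close>, so the space \<open>M_space\<close> of all modular functions is stable under both. It is
therefore one of the subspaces whose largest member is \<open>MI2'\<close>, and the two spaces coincide
(\<open>MI2'_eq\<close>). What has to be shown is that every coordinate function of \<open>phi_poly\<close> is modular of some
weight. By \<open>M_weight_iff\<close> this means a transformation law and an expansion in finitely many powers of
\<open>y\<close> with double series in \<open>q\<close> and its conjugate as coefficients; functions with such an expansion are
called \<open>qexp\<close> here.

Let \<open>n = k - 2\<close>, and let \<open>G i\<close> be the coordinates of \<open>F_plus k f\<close> in the basis \<open>(X - z)^i (X - cnj z)^(n - i)\<close>.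
The modular group acts diagonally in this basis. Hence the coordinates of \<open>phi_poly\<close> are the Poincare
series of \<open>G i (\<gamma> z) j^(- r - i) (cnj j)^(- s - n + i)\<close>, where \<open>j = c z + d\<close>
(\<open>poly_act_F_plus_coords\<close>, \<open>phi_poly_F_plus\<close>), and the transformation law is immediate.

For the expansion, the cocycle property of Eichler integrals is used: the difference of
\<open>F (\<gamma> z, \<gamma> X) (c X + d)^n\<close> and \<open>F (z, X)\<close> does not depend on \<open>z\<close>, because both have the derivative
\<open>f z * (z - X)^n\<close>. Evaluated at the point \<open>z = (- d + \<i>) / c\<close>, it becomes a polynomial in \<open>c X + d\<close> whose
coefficients depend on \<open>c\<close> and on \<open>d\<close> modulo \<open>c\<close> (\<open>eichler_period\<close>). They are bounded independently of \<open>\<gamma>\<close>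
(\<open>period_poly_bound\<close>), because Hecke's estimate bounds \<open>y^n |f|\<close>. In coordinates,
\<open>G i (\<gamma> z) j^(- i) (cnj j)^(i - n)\<close> is \<open>G i z\<close> plus a combination of monomials in \<open>j\<close> and \<open>cnj j\<close> of degree
at most \<open>n\<close>, divided by a power of \<open>y\<close> (\<open>G_expansion\<close>). Since \<open>r + s \<ge> n + 4\<close>, the Poincare series is a
combination, with products of functions \<open>G i\<close> and powers of \<open>y\<close> as coefficients, of absolutely convergent
sums \<open>\<Sum>c d. p c d * j^(- a) * (cnj j)^(- b)\<close> with \<open>p\<close> bounded and periodic in \<open>d\<close> modulo \<open>c\<close>, and
\<open>a + b \<ge> 4\<close>.

Such a sum is an average over the rational translates \<open>z + d / c\<close> of the lattice sum
\<open>\<Sum>m. (z + m)^(- a) (cnj z + m)^(- b)\<close> (\<open>qexp_pair_sum\<close>), and real translations only rotate the coefficients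
of an expansion (\<open>qexp_average\<close>). The lattice sums reduce, by partial fractions in
\<open>(z + m) - (cnj z + m) = 2 \<i> y\<close>, to derivatives of the cotangent, which are power series in \<open>q\<close>
(\<open>qexp_lattice_sum\<close>). The functions of \<open>F_minus\<close> are complex conjugates of those of \<open>F_plus\<close>.
\<close>

section \<open>Double power series\<close>

lemma abs_summable_complexI:
  fixes f :: "'a \<Rightarrow> complex"
  shows "f summable_on A \<Longrightarrow> (\<lambda>x. norm (f x)) summable_on A"
  using summable_on_iff_abs_summable_on_complex by blast

lemma has_sum_product:
  fixes f :: "'a \<Rightarrow> 'c :: {real_normed_field, banach}" and g :: "'b \<Rightarrow> 'c"
  assumes f: "(f has_sum a) A" "(\<lambda>x. norm (f x)) summable_on A"
    and g: "(g has_sum b) B" "(\<lambda>x. norm (g x)) summable_on B"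
  shows "((\<lambda>p. f (fst p) * g (snd p)) has_sum (a * b)) (A \<times> B)"
proof (rule has_sum_SigmaI[where g = "\<lambda>x. f x * b"])
  show "((\<lambda>y. f (fst (x, y)) * g (snd (x, y))) has_sum f x * b) B" for x
    using g(1) by (simp add: has_sum_cmult_right)
  show "((\<lambda>x. f x * b) has_sum a * b) A"
    using f(1) by (rule has_sum_cmult_left)
  have "(\<lambda>p. norm (f (fst p) * g (snd p))) summable_on (A \<times> B)"
  proof (rule summable_on_SigmaI[where g = "\<lambda>x. norm (f x) * infsum (\<lambda>y. norm (g y)) B"])
    show "((\<lambda>y. norm (f (fst (x, y)) * g (snd (x, y)))) has_sum norm (f x) * (\<Sum>\<^sub>\<infinity>y\<in>B. norm (g y))) B" for x
      using g(2) by (simp add: norm_mult has_sum_cmult_right)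
    show "(\<lambda>x. norm (f x) * (\<Sum>\<^sub>\<infinity>y\<in>B. norm (g y))) summable_on A"
      using f(2) by (rule summable_on_cmult_left)
  qed auto
  then show "(\<lambda>p. f (fst p) * g (snd p)) summable_on (A \<times> B)"
    by (rule abs_summable_summable)
qed

lemma has_sum_product_complex:
  fixes f :: "'a \<Rightarrow> complex" and g :: "'b \<Rightarrow> complex"
  assumes "(f has_sum a) A" "(g has_sum b) B"
  shows "((\<lambda>p. f (fst p) * g (snd p)) has_sum (a * b)) (A \<times> B)"
  using assms by (intro has_sum_product abs_summable_complexI) (auto intro: has_sum_imp_summable)

text \<open>Collecting the terms of an absolutely convergent sum by a label. With the pair of exponents as the
label, it turns the product of two double power series into a double power series.\<close>

lemma has_sum_regroup:
  fixes F :: "'i \<Rightarrow> complex" and \<pi> :: "'i \<Rightarrow> 'k"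
  assumes "(F has_sum S) UNIV"
  shows "((\<lambda>k. \<Sum>\<^sub>\<infinity>i\<in>{i. \<pi> i = k}. F i) has_sum S) UNIV"
proof (rule has_sum_SigmaD[where f = "\<lambda>p. F (snd p)" and B = "\<lambda>k. {i. \<pi> i = k}"])
  have "bij_betw (\<lambda>i. (\<pi> i, i)) UNIV (SIGMA k:UNIV. {i. \<pi> i = k})"
    by (rule bij_betwI[where g = snd]) auto
  from has_sum_reindex_bij_betw[OF this, of "\<lambda>p. F (snd p)" S] assms
  show "((\<lambda>p. F (snd p)) has_sum S) (SIGMA k:UNIV. {i. \<pi> i = k})" by simp
  show "((\<lambda>y. F (snd (k, y))) has_sum (\<Sum>\<^sub>\<infinity>i\<in>{i. \<pi> i = k}. F i)) {i. \<pi> i = k}" for k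
    using summable_on_subset[OF has_sum_imp_summable[OF assms], of "{i. \<pi> i = k}"] by simp
qed

text \<open>The coefficients of a product of two double power series. The finite sum over the decompositions
\<open>(M, N) = (m, n) + (m', n')\<close> is written as a sum over a fibre, which is the form that regrouping
produces.\<close>

definition double_conv ::
  "(nat \<Rightarrow> nat \<Rightarrow> complex) \<Rightarrow> (nat \<Rightarrow> nat \<Rightarrow> complex) \<Rightarrow> nat \<Rightarrow> nat \<Rightarrow> complex" where
  "double_conv a b M N =
     (\<Sum>\<^sub>\<infinity>p\<in>{p. (fst (fst p) + fst (snd p), snd (fst p) + snd (snd p)) = (M, N)}.
        a (fst (fst p)) (snd (fst p)) * b (fst (snd p)) (snd (snd p)))"

lemma double_power_series_mult:
  fixes X Y :: complex
  assumes "((\<lambda>(m, n). a m n * X ^ m * Y ^ n) has_sum S) UNIV"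
    and "((\<lambda>(m, n). b m n * X ^ m * Y ^ n) has_sum T) UNIV"
  shows "((\<lambda>(m, n). double_conv a b m n * X ^ m * Y ^ n) has_sum (S * T)) UNIV"
proof -
  let ?\<pi> = "\<lambda>p :: (nat \<times> nat) \<times> nat \<times> nat. (fst (fst p) + fst (snd p), snd (fst p) + snd (snd p))"
  let ?F = "\<lambda>p. (case fst p of (m, n) \<Rightarrow> a m n * X ^ m * Y ^ n) *
                 (case snd p of (m, n) \<Rightarrow> b m n * X ^ m * Y ^ n)"
  have "(?F has_sum (S * T)) UNIV"
    using has_sum_product_complex[OF assms] by simp
  from has_sum_regroup[OF this, of ?\<pi>]
  have "((\<lambda>k. \<Sum>\<^sub>\<infinity>p\<in>{p. ?\<pi> p = k}. ?F p) has_sum (S * T)) UNIV" .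
  also have "(\<lambda>k. \<Sum>\<^sub>\<infinity>p\<in>{p. ?\<pi> p = k}. ?F p) =
      (\<lambda>(m, n). double_conv a b m n * X ^ m * Y ^ n)"
  proof
    fix k :: "nat \<times> nat"
    obtain M N where k: "k = (M, N)" by (cases k)
    have "(\<Sum>\<^sub>\<infinity>p\<in>{p. ?\<pi> p = k}. ?F p) =
        (\<Sum>\<^sub>\<infinity>p\<in>{p. ?\<pi> p = (M, N)}.
          (a (fst (fst p)) (snd (fst p)) * b (fst (snd p)) (snd (snd p))) * (X ^ M * Y ^ N))"
      unfolding k by (rule infsum_cong) (auto simp: power_add algebra_simps)
    also have "\<dots> = double_conv a b M N * (X ^ M * Y ^ N)"
      unfolding double_conv_def by (rule infsum_cmult_left')
    finally show "(\<Sum>\<^sub>\<infinity>p\<in>{p. ?\<pi> p = k}. ?F p) =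
        (case k of (m, n) \<Rightarrow> double_conv a b m n * X ^ m * Y ^ n)"
      by (simp add: k mult.assoc)
  qed
  finally show ?thesis .
qed

lemma double_power_series_monom:
  fixes X Y :: complex
  shows "((\<lambda>(m, n). (if (m, n) = (m0, n0) then c else 0) * X ^ m * Y ^ n) has_sum (c * X ^ m0 * Y ^ n0)) UNIV"
  by (rule has_sum_finite_neutralI[where B = "{(m0, n0)}"]) (auto split: if_splits)

lemma has_sum_exp:
  fixes x :: "'a :: {real_normed_field, banach}"
  shows "((\<lambda>n. x ^ n / fact n) has_sum exp x) UNIV" and "(\<lambda>n. norm (x ^ n / fact n)) summable_on UNIV"
proof -
  have s: "summable (\<lambda>n. norm (x ^ n / fact n))"
    using summable_norm_exp[of x] by (simp add: divide_inverse mult.commute scaleR_conv_of_real)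
  then show "(\<lambda>n. norm (x ^ n / fact n)) summable_on UNIV"
    by (simp add: summable_on_UNIV_nonneg_real_iff)
  have "(\<lambda>n. x ^ n / fact n) sums exp x"
    using exp_converges[of x] by (simp add: divide_inverse mult.commute scaleR_conv_of_real)
  with s show "((\<lambda>n. x ^ n / fact n) has_sum exp x) UNIV"
    by (rule norm_summable_imp_has_sum)
qed

section \<open>Expansions in powers of y, q and the conjugate of q\<close>

lemma norm_nome: "norm (nome z) = exp (- 2 * pi * Im z)"
  unfolding nome_def by simp

lemma nome_shift: "nome (z + w) = nome z * nome w"
  unfolding nome_def by (simp add: exp_add[symmetric] algebra_simps)

lemma cnj_nome: "cnj (nome z) = exp (- (2 * of_real pi * \<i> * cnj z))"
  unfolding nome_def by (simp add: exp_cnj)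

lemma nome_powers:
  "nome z ^ m * cnj (nome z) ^ n =
     exp (2 * of_real pi * \<i> * (of_nat m * z - of_nat n * cnj z))"
  unfolding cnj_nome unfolding nome_def
  by (simp add: exp_of_nat_mult[symmetric] exp_add[symmetric] algebra_simps)

abbreviation q_terms :: "(nat \<Rightarrow> nat \<Rightarrow> complex) \<Rightarrow> complex \<Rightarrow> nat \<times> nat \<Rightarrow> complex" where
  "q_terms a z \<equiv> \<lambda>(m, n). a m n * nome z ^ m * cnj (nome z) ^ n"

text \<open>The functions with a finite expansion \<open>\<Sum>j. y^j * (\<Sum>m n. a m n * q^m * cnj q^n)\<close> on the upper half-plane.
The inductive form adds one power of \<open>y\<close> at a time, so that closure properties are rule inductions
whose only substance is the case of a single power; the lemma \<open>qexp_iff\<close> recovers the finite sum.\<close>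

inductive qexp :: "(complex \<Rightarrow> complex) \<Rightarrow> bool" where
  base: "(\<And>z. Im z > 0 \<Longrightarrow>
            (q_terms a z has_sum h z) UNIV) \<Longrightarrow>
         (\<And>z. Im z > 0 \<Longrightarrow> g z = of_real (Im z) powi j * h z) \<Longrightarrow> qexp g"
| add: "qexp g1 \<Longrightarrow> qexp g2 \<Longrightarrow> (\<And>z. Im z > 0 \<Longrightarrow> g z = g1 z + g2 z) \<Longrightarrow> qexp g"

lemma qexp_cong: "qexp g \<Longrightarrow> (\<And>z. Im z > 0 \<Longrightarrow> g' z = g z) \<Longrightarrow> qexp g'"
proof (induction arbitrary: g' rule: qexp.induct)
  case (base a h g j)
  then show ?case by (intro qexp.base[of a h g' j]) auto
next
  case (add g1 g2 g)
  then show ?case by (intro qexp.add[of g1 g2 g']) auto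
qed

lemma qexp_add: "qexp f \<Longrightarrow> qexp g \<Longrightarrow> qexp (\<lambda>z. f z + g z)"
  by (rule qexp.add) auto

lemma qexp_y_powi: "qexp (\<lambda>z. of_real (Im z) powi j)"
proof (rule qexp.base)
  fix z
  show "((\<lambda>(m, n). (if (m, n) = (0, 0) then 1 else 0) * nome z ^ m * cnj (nome z) ^ n) has_sum (\<lambda>_. 1) z) UNIV"
    using double_power_series_monom[of 0 0 1 "nome z" "cnj (nome z)"] by simp
qed auto

lemma qexp_const: "qexp (\<lambda>z. c)"
proof (rule qexp.base[where j = 0])
  fix z
  show "((\<lambda>(m, n). (if (m, n) = (0, 0) then c else 0) * nome z ^ m * cnj (nome z) ^ n) has_sum (\<lambda>_. c) z) UNIV"
    using double_power_series_monom[of 0 0 c "nome z" "cnj (nome z)"] by simp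
qed auto

lemma qexp_mult_base:
  assumes h: "\<And>z. Im z > 0 \<Longrightarrow> (q_terms a z has_sum h z) UNIV"
    and "qexp g"
  shows "qexp (\<lambda>z. of_real (Im z) powi j * h z * g z)"
  using \<open>qexp g\<close>
proof (induction rule: qexp.induct)
  case (base b k g i)
  have "(q_terms (double_conv a b) z has_sum (h z * k z)) UNIV"
    if "Im z > 0" for z
    using h[OF that] base(1)[OF that] by (rule double_power_series_mult)
  then show ?case
    by (rule qexp.base[where j = "i + j"]) (auto simp: base(2) power_int_add)
next
  case (add g1 g2 g)
  then show ?case by (intro qexp.add[OF add(4,5)]) (auto simp: algebra_simps)
qed

lemma qexp_mult: "qexp f \<Longrightarrow> qexp g \<Longrightarrow> qexp (\<lambda>z. f z * g z)"
proof (induction rule: qexp.induct)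
  case (base a h f j)
  show ?case
    by (rule qexp_cong[OF qexp_mult_base[OF base(1) base(3), where j = j]]) (auto simp: base(2))
next
  case (add g1 g2 f)
  show ?case
    by (rule qexp.add[OF add(4)[OF add(6)] add(5)[OF add(6)]]) (auto simp: add(3) algebra_simps)
qed

lemma qexp_cmult: "qexp f \<Longrightarrow> qexp (\<lambda>z. c * f z)"
  by (rule qexp_mult[OF qexp_const])

lemma qexp_diff: "qexp f \<Longrightarrow> qexp g \<Longrightarrow> qexp (\<lambda>z. f z - g z)"
  using qexp_add[of f "\<lambda>z. (-1) * g z"] qexp_cmult[of g "-1"] by simp

lemma qexp_sum: "finite I \<Longrightarrow> (\<And>i. i \<in> I \<Longrightarrow> qexp (f i)) \<Longrightarrow> qexp (\<lambda>z. \<Sum>i\<in>I. f i z)"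
  by (induction rule: finite_induct) (auto intro: qexp_const qexp_add)

lemma qexp_cnj: "qexp f \<Longrightarrow> qexp (\<lambda>z. cnj (f z))"
proof (induction rule: qexp.induct)
  case (base a h f j)
  show ?case
  proof (rule qexp.base)
    fix z :: complex assume z: "Im z > 0"
    have "((\<lambda>p. cnj (q_terms a z p)) has_sum cnj (h z)) (UNIV \<times> UNIV)"
      using base(1)[OF z] has_sum_cnj_iff by auto
    then show "((\<lambda>(m, n). cnj (a n m) * nome z ^ m * cnj (nome z) ^ n) has_sum (\<lambda>z. cnj (h z)) z) UNIV"
      by (subst (asm) has_sum_swap) (simp add: case_prod_unfold mult_ac)
    show "cnj (f z) = of_real (Im z) powi j * cnj (h z)"
      using z by (simp add: base(2))
  qed
next
  case (add g1 g2 f)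
  show ?case
    by (rule qexp.add[OF add(4,5)]) (auto simp: add(3))
qed

text \<open>Averages over real translates. Translating the argument by a real \<open>x\<close> multiplies the coefficient of
\<open>q^m * cnj q^n\<close> by a complex number of modulus 1. Hence all translates are dominated by the absolute
series of \<open>g\<close> itself, and absolutely summable weights may be moved inside, coefficient by coefficient.\<close>

lemma qexp_average_aux:
  fixes w :: "'i \<Rightarrow> complex" and x :: "'i \<Rightarrow> real"
  assumes w: "(\<lambda>i. norm (w i)) summable_on I" and "qexp g"
  shows "qexp (\<lambda>z. \<Sum>\<^sub>\<infinity>i\<in>I. w i * g (z + of_real (x i))) \<and>
         (\<forall>z. Im z > 0 \<longrightarrow> (\<lambda>i. w i * g (z + of_real (x i))) summable_on I)"
  using \<open>qexp g\<close>
proof (induction rule: qexp.induct)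
  case (base a h g j)
  define e where "e i m n = nome (of_real (x i)) ^ m * cnj (nome (of_real (x i))) ^ n" for i m n
  have norm_e: "norm (e i m n) = 1" for i m n
    unfolding e_def by (simp add: norm_mult norm_power norm_nome)
  define b where "b m n = (\<Sum>\<^sub>\<infinity>i\<in>I. w i * e i m n) * a m n" for m n
  have main: "(\<lambda>i. w i * h (z + of_real (x i))) summable_on I \<and>
      (q_terms b z has_sum
        (\<Sum>\<^sub>\<infinity>i\<in>I. w i * h (z + of_real (x i)))) UNIV" if z: "Im z > 0" for z
  proof -
    define Q where "Q p = (q_terms a z p)" for p :: "nat \<times> nat"
    define G where "G u = w (fst u) * e (fst u) (fst (snd u)) (snd (snd u)) * Q (snd u)"
      for u :: "'i \<times> nat \<times> nat"
    have Qs: "Q summable_on UNIV"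
      using base(1)[OF z] unfolding Q_def[symmetric] by (rule has_sum_imp_summable)
    have wQ: "(\<lambda>u. norm (w (fst u)) * norm (Q (snd u))) summable_on (I \<times> UNIV)"
      using abs_summable_complexI[OF Qs] w
      by (intro has_sum_imp_summable[OF has_sum_product[OF has_sum_infsum _ has_sum_infsum]]) auto
    have "(\<lambda>u. norm (G u)) summable_on (I \<times> UNIV)"
      by (rule summable_on_comparison_test[OF wQ]) (auto simp: G_def norm_mult norm_e)
    then have Gs: "G summable_on (I \<times> UNIV)"
      by (rule abs_summable_summable)
    then obtain S where S: "(G has_sum S) (I \<times> UNIV)"
      by (auto simp: summable_on_def)
    have 1: "((\<lambda>i. w i * h (z + of_real (x i))) has_sum S) I"
    proof (rule has_sum_SigmaD[OF S])
      fix i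
      have "((\<lambda>p. w i * (q_terms a (z + of_real (x i)) p))
          has_sum (w i * h (z + of_real (x i)))) UNIV"
        by (rule has_sum_cmult_right) (rule base(1), use z in simp)
      then show "((\<lambda>p. G (i, p)) has_sum (w i * h (z + of_real (x i)))) UNIV"
        by (rule has_sum_cong[THEN iffD1, rotated])
           (auto simp: G_def Q_def e_def nome_shift power_mult_distrib mult_ac)
    qed
    have 2: "((\<lambda>p. (\<Sum>\<^sub>\<infinity>i\<in>I. w i * e i (fst p) (snd p)) * Q p) has_sum S) UNIV"
    proof (rule has_sum_SigmaD[where f = "\<lambda>(p, i). G (i, p)" and B = "\<lambda>_. I"])
      show "((\<lambda>(p, i). G (i, p)) has_sum S) (UNIV \<times> I)"
        using S by (subst (asm) has_sum_swap)
      fix p :: "nat \<times> nat"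
      have "(\<lambda>i. w i * e i (fst p) (snd p)) summable_on I"
        by (rule abs_summable_summable, rule summable_on_comparison_test[OF w])
           (auto simp: norm_mult norm_e)
      then have "((\<lambda>i. w i * e i (fst p) (snd p) * Q p) has_sum (\<Sum>\<^sub>\<infinity>i\<in>I. w i * e i (fst p) (snd p)) * Q p) I"
        by (intro has_sum_cmult_left has_sum_infsum)
      then show "((\<lambda>y. case (p, y) of (p, i) \<Rightarrow> G (i, p)) has_sum (\<Sum>\<^sub>\<infinity>i\<in>I. w i * e i (fst p) (snd p)) * Q p) I"
        by (simp add: G_def)
    qed
    have "(\<Sum>\<^sub>\<infinity>i\<in>I. w i * h (z + of_real (x i))) = S"
      using 1 by (rule infsumI)
    moreover have "(\<lambda>p. (\<Sum>\<^sub>\<infinity>i\<in>I. w i * e i (fst p) (snd p)) * Q p) =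
        (q_terms b z)"
      by (auto simp: fun_eq_iff Q_def b_def mult_ac)
    ultimately show ?thesis
      using 1 2 by (auto intro: has_sum_imp_summable)
  qed
  have eq: "w i * g (z + of_real (x i)) = of_real (Im z) powi j * (w i * h (z + of_real (x i)))"
    if "Im z > 0" for z i
    using base(2)[of "z + of_real (x i)"] that by simp
  show ?case
  proof (intro conjI allI impI)
    show "qexp (\<lambda>z. \<Sum>\<^sub>\<infinity>i\<in>I. w i * g (z + of_real (x i)))"
    proof (rule qexp.base[OF main[THEN conjunct2]])
      show "(\<Sum>\<^sub>\<infinity>i\<in>I. w i * g (z + of_real (x i))) =
          of_real (Im z) powi j * (\<Sum>\<^sub>\<infinity>i\<in>I. w i * h (z + of_real (x i)))" if "Im z > 0" for z
        by (simp only: eq[OF that] infsum_cmult_right')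
    qed
    show "(\<lambda>i. w i * g (z + of_real (x i))) summable_on I" if "Im z > 0" for z
      unfolding eq[OF that] using main[OF that] by (intro summable_on_cmult_right) auto
  qed
next
  case (add g1 g2 g)
  have eq: "w i * g (z + of_real (x i)) = w i * g1 (z + of_real (x i)) + w i * g2 (z + of_real (x i))"
    if "Im z > 0" for z i
    using add(3)[of "z + of_real (x i)"] that by (simp add: algebra_simps)
  show ?case
  proof (intro conjI allI impI)
    show "(\<lambda>i. w i * g (z + of_real (x i))) summable_on I" if "Im z > 0" for z
      unfolding eq[OF that] using add(4,5) that by (intro summable_on_add) auto
    show "qexp (\<lambda>z. \<Sum>\<^sub>\<infinity>i\<in>I. w i * g (z + of_real (x i)))"
    proof (rule qexp.add[OF add(4)[THEN conjunct1] add(5)[THEN conjunct1]])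
      show "(\<Sum>\<^sub>\<infinity>i\<in>I. w i * g (z + of_real (x i))) =
          (\<Sum>\<^sub>\<infinity>i\<in>I. w i * g1 (z + of_real (x i))) + (\<Sum>\<^sub>\<infinity>i\<in>I. w i * g2 (z + of_real (x i)))"
        if "Im z > 0" for z
        unfolding eq[OF that] using add(4,5) that by (intro infsum_add) auto
    qed
  qed
qed

lemmas qexp_average = qexp_average_aux[THEN conjunct1]

text \<open>A power series in \<open>q\<close> that converges on the whole upper half-plane converges absolutely there: compare
with the point at half the height.\<close>

lemma qexp_qseries:
  assumes "\<And>z. Im z > 0 \<Longrightarrow> (\<lambda>n. a n * nome z ^ n) sums h z"
  shows "qexp h"
proof (rule qexp.base[where j = 0])
  fix z :: complex assume z: "Im z > 0"
  let ?w = "z - \<i> * of_real (Im z / 2)"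
  have "summable (\<lambda>n. a n * nome ?w ^ n)"
    using assms[of ?w] z by (auto intro: sums_summable)
  moreover have "norm (nome z) < norm (nome ?w)"
    using z by (simp add: norm_nome)
  ultimately have "summable (\<lambda>n. norm (a n * nome z ^ n))"
    by (rule powser_insidea)
  from norm_summable_imp_has_sum[OF this assms[OF z]]
  have "((\<lambda>n. a n * nome z ^ n) has_sum h z) UNIV" .
  then have "((\<lambda>p. a (fst p) * nome z ^ fst p) has_sum h z) ((\<lambda>n. (n, 0 :: nat)) ` UNIV)"
    by (subst has_sum_reindex) (auto simp: inj_on_def o_def)
  then show "((\<lambda>(m, n). (if n = 0 then a m else 0) * nome z ^ m * cnj (nome z) ^ n) has_sum h z) UNIV"
    by (rule has_sum_cong_neutral[THEN iffD1, rotated -1]) (auto split: if_splits)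
qed auto

text \<open>Above height 1 the double series is bounded by the sum of its absolute terms at \<open>\<i>\<close>, so that only the
power of \<open>y\<close> can grow.\<close>

lemma qexp_growth:
  assumes "qexp g"
  shows "\<exists>C>0. \<exists>K\<ge>0. \<forall>z. Im z \<ge> 1 \<longrightarrow> norm (g z) \<le> K * Im z powr C"
  using assms
proof (induction rule: qexp.induct)
  case (base a h g j)
  define Q where "Q z p = (q_terms a z p)" for z and p :: "nat \<times> nat"
  define K where "K = (\<Sum>\<^sub>\<infinity>p. norm (Q \<i> p))"
  have Qs: "(\<lambda>p. norm (Q z p)) summable_on UNIV" if "Im z > 0" for z
    using base(1)[OF that] unfolding Q_def[symmetric] by (intro abs_summable_complexI has_sum_imp_summable)
  have h: "norm (h z) \<le> K" if z: "Im z \<ge> 1" for z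
  proof -
    have "(Q z has_sum h z) UNIV"
      using base(1)[of z] z by (simp add: Q_def[abs_def])
    then have "h z = infsum (Q z) UNIV"
      by (rule infsumI[symmetric])
    also have "norm \<dots> \<le> (\<Sum>\<^sub>\<infinity>p. norm (Q z p))"
      using Qs[of z] z by (intro norm_infsum_bound) auto
    also have "\<dots> \<le> K"
      unfolding K_def
    proof (rule infsum_mono)
      fix p :: "nat \<times> nat"
      obtain m n where p: "p = (m, n)" by (cases p)
      have "norm (nome z) ^ m * norm (nome z) ^ n \<le> norm (nome \<i>) ^ m * norm (nome \<i>) ^ n"
        using z by (intro mult_mono power_mono) (auto simp: norm_nome)
      then show "norm (Q z p) \<le> norm (Q \<i> p)"
        by (simp add: Q_def p norm_mult norm_power mult.assoc mult_left_mono)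
    qed (use Qs[of z] Qs[of \<i>] z in auto)
    finally show ?thesis .
  qed
  have "norm (g z) \<le> K * Im z powr (real (nat \<bar>j\<bar>) + 1)" if z: "Im z \<ge> 1" for z
  proof -
    have "Im z powi j \<le> Im z powi \<bar>j\<bar>"
      using z by (intro power_int_increasing) auto
    also have "\<dots> = Im z powr real (nat \<bar>j\<bar>)"
      using z powr_realpow[of "Im z" "nat \<bar>j\<bar>"] by (simp add: power_int_nonneg_exp)
    also have "\<dots> \<le> Im z powr (real (nat \<bar>j\<bar>) + 1)"
      using z by (intro powr_mono) auto
    finally have y: "Im z powi j \<le> Im z powr (real (nat \<bar>j\<bar>) + 1)" .
    have "norm (g z) = Im z powi j * norm (h z)"
      using base(2)[of z] z by (simp add: norm_mult norm_power_int)
    also have "\<dots> \<le> Im z powr (real (nat \<bar>j\<bar>) + 1) * K"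
      using y h[OF z] z by (intro mult_mono) auto
    finally show ?thesis by (simp add: mult.commute)
  qed
  moreover have "K \<ge> 0" unfolding K_def by (rule infsum_nonneg) auto
  ultimately show ?case
    by (intro exI[of _ "real (nat \<bar>j\<bar>) + 1"] conjI exI[of _ K]) auto
next
  case (add g1 g2 g)
  then obtain C1 C2 K1 K2 where C: "C1 > 0" "C2 > 0" "K1 \<ge> 0" "K2 \<ge> 0"
    "\<And>z. Im z \<ge> 1 \<Longrightarrow> norm (g1 z) \<le> K1 * Im z powr C1"
    "\<And>z. Im z \<ge> 1 \<Longrightarrow> norm (g2 z) \<le> K2 * Im z powr C2" by blast
  have "norm (g z) \<le> (K1 + K2) * Im z powr (C1 + C2)" if z: "Im z \<ge> 1" for z
  proof -
    have "norm (g z) \<le> norm (g1 z) + norm (g2 z)"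
      using add(3)[of z] z by (simp add: norm_triangle_ineq)
    also have "\<dots> \<le> K1 * Im z powr C1 + K2 * Im z powr C2"
      using C z by (intro add_mono) auto
    also have "\<dots> \<le> K1 * Im z powr (C1 + C2) + K2 * Im z powr (C1 + C2)"
      using C z by (intro add_mono mult_left_mono powr_mono) auto
    finally show ?thesis by (simp add: algebra_simps)
  qed
  then show ?case
    using C by (intro exI[of _ "C1 + C2"] conjI exI[of _ "K1 + K2"]) auto
qed

section \<open>Real analyticity\<close>

abbreviation power_terms ::
  "(nat \<Rightarrow> nat \<Rightarrow> complex) \<Rightarrow> complex \<Rightarrow> complex \<Rightarrow> nat \<times> nat \<Rightarrow> complex" where
  "power_terms c z0 z \<equiv> \<lambda>(m, n). c m n * complex_of_real (Re (z - z0)) ^ m * complex_of_real (Im (z - z0)) ^ n"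

definition analytic_near :: "(complex \<Rightarrow> complex) \<Rightarrow> complex \<Rightarrow> bool" where
  "analytic_near g z0 \<longleftrightarrow> (\<exists>\<epsilon>>0. \<exists>c :: nat \<Rightarrow> nat \<Rightarrow> complex. \<forall>z\<in>ball z0 \<epsilon>.
     (power_terms c z0 z has_sum g z) UNIV)"

lemma analytic_nearE:
  assumes "analytic_near g z0"
  obtains \<epsilon> c where "\<epsilon> > 0" "\<And>z. z \<in> ball z0 \<epsilon> \<Longrightarrow>
     (power_terms c z0 z has_sum g z) UNIV"
  using assms unfolding analytic_near_def by blast

lemma analytic_nearI:
  assumes "\<epsilon> > 0" "\<And>z. z \<in> ball z0 \<epsilon> \<Longrightarrow>
     (power_terms c z0 z has_sum g z) UNIV"
  shows "analytic_near g z0"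
  using assms unfolding analytic_near_def by blast

lemma analytic_near_cong:
  assumes "analytic_near g z0" "\<delta> > 0" "\<And>z. z \<in> ball z0 \<delta> \<Longrightarrow> g' z = g z"
  shows "analytic_near g' z0"
proof -
  obtain \<epsilon> c where "\<epsilon> > 0" "\<And>z. z \<in> ball z0 \<epsilon> \<Longrightarrow>
     (power_terms c z0 z has_sum g z) UNIV"
    using analytic_nearE[OF assms(1)] by blast
  then show ?thesis
    using assms(2,3) by (intro analytic_nearI[of "min \<epsilon> \<delta>" z0 c]) auto
qed

lemma analytic_near_add:
  assumes "analytic_near f z0" "analytic_near g z0"
  shows "analytic_near (\<lambda>z. f z + g z) z0"
proof -
  obtain \<epsilon> c where c: "\<epsilon> > 0" "\<And>z. z \<in> ball z0 \<epsilon> \<Longrightarrow>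
     (power_terms c z0 z has_sum f z) UNIV"
    using analytic_nearE[OF assms(1)] by blast
  obtain \<delta> d where d: "\<delta> > 0" "\<And>z. z \<in> ball z0 \<delta> \<Longrightarrow>
     (power_terms d z0 z has_sum g z) UNIV"
    using analytic_nearE[OF assms(2)] by blast
  show ?thesis
  proof (rule analytic_nearI[of "min \<epsilon> \<delta>" z0 "\<lambda>m n. c m n + d m n"])
    fix z assume "z \<in> ball z0 (min \<epsilon> \<delta>)"
    then have "z \<in> ball z0 \<epsilon>" "z \<in> ball z0 \<delta>" by auto
    from has_sum_add[OF c(2)[OF this(1)] d(2)[OF this(2)]]
    show "((\<lambda>(m, n). (c m n + d m n) * of_real (Re (z - z0)) ^ m * of_real (Im (z - z0)) ^ n)
            has_sum f z + g z) UNIV"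
      by (simp add: case_prod_unfold algebra_simps)
  qed (use c d in auto)
qed

lemma analytic_near_mult:
  assumes "analytic_near f z0" "analytic_near g z0"
  shows "analytic_near (\<lambda>z. f z * g z) z0"
proof -
  obtain \<epsilon> c where c: "\<epsilon> > 0" "\<And>z. z \<in> ball z0 \<epsilon> \<Longrightarrow>
     (power_terms c z0 z has_sum f z) UNIV"
    using analytic_nearE[OF assms(1)] by blast
  obtain \<delta> d where d: "\<delta> > 0" "\<And>z. z \<in> ball z0 \<delta> \<Longrightarrow>
     (power_terms d z0 z has_sum g z) UNIV"
    using analytic_nearE[OF assms(2)] by blast
  show ?thesis
    by (rule analytic_nearI[of "min \<epsilon> \<delta>" z0 "double_conv c d"],
        use c d in simp, rule double_power_series_mult) (use c d in auto)
qed

lemma analytic_near_monom: "analytic_near (\<lambda>z. c * of_real (Re (z - z0)) ^ m * of_real (Im (z - z0)) ^ n) z0"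
  by (rule analytic_nearI[of 1], simp, rule double_power_series_monom)

lemma analytic_near_const: "analytic_near (\<lambda>z. c) z0"
  using analytic_near_monom[of c z0 0 0] by simp

lemma double_series_of_single:
  fixes X Y :: complex
  assumes "((\<lambda>n. a n * Y ^ n) has_sum S) UNIV"
  shows "((\<lambda>(m, n). (if m = 0 then a n else 0) * X ^ m * Y ^ n) has_sum S) UNIV"
proof -
  have "((\<lambda>p. a (snd p) * Y ^ snd p) has_sum S) ((\<lambda>n. (0 :: nat, n)) ` UNIV)"
    using assms by (subst has_sum_reindex) (auto simp: inj_on_def o_def)
  then show ?thesis
    by (rule has_sum_cong_neutral[THEN iffD1, rotated -1]) (auto split: if_splits)
qed

lemma analytic_near_inverse_y:
  assumes "Im z0 > 0"
  shows "analytic_near (\<lambda>z. inverse (of_real (Im z))) z0"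
proof (rule analytic_nearI)
  fix z assume "z \<in> ball z0 (Im z0)"
  then have "\<bar>Im (z - z0)\<bar> < Im z0"
    using abs_Im_le_cmod[of "z - z0"] by (simp add: dist_norm norm_minus_commute)
  define r where "r = - Im (z - z0) / Im z0"
  have r: "norm r < 1" unfolding r_def using \<open>\<bar>Im (z - z0)\<bar> < Im z0\<close> by (simp add: abs_divide)
  have eq: "inverse (Im z0) * (1 / (1 - r)) = inverse (Im z)"
  proof -
    have "Im z0 * (1 - r) = Im z" unfolding r_def using assms by (simp add: field_simps)
    then show ?thesis by (metis divide_inverse inverse_mult_distrib mult_1)
  qed
  have "((\<lambda>n. r ^ n) has_sum (1 / (1 - r))) UNIV"
    using geometric_sums[OF r] r summable_geometric[of "norm r"]
    by (intro norm_summable_imp_has_sum) (auto simp: power_abs)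
  then have "((\<lambda>n. inverse (Im z0) * r ^ n) has_sum inverse (Im z)) UNIV"
    unfolding eq[symmetric] by (rule has_sum_cmult_right)
  then have "((\<lambda>n. complex_of_real (inverse (Im z0) * r ^ n)) has_sum of_real (inverse (Im z))) UNIV"
    by (rule has_sum_of_real)
  moreover have "complex_of_real (inverse (Im z0) * r ^ n) =
      inverse (of_real (Im z0)) * (- inverse (of_real (Im z0))) ^ n * complex_of_real (Im (z - z0)) ^ n" for n
  proof -
    have "r = - inverse (Im z0) * Im (z - z0)" using assms unfolding r_def by (simp add: divide_simps)
    then have "r ^ n = (- inverse (Im z0)) ^ n * Im (z - z0) ^ n"
      by (simp only: power_mult_distrib)
    then show ?thesis by simp
  qed
  ultimately have "((\<lambda>n. inverse (of_real (Im z0)) * (- inverse (of_real (Im z0))) ^ n * complex_of_real (Im (z - z0)) ^ n)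
      has_sum inverse (of_real (Im z))) UNIV"
    by (simp only: of_real_inverse)
  from double_series_of_single[OF this]
  show "((\<lambda>(m, n). (if m = 0 then inverse (complex_of_real (Im z0)) * (- inverse (complex_of_real (Im z0))) ^ n else 0) *
      complex_of_real (Re (z - z0)) ^ m * complex_of_real (Im (z - z0)) ^ n) has_sum inverse (complex_of_real (Im z))) UNIV" .
qed fact

lemma analytic_near_y: "analytic_near (\<lambda>z. of_real (Im z)) z0"
  by (rule analytic_near_cong[OF analytic_near_add[OF analytic_near_const[of "of_real (Im z0)"]
       analytic_near_monom[of 1 z0 0 1]], of 1]) auto

lemma analytic_near_power: "analytic_near f z0 \<Longrightarrow> analytic_near (\<lambda>z. f z ^ n) z0"
  by (induction n) (auto intro: analytic_near_const analytic_near_mult)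

lemma analytic_near_y_powi:
  assumes "Im z0 > 0"
  shows "analytic_near (\<lambda>z. of_real (Im z) powi j) z0"
  using analytic_near_power[OF analytic_near_y] analytic_near_power[OF analytic_near_inverse_y[OF assms]]
  by (cases "j \<ge> 0") (simp_all add: power_int_def)

text \<open>Write \<open>z = z0 + s + \<i> t\<close>. Each term \<open>q^m * cnj q^n\<close> is its value at \<open>z0\<close> times an exponential in \<open>s\<close> times
an exponential in \<open>t\<close>. Expanding both gives a fourfold series. For \<open>s, t\<close> of modulus at most
\<open>Im z0 / 4\<close> the absolute values of its terms add up to at most the double series at height
\<open>Im z0 / 2\<close>; so it may be summed over \<open>(m, n)\<close> first, which leaves a power series in \<open>s\<close> and \<open>t\<close>.\<close>

lemma analytic_near_double_q_series:
  assumes h: "\<And>z. Im z > 0 \<Longrightarrow> (q_terms a z has_sum h z) UNIV"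
    and z0: "Im z0 > 0"
  shows "analytic_near h z0"
proof -
  define \<sigma> \<tau> :: "nat \<times> nat \<Rightarrow> complex"
    where "\<sigma> p = 2 * of_real pi * \<i> * (of_nat (fst p) - of_nat (snd p))"
      and "\<tau> p = - 2 * of_real pi * (of_nat (fst p) + of_nat (snd p))" for p
  define Q where "Q z p = (q_terms a z p)" for z p
  define c where "c u v = (\<Sum>\<^sub>\<infinity>p. Q z0 p * (\<sigma> p ^ u / fact u) * (\<tau> p ^ v / fact v))" for u v
  have Qs: "(\<lambda>p. norm (Q z p)) summable_on UNIV" if "Im z > 0" for z
    using h[OF that] unfolding Q_def[symmetric] by (intro abs_summable_complexI has_sum_imp_summable)
  show ?thesis
  proof (rule analytic_nearI[of "Im z0 / 4" z0 c])
    fix z assume "z \<in> ball z0 (Im z0 / 4)"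
    then have "norm (z - z0) < Im z0 / 4" by (simp add: dist_norm norm_minus_commute)
    then have s: "\<bar>Re (z - z0)\<bar> \<le> Im z0 / 4" and t: "\<bar>Im (z - z0)\<bar> \<le> Im z0 / 4"
      using abs_Re_le_cmod[of "z - z0"] abs_Im_le_cmod[of "z - z0"] by linarith+
    define s t where "s = Re (z - z0)" and "t = Im (z - z0)"
    have s': "\<bar>s\<bar> \<le> Im z0 / 4" and t': "\<bar>t\<bar> \<le> Im z0 / 4"
      using s t unfolding s_def t_def .
    have zst: "z = z0 + of_real s + \<i> * of_real t"
      unfolding s_def t_def by (simp add: complex_eq_iff)
    have z: "Im z > 0" using t' z0 by (simp add: zst)
    define G where "G u = Q z0 (fst u) * ((\<sigma> (fst u) * of_real s) ^ fst (snd u) / fact (fst (snd u)) *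
        ((\<tau> (fst u) * of_real t) ^ snd (snd u) / fact (snd (snd u))))" for u :: "(nat \<times> nat) \<times> nat \<times> nat"
    have Qz: "Q z p = Q z0 p * (exp (\<sigma> p * of_real s) * exp (\<tau> p * of_real t))" for p
    proof (cases p)
      case (Pair m n)
      have *: "2 * of_real pi * \<i> * (of_nat m * z - of_nat n * cnj z) =
          2 * of_real pi * \<i> * (of_nat m * z0 - of_nat n * cnj z0) + \<sigma> p * of_real s + \<tau> p * of_real t"
        unfolding zst \<sigma>_def \<tau>_def Pair by (simp add: algebra_simps)
      have "nome z ^ m * cnj (nome z) ^ n =
          nome z0 ^ m * cnj (nome z0) ^ n * (exp (\<sigma> p * of_real s) * exp (\<tau> p * of_real t))"
        unfolding nome_powers * exp_add by (simp only: mult.assoc)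
      then show ?thesis
        by (simp add: Q_def Pair mult.assoc)
    qed
    have in1: "((\<lambda>q. G (p, q)) has_sum Q z p) UNIV" for p
    proof -
      have "((\<lambda>q. (\<sigma> p * of_real s) ^ fst q / fact (fst q) * ((\<tau> p * of_real t) ^ snd q / fact (snd q)))
          has_sum (exp (\<sigma> p * of_real s) * exp (\<tau> p * of_real t))) (UNIV \<times> UNIV)"
        by (rule has_sum_product) (rule has_sum_exp)+
      from has_sum_cmult_right[OF this, of "Q z0 p"] show ?thesis
        unfolding Qz G_def by simp
    qed
    have in2: "((\<lambda>q. norm (G (p, q))) has_sum
        (norm (Q z0 p) * (exp (norm (\<sigma> p * of_real s)) * exp (norm (\<tau> p * of_real t))))) UNIV" for p
    proof -
      have "((\<lambda>q. norm (\<sigma> p * of_real s) ^ fst q / fact (fst q) * (norm (\<tau> p * of_real t) ^ snd q / fact (snd q)))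
          has_sum (exp (norm (\<sigma> p * of_real s)) * exp (norm (\<tau> p * of_real t)))) (UNIV \<times> UNIV)"
        by (rule has_sum_product) (rule has_sum_exp)+
      from has_sum_cmult_right[OF this, of "norm (Q z0 p)"] show ?thesis
        unfolding G_def by (simp add: norm_mult norm_divide norm_power)
    qed
    have bound: "norm (Q z0 p) * (exp (norm (\<sigma> p * of_real s)) * exp (norm (\<tau> p * of_real t)))
        \<le> norm (Q (\<i> * of_real (Im z0 / 2)) p)" for p
    proof (cases p)
      case (Pair m n)
      have "norm (\<sigma> p * of_real s) \<le> 2 * pi * (real m + real n) * (Im z0 / 4)"
      proof -
        have "norm (\<sigma> p) = 2 * pi * \<bar>real m - real n\<bar>"
          unfolding \<sigma>_def Pair
          by (simp add: norm_mult del: of_nat_diff) (metis norm_of_real of_real_diff of_real_of_nat_eq)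
        also have "\<dots> \<le> 2 * pi * (real m + real n)" by (intro mult_left_mono) auto
        finally have "norm (\<sigma> p) * \<bar>s\<bar> \<le> 2 * pi * (real m + real n) * (Im z0 / 4)"
          using s' by (rule mult_mono) (auto intro: mult_nonneg_nonneg)
        then show ?thesis by (simp add: norm_mult)
      qed
      moreover have "norm (\<tau> p * of_real t) \<le> 2 * pi * (real m + real n) * (Im z0 / 4)"
      proof -
        have "norm (\<tau> p) = 2 * pi * (real m + real n)"
          unfolding \<tau>_def Pair
          by (simp add: norm_mult) (metis abs_of_nat norm_of_nat of_nat_add)
        then have "norm (\<tau> p) * \<bar>t\<bar> \<le> 2 * pi * (real m + real n) * (Im z0 / 4)"
          using t' by (intro mult_mono) auto
        then show ?thesis by (simp add: norm_mult)
      qed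
      ultimately have "exp (norm (\<sigma> p * of_real s)) * exp (norm (\<tau> p * of_real t)) \<le>
          exp (2 * pi * (real m + real n) * (Im z0 / 2))"
        unfolding exp_add[symmetric] exp_le_cancel_iff by argo
      then have "norm (Q z0 p) * (exp (norm (\<sigma> p * of_real s)) * exp (norm (\<tau> p * of_real t))) \<le>
          norm (Q z0 p) * exp (2 * pi * (real m + real n) * (Im z0 / 2))"
        by (rule mult_left_mono) simp
      also have "\<dots> = norm (Q (\<i> * of_real (Im z0 / 2)) p)"
        by (simp add: Q_def Pair norm_mult norm_power norm_nome exp_of_nat_mult[symmetric] exp_add[symmetric] mult.assoc)
           (simp add: algebra_simps)
      finally show ?thesis .
    qed
    have "(\<lambda>u. norm (G u)) summable_on (UNIV \<times> UNIV)"
    proof (rule summable_on_SigmaI[OF in2])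
      show "(\<lambda>p. norm (Q z0 p) * (exp (norm (\<sigma> p * of_real s)) * exp (norm (\<tau> p * of_real t)))) summable_on UNIV"
        by (rule summable_on_comparison_test[OF Qs[of "\<i> * of_real (Im z0 / 2)"] bound]) (use z0 in auto)
    qed auto
    then have Gs: "G summable_on (UNIV \<times> UNIV)" by (rule abs_summable_summable)
    have "(Q z has_sum h z) UNIV" using h[OF z] by (simp add: Q_def[abs_def])
    then have S: "(G has_sum h z) (UNIV \<times> UNIV)"
      by (rule has_sum_SigmaI[OF in1]) (rule Gs)
    then have S': "((\<lambda>(q, p). G (p, q)) has_sum h z) (UNIV \<times> UNIV)"
      by (subst (asm) has_sum_swap)
    have "((\<lambda>q. \<Sum>\<^sub>\<infinity>p. G (p, q)) has_sum h z) UNIV"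
    proof (rule has_sum_SigmaD[OF S'])
      fix q :: "nat \<times> nat"
      have "(\<lambda>(q, p). G (p, q)) summable_on Sigma UNIV (\<lambda>_. UNIV)"
        using S' by (rule has_sum_imp_summable)
      then have "(\<lambda>(q, p). G (p, q)) summable_on ((\<lambda>p. (q, p)) ` UNIV)"
        by (rule summable_on_subset) auto
      then have "(\<lambda>p. G (p, q)) summable_on UNIV"
        by (subst (asm) summable_on_reindex) (auto simp: inj_on_def o_def)
      then show "((\<lambda>p. case (q, p) of (q, p) \<Rightarrow> G (p, q)) has_sum (\<Sum>\<^sub>\<infinity>p. G (p, q))) UNIV"
        by simp
    qed
    also have "(\<lambda>q. \<Sum>\<^sub>\<infinity>p. G (p, q)) = (\<lambda>(u, v). c u v * of_real s ^ u * of_real t ^ v)"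
    proof
      fix q :: "nat \<times> nat"
      obtain u v where q: "q = (u, v)" by (cases q)
      have "(\<Sum>\<^sub>\<infinity>p. G (p, q)) = (\<Sum>\<^sub>\<infinity>p. Q z0 p * (\<sigma> p ^ u / fact u) * (\<tau> p ^ v / fact v) * (of_real s ^ u * of_real t ^ v))"
        by (rule infsum_cong) (simp add: G_def q power_mult_distrib)
      also have "\<dots> = c u v * (of_real s ^ u * of_real t ^ v)"
        unfolding c_def by (rule infsum_cmult_left')
      finally show "(\<Sum>\<^sub>\<infinity>p. G (p, q)) = (case q of (u, v) \<Rightarrow> c u v * of_real s ^ u * of_real t ^ v)"
        by (simp add: q mult.assoc)
    qed
    finally show "(power_terms c z0 z has_sum h z) UNIV"
      by (simp add: s_def t_def)
  qed (use z0 in auto)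
qed

lemma ball_subset_uhp: "Im z0 > 0 \<Longrightarrow> z \<in> ball z0 (Im z0) \<Longrightarrow> Im z > 0"
  using abs_Im_le_cmod[of "z - z0"] by (simp add: dist_norm norm_minus_commute)

lemma qexp_analytic_near:
  assumes "qexp g" "Im z0 > 0"
  shows "analytic_near g z0"
  using assms
proof (induction rule: qexp.induct)
  case (base a h g j)
  show ?case
    by (rule analytic_near_cong[OF analytic_near_mult[OF analytic_near_y_powi[OF base(3), of j]
          analytic_near_double_q_series[OF base(1) base(3)]], of "Im z0"])
       (use base(3) in \<open>simp_all only: base(2)[OF ball_subset_uhp[OF base(3)]]\<close>)
next
  case (add g1 g2 g)
  show ?case
    by (rule analytic_near_cong[OF analytic_near_add[OF add(4)[OF add(6)] add(5)[OF add(6)]], of "Im z0"])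
       (use add(6) in \<open>simp_all only: add(3)[OF ball_subset_uhp[OF add(6)]]\<close>)
qed

lemma qexp_real_analytic: "qexp g \<Longrightarrow> real_analytic_uhp g"
  using qexp_analytic_near unfolding real_analytic_uhp_def analytic_near_def upper_half_plane_def by simp

section \<open>Wirtinger derivatives of expansions\<close>

text \<open>The derivative as a real-linear map in the coordinates \<open>d\<close> and \<open>cnj d\<close>: the two coefficients are the
Wirtinger derivatives.\<close>

abbreviation has_wirtinger :: "(complex \<Rightarrow> complex) \<Rightarrow> complex \<Rightarrow> complex \<Rightarrow> complex \<Rightarrow> bool" where
  "has_wirtinger f A B z \<equiv> (f has_derivative (\<lambda>d. A * d + B * cnj d)) (at z)"

text \<open>Termwise differentiation multiplies coefficients by \<open>m\<close> or \<open>n\<close>. The estimate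
\<open>N \<le> exp (\<pi> y N) / (\<pi> y)\<close> trades such a factor for the passage from height \<open>y\<close> to height \<open>y / 2\<close>.\<close>

lemma q_coeffs_times_index_summable:
  assumes a: "\<And>z. Im z > 0 \<Longrightarrow> q_terms a z summable_on UNIV"
    and z: "Im z > 0"
  shows "(\<lambda>(m, n). (real m + real n) * norm (a m n) * norm (nome z) ^ m * norm (nome z) ^ n) summable_on UNIV"
proof -
  let ?w = "\<i> * of_real (Im z / 2)"
  have "(\<lambda>p. 1 / (pi * Im z) * norm (q_terms a ?w p)) summable_on UNIV"
    using a[of ?w] z by (intro summable_on_cmult_right abs_summable_complexI) auto
  then show ?thesis
  proof (rule summable_on_comparison_test)
    fix p :: "nat \<times> nat"
    obtain m n where p: "p = (m, n)" by (cases p)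
    define N where "N = real m + real n"
    have "pi * Im z * N \<le> exp (pi * Im z * N)"
      using exp_ge_add_one_self[of "pi * Im z * N"] by linarith
    then have "N \<le> 1 / (pi * Im z) * exp (pi * Im z * N)"
      using z by (simp add: field_simps)
    then have "N * (norm (a m n) * exp (- (2 * pi * Im z * N))) \<le>
        1 / (pi * Im z) * exp (pi * Im z * N) * (norm (a m n) * exp (- (2 * pi * Im z * N)))"
      by (rule mult_right_mono) simp
    also have "\<dots> = 1 / (pi * Im z) * (norm (a m n) * exp (- (pi * Im z * N)))"
      by (simp add: exp_add[symmetric])
    finally show "(case p of (m, n) \<Rightarrow> (real m + real n) * norm (a m n) * norm (nome z) ^ m * norm (nome z) ^ n)
      \<le> 1 / (pi * Im z) * norm (q_terms a ?w p)"
      by (simp add: p N_def norm_mult norm_power norm_nome exp_of_nat_mult[symmetric] exp_add[symmetric] mult.assoc)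
         (simp add: algebra_simps)
  qed (auto simp: case_prod_unfold)
qed

lemma has_derivative_exp_complex:
  fixes g :: "complex \<Rightarrow> complex"
  assumes "(g has_derivative g') (at z)"
  shows "((\<lambda>z. exp (g z)) has_derivative (\<lambda>d. g' d * exp (g z))) (at z)"
  using has_derivative_compose[OF assms DERIV_exp[of "g z", unfolded has_field_derivative_def]]
  by (simp add: mult.commute)

lemma has_wirtinger_q_term:
  "has_wirtinger (\<lambda>z. a * nome z ^ m * cnj (nome z) ^ n)
     (2 * of_real pi * \<i> * of_nat m * (a * nome z ^ m * cnj (nome z) ^ n))
     (- 2 * of_real pi * \<i> * of_nat n * (a * nome z ^ m * cnj (nome z) ^ n)) z"
proof -
  have "((\<lambda>z. a * exp (2 * of_real pi * \<i> * (of_nat m * z - of_nat n * cnj z))) has_derivative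
      (\<lambda>d. 2 * of_real pi * \<i> * of_nat m * (a * exp (2 * of_real pi * \<i> * (of_nat m * z - of_nat n * cnj z))) * d +
        - 2 * of_real pi * \<i> * of_nat n * (a * exp (2 * of_real pi * \<i> * (of_nat m * z - of_nat n * cnj z))) * cnj d)) (at z)"
  proof -
    have cnj: "(cnj has_derivative cnj) (at z)"
      by (rule bounded_linear_imp_has_derivative[OF bounded_linear_cnj])
    have "((\<lambda>z. a * exp (2 * of_real pi * \<i> * (of_nat m * z - of_nat n * cnj z))) has_derivative
        (\<lambda>d. a * (2 * of_real pi * \<i> * (of_nat m * d - of_nat n * cnj d) *
          exp (2 * of_real pi * \<i> * (of_nat m * z - of_nat n * cnj z))))) (at z)"
      by (intro has_derivative_mult_right has_derivative_exp_complex has_derivative_diff has_derivative_ident cnj)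
    then show ?thesis
      by (rule has_derivative_eq_rhs) (simp add: fun_eq_iff algebra_simps)
  qed
  then show ?thesis
    unfolding mult.assoc nome_powers .
qed

text \<open>Termwise differentiation. On the half-plane above \<open>Im z0 / 2\<close> the derivatives of the terms are dominated
by a convergent series of constants. The double series is enumerated by \<open>prod_decode\<close> because the
theorem on differentiating a series is about sequences of partial sums.\<close>

lemma has_wirtinger_double_q_series:
  assumes h: "\<And>z. Im z > 0 \<Longrightarrow> (q_terms a z has_sum h z) UNIV"
  shows "\<exists>A B. qexp A \<and> qexp B \<and> (\<forall>z. Im z > 0 \<longrightarrow> has_wirtinger h (A z) (B z) z)"
proof -
  define a1 where "a1 m n = 2 * of_real pi * \<i> * of_nat m * a m n" for m n
  define a2 where "a2 m n = - 2 * of_real pi * \<i> * of_nat n * a m n" for m n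
  define T where "T b z p = (q_terms b z p)"
    for b :: "nat \<Rightarrow> nat \<Rightarrow> complex" and z and p :: "nat \<times> nat"
  define M where "M y p = (case p of (m, n) \<Rightarrow> 2 * pi * ((real m + real n) * norm (a m n) * exp (- 2 * pi * y) ^ m * exp (- 2 * pi * y) ^ n))"
    for y p
  have Msum: "M y summable_on UNIV" if "y > 0" for y
  proof -
    have "(\<lambda>(m, n). (real m + real n) * norm (a m n) * norm (nome (\<i> * of_real y)) ^ m * norm (nome (\<i> * of_real y)) ^ n) summable_on UNIV"
      by (rule q_coeffs_times_index_summable) (use h that in \<open>auto intro: has_sum_imp_summable\<close>)
    then have "(\<lambda>p. 2 * pi * (case p of (m, n) \<Rightarrow> (real m + real n) * norm (a m n) * exp (- 2 * pi * y) ^ m * exp (- 2 * pi * y) ^ n)) summable_on UNIV"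
      by (intro summable_on_cmult_right) (simp add: norm_nome)
    then show ?thesis
      by (simp add: M_def[abs_def] case_prod_unfold)
  qed
  have le: "norm (T b z p) \<le> M y p" if "y \<le> Im z" "b = a1 \<or> b = a2" for b z y p
  proof (cases p)
    case (Pair m n)
    have "norm (b m n) \<le> 2 * pi * ((real m + real n) * norm (a m n))"
      using that(2) by (auto simp: a1_def a2_def norm_mult intro!: mult_right_mono)
    moreover have "norm (nome z) ^ m * norm (nome z) ^ n \<le> exp (- 2 * pi * y) ^ m * exp (- 2 * pi * y) ^ n"
      using that(1) by (intro mult_mono power_mono) (auto simp: norm_nome)
    ultimately have "norm (b m n) * (norm (nome z) ^ m * norm (nome z) ^ n) \<le>
        2 * pi * ((real m + real n) * norm (a m n)) * (exp (- 2 * pi * y) ^ m * exp (- 2 * pi * y) ^ n)"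
      by (rule mult_mono) auto
    then show ?thesis
      by (simp add: T_def M_def Pair norm_mult norm_power mult.assoc)
  qed
  have Tsum: "T b z summable_on UNIV" if "Im z > 0" "b = a1 \<or> b = a2" for b z
    by (rule abs_summable_summable, rule summable_on_comparison_test[OF Msum[OF that(1)] le]) (use that in auto)
  have Thas: "(q_terms b z has_sum infsum (T b z) UNIV) UNIV"
    if "Im z > 0" "b = a1 \<or> b = a2" for b z
    using Tsum[OF that] by (simp add: T_def[abs_def])
  have bij: "bij_betw prod_decode UNIV UNIV"
    by (rule bij_prod_decode)
  have nat_sums: "(\<lambda>i. F (prod_decode i)) sums S" if "(F has_sum S) UNIV" for F :: "nat \<times> nat \<Rightarrow> complex" and S
    by (rule has_sum_imp_sums) (use that has_sum_reindex_bij_betw[OF bij, of F S] in simp)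
  have deriv: "has_wirtinger h (infsum (T a1 z0) UNIV) (infsum (T a2 z0) UNIV) z0" if z0: "Im z0 > 0" for z0
  proof -
    define y where "y = Im z0 / 2"
    define S where "S = {z. Im z > y}"
    have y: "y > 0" and z0S: "z0 \<in> S" using z0 by (auto simp: y_def S_def)
    have opS: "open S" unfolding S_def by (rule open_halfspace_Im_gt)
    have uhpS: "Im z > 0" if "z \<in> S" for z using that y by (auto simp: S_def)
    have unif: "uniform_limit S (\<lambda>n z. \<Sum>i<n. T b z (prod_decode i)) (\<lambda>z. infsum (T b z) UNIV) sequentially"
      if b: "b = a1 \<or> b = a2" for b
    proof -
      have "uniform_limit S (\<lambda>n z. \<Sum>i<n. T b z (prod_decode i)) (\<lambda>z. suminf (\<lambda>i. T b z (prod_decode i))) sequentially"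
      proof (rule Weierstrass_m_test)
        show "norm (T b z (prod_decode i)) \<le> M y (prod_decode i)" if "z \<in> S" for i z
          using that b by (intro le) (auto simp: S_def)
        have "(\<lambda>i. M y (prod_decode i)) summable_on UNIV"
          using Msum[OF y] summable_on_reindex_bij_betw[OF bij, of "M y"] by simp
        then show "summable (\<lambda>i. M y (prod_decode i))" by (rule summable_on_imp_summable)
      qed
      moreover have "suminf (\<lambda>i. T b z (prod_decode i)) = infsum (T b z) UNIV" if "z \<in> S" for z
        by (intro sums_unique[symmetric] nat_sums has_sum_infsum Tsum uhpS that b)
      ultimately show ?thesis
        by (rule uniform_limit_cong'[OF refl, THEN iffD1, rotated])
    qed
    have "\<exists>g. \<forall>z\<in>S. (\<lambda>i. T a z (prod_decode i)) sums g z \<and>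
        (g has_derivative (\<lambda>d. infsum (T a1 z) UNIV * d + infsum (T a2 z) UNIV * cnj d)) (at z within S)"
    proof (rule has_derivative_series)
      show "convex S" unfolding S_def by (rule convex_halfspace_Im_gt)
      show "((\<lambda>z. T a z (prod_decode i)) has_derivative
          (\<lambda>d. T a1 z (prod_decode i) * d + T a2 z (prod_decode i) * cnj d)) (at z within S)" for i z
      proof -
        obtain m n where p: "prod_decode i = (m, n)" by (cases "prod_decode i")
        from has_derivative_at_withinI[OF has_wirtinger_q_term[of "a m n" m n z]] show ?thesis
          by (simp only: T_def p prod.case a1_def a2_def mult.assoc)
      qed
      show "\<forall>\<^sub>F n in sequentially. \<forall>z\<in>S. \<forall>d::complex. norm ((\<Sum>i<n. T a1 z (prod_decode i) * d + T a2 z (prod_decode i) * cnj d) -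
          (infsum (T a1 z) UNIV * d + infsum (T a2 z) UNIV * cnj d)) \<le> e * norm d" if e: "e > 0" for e
      proof -
        have "\<forall>\<^sub>F n in sequentially. \<forall>z\<in>S. dist (\<Sum>i<n. T b z (prod_decode i)) (infsum (T b z) UNIV) < e / 2"
          if "b = a1 \<or> b = a2" for b
          using uniform_limitD[OF unif[OF that], of "e / 2"] e by simp
        from this[of a1, simplified] this[of a2, simplified] show ?thesis
        proof eventually_elim
          case (elim n)
          show ?case
          proof (intro ballI allI)
            fix z d :: complex assume z: "z \<in> S"
            define U V where "U = (\<Sum>i<n. T a1 z (prod_decode i)) - infsum (T a1 z) UNIV"
              and "V = (\<Sum>i<n. T a2 z (prod_decode i)) - infsum (T a2 z) UNIV"
            have "norm U \<le> e / 2" "norm V \<le> e / 2"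
              using elim z by (auto simp: U_def V_def dist_norm less_imp_le)
            then have "norm U * norm d + norm V * norm d \<le> e / 2 * norm d + e / 2 * norm d"
              by (intro add_mono mult_right_mono) auto
            moreover have "norm (U * d + V * cnj d) \<le> norm U * norm d + norm V * norm d"
              using norm_triangle_ineq[of "U * d" "V * cnj d"] by (simp add: norm_mult)
            ultimately have "norm (U * d + V * cnj d) \<le> e * norm d" by simp
            moreover have "(\<Sum>i<n. T a1 z (prod_decode i) * d + T a2 z (prod_decode i) * cnj d) -
              (infsum (T a1 z) UNIV * d + infsum (T a2 z) UNIV * cnj d) = U * d + V * cnj d"
              by (simp add: U_def V_def sum.distrib sum_distrib_left algebra_simps)
            ultimately show "norm ((\<Sum>i<n. T a1 z (prod_decode i) * d + T a2 z (prod_decode i) * cnj d) -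
              (infsum (T a1 z) UNIV * d + infsum (T a2 z) UNIV * cnj d)) \<le> e * norm d" by simp
          qed
        qed
      qed
      show "z0 \<in> S" by fact
      show "(\<lambda>i. T a z0 (prod_decode i)) sums h z0"
        using nat_sums[OF h[OF z0]] by (simp add: T_def)
    qed
    then obtain g where g: "\<And>z. z \<in> S \<Longrightarrow> (\<lambda>i. T a z (prod_decode i)) sums g z"
      "\<And>z. z \<in> S \<Longrightarrow> (g has_derivative (\<lambda>d. infsum (T a1 z) UNIV * d + infsum (T a2 z) UNIV * cnj d)) (at z within S)"
      by blast
    have gh: "g z = h z" if "z \<in> S" for z
    proof (rule sums_unique2[OF g(1)[OF that]])
      show "(\<lambda>i. T a z (prod_decode i)) sums h z"
        using nat_sums[OF h[OF uhpS[OF that]]] by (simp add: T_def)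
    qed
    have "has_wirtinger g (infsum (T a1 z0) UNIV) (infsum (T a2 z0) UNIV) z0"
      using g(2)[OF z0S] at_within_open[OF z0S opS] by simp
    then show ?thesis
      by (rule has_derivative_transform_within_open[OF _ opS z0S gh])
  qed
  have "qexp (\<lambda>z. infsum (T b z) UNIV)" if "b = a1 \<or> b = a2" for b
    by (rule qexp.base[where j = 0, OF Thas]) (use that in auto)
  then show ?thesis
    using deriv by (intro exI[of _ "\<lambda>z. infsum (T a1 z) UNIV"] exI[of _ "\<lambda>z. infsum (T a2 z) UNIV"]) auto
qed

lemma has_wirtinger_y_powi:
  assumes "Im z > 0"
  shows "has_wirtinger (\<lambda>z. of_real (Im z) powi j)
     (of_int j / (2 * \<i>) * of_real (Im z) powi (j - 1)) (- of_int j / (2 * \<i>) * of_real (Im z) powi (j - 1)) z"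
proof -
  have "((\<lambda>z. complex_of_real (Im z)) has_derivative (\<lambda>d. of_real (Im d))) (at z)"
    by (intro bounded_linear_imp_has_derivative bounded_linear_compose[OF bounded_linear_of_real bounded_linear_Im])
  then have "((\<lambda>z. complex_of_real (Im z) powi j) has_derivative
      (\<lambda>d. of_real (Im d) * (of_int j * of_real (Im z) powi (j - 1)))) (at z)"
    using assms by (intro has_derivative_power_int) auto
  moreover have "of_real (Im d) * (c * Y) = c / (2 * \<i>) * Y * d + - c / (2 * \<i>) * Y * cnj d" for c Y d
  proof -
    have "of_real (Im d) = (d - cnj d) / (2 * \<i>)" by (simp add: complex_eq_iff)
    then show ?thesis unfolding \<open>of_real (Im d) = _\<close> by (simp add: diff_divide_distrib algebra_simps)
  qed
  ultimately show ?thesis by simp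
qed

lemma has_wirtinger_add:
  "has_wirtinger f A B z \<Longrightarrow> has_wirtinger g A' B' z \<Longrightarrow> has_wirtinger (\<lambda>z. f z + g z) (A + A') (B + B') z"
  by (drule (1) has_derivative_add) (simp add: algebra_simps)

lemma has_wirtinger_mult:
  "has_wirtinger f A B z \<Longrightarrow> has_wirtinger g A' B' z \<Longrightarrow>
   has_wirtinger (\<lambda>z. f z * g z) (f z * A' + A * g z) (f z * B' + B * g z) z"
  by (drule (1) has_derivative_mult) (simp add: algebra_simps)

lemma has_wirtinger_transform_uhp:
  assumes "has_wirtinger f A B z" "Im z > 0" "\<And>w. Im w > 0 \<Longrightarrow> g w = f w"
  shows "has_wirtinger g A B z"
  using assms by (intro has_derivative_transform_within_open[OF assms(1) open_halfspace_Im_gt[of 0]]) auto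

lemma qexp_has_wirtinger:
  assumes "qexp g"
  shows "\<exists>A B. qexp A \<and> qexp B \<and> (\<forall>z. Im z > 0 \<longrightarrow> has_wirtinger g (A z) (B z) z)"
  using assms
proof (induction rule: qexp.induct)
  case (base a h g j)
  from has_wirtinger_double_q_series[OF base(1)] obtain A B where
    AB: "qexp A" "qexp B" "\<And>z. Im z > 0 \<Longrightarrow> has_wirtinger h (A z) (B z) z" by blast
  have h: "qexp h" by (rule qexp.base[where j = 0, OF base(1)]) auto
  let ?y = "\<lambda>j z. complex_of_real (Im z) powi j"
  let ?A = "\<lambda>z. ?y j z * A z + of_int j / (2 * \<i>) * ?y (j - 1) z * h z"
  let ?B = "\<lambda>z. ?y j z * B z + - of_int j / (2 * \<i>) * ?y (j - 1) z * h z"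
  have "has_wirtinger g (?A z) (?B z) z" if z: "Im z > 0" for z
    by (rule has_wirtinger_transform_uhp[OF has_wirtinger_mult[OF has_wirtinger_y_powi[OF z] AB(3)[OF z]] z])
       (rule base(2))
  moreover have "qexp ?A" "qexp ?B"
    by (intro qexp_add qexp_mult qexp_const qexp_y_powi AB h)+
  ultimately show ?case by blast
next
  case (add g1 g2 g)
  then obtain A B A' B' where AB: "qexp A" "qexp B" "qexp A'" "qexp B'"
    "\<And>z. Im z > 0 \<Longrightarrow> has_wirtinger g1 (A z) (B z) z" "\<And>z. Im z > 0 \<Longrightarrow> has_wirtinger g2 (A' z) (B' z) z" by blast
  have "has_wirtinger g (A z + A' z) (B z + B' z) z" if z: "Im z > 0" for z
    by (rule has_wirtinger_transform_uhp[OF has_wirtinger_add[OF AB(5)[OF z] AB(6)[OF z]] z add(3)])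
  then show ?case
    using AB by (intro exI[of _ "\<lambda>z. A z + A' z"] exI[of _ "\<lambda>z. B z + B' z"]) (auto intro: qexp_add)
qed

definition expansion_term :: "(nat \<Rightarrow> nat \<Rightarrow> complex) \<Rightarrow> complex \<Rightarrow> complex" where
  "expansion_term a z = (\<Sum>\<^sub>\<infinity>(m, n)\<in>UNIV. a m n * nome z ^ m * cnj (nome z) ^ n)"

lemma qexp_iff:
  "qexp f \<longleftrightarrow> (\<exists>(M::nat) (a :: int \<Rightarrow> nat \<Rightarrow> nat \<Rightarrow> complex). \<forall>z\<in>upper_half_plane.
        (\<forall>j\<in>{- int M..int M}.
           q_terms (a j) z summable_on UNIV) \<and>
        f z = (\<Sum>j\<in>{- int M..int M}. of_real (Im z) powi j *
                 (\<Sum>\<^sub>\<infinity>(m, n)\<in>UNIV. a j m n * nome z ^ m * cnj (nome z) ^ n)))"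
  (is "_ \<longleftrightarrow> ?expansion f")
proof
  assume "qexp f"
  then show "?expansion f"
    unfolding expansion_term_def[symmetric]
  proof (induction rule: qexp.induct)
    case (base a h g j)
    define b where "b i = (if i = j then a else (\<lambda>_ _. 0))" for i
    have h: "expansion_term (b i) z = (if i = j then h z else 0)" if "Im z > 0" for i z
      using base(1)[OF that] by (auto simp: b_def expansion_term_def infsumI case_prod_unfold)
    show ?case
    proof (rule exI[of _ "nat \<bar>j\<bar>"], rule exI[of _ b], intro ballI conjI)
      fix z assume "z \<in> upper_half_plane"
      then have z: "Im z > 0" by (simp add: upper_half_plane_def)
      show "q_terms (b i) z summable_on UNIV" for i
        using base(1)[OF z] by (auto simp: b_def case_prod_unfold intro: has_sum_imp_summable)
      show "g z = (\<Sum>i\<in>{- int (nat \<bar>j\<bar>)..int (nat \<bar>j\<bar>)}. of_real (Im z) powi i * expansion_term (b i) z)"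
        using abs_ge_self[of j] abs_ge_minus_self[of j]
        by (auto simp: h[OF z] base(2)[OF z] if_distrib[where f = "\<lambda>x. _ * x"] cong: if_cong)
    qed
  next
    case (add g1 g2 g)
    then obtain M1 M2 :: nat and a1 a2 where
      1: "\<And>z i. Im z > 0 \<Longrightarrow> i \<in> {- int M1..int M1} \<Longrightarrow> q_terms (a1 i) z summable_on UNIV"
        "\<And>z. Im z > 0 \<Longrightarrow> g1 z = (\<Sum>j\<in>{- int M1..int M1}. of_real (Im z) powi j * expansion_term (a1 j) z)" and
      2: "\<And>z i. Im z > 0 \<Longrightarrow> i \<in> {- int M2..int M2} \<Longrightarrow> q_terms (a2 i) z summable_on UNIV"
        "\<And>z. Im z > 0 \<Longrightarrow> g2 z = (\<Sum>j\<in>{- int M2..int M2}. of_real (Im z) powi j * expansion_term (a2 j) z)"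
      unfolding upper_half_plane_def by (auto simp: Ball_def) blast
    define M where "M = max M1 M2"
    define b1 where "b1 i = (if i \<in> {- int M1..int M1} then a1 i else (\<lambda>_ _. 0))" for i
    define b2 where "b2 i = (if i \<in> {- int M2..int M2} then a2 i else (\<lambda>_ _. 0))" for i
    define b where "b i m n = b1 i m n + b2 i m n" for i m n
    have s1: "q_terms (b1 i) z summable_on UNIV" if "Im z > 0" for z i
      using 1(1)[OF that, of i] by (auto simp: b1_def case_prod_unfold)
    have s2: "q_terms (b2 i) z summable_on UNIV" if "Im z > 0" for z i
      using 2(1)[OF that, of i] by (auto simp: b2_def case_prod_unfold)
    have b: "(q_terms (b i) z) =
        (\<lambda>p. (q_terms (b1 i) z p) +
             (q_terms (b2 i) z p))" for i z
      by (auto simp: b_def algebra_simps)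
    have g1: "g1 z = (\<Sum>j\<in>{- int M..int M}. of_real (Im z) powi j * expansion_term (b1 j) z)" if "Im z > 0" for z
      unfolding 1(2)[OF that] by (rule sum.mono_neutral_cong_left) (auto simp: M_def b1_def expansion_term_def case_prod_unfold)
    have g2: "g2 z = (\<Sum>j\<in>{- int M..int M}. of_real (Im z) powi j * expansion_term (b2 j) z)" if "Im z > 0" for z
      unfolding 2(2)[OF that] by (rule sum.mono_neutral_cong_left) (auto simp: M_def b2_def expansion_term_def case_prod_unfold)
    show ?case
    proof (rule exI[of _ M], rule exI[of _ b], intro ballI conjI)
      fix z assume "z \<in> upper_half_plane"
      then have z: "Im z > 0" by (simp add: upper_half_plane_def)
      show "q_terms (b i) z summable_on UNIV" for i
        unfolding b by (rule summable_on_add[OF s1[OF z] s2[OF z]])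
      have "expansion_term (b i) z = expansion_term (b1 i) z + expansion_term (b2 i) z" for i
        unfolding expansion_term_def b by (rule infsum_add[OF s1[OF z] s2[OF z]])
      then show "g z = (\<Sum>i\<in>{- int M..int M}. of_real (Im z) powi i * expansion_term (b i) z)"
        by (simp add: add(3)[OF z] g1[OF z] g2[OF z] sum.distrib[symmetric] algebra_simps)
    qed
  qed
next
  assume "?expansion f"
  then obtain M :: nat and a where
    1: "\<And>z i. Im z > 0 \<Longrightarrow> i \<in> {- int M..int M} \<Longrightarrow> q_terms (a i) z summable_on UNIV"
      "\<And>z. Im z > 0 \<Longrightarrow> f z = (\<Sum>j\<in>{- int M..int M}. of_real (Im z) powi j * expansion_term (a j) z)"
    unfolding upper_half_plane_def expansion_term_def[symmetric] by (auto simp: Ball_def)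
  have "qexp (\<lambda>z. \<Sum>j\<in>{- int M..int M}. of_real (Im z) powi j * expansion_term (a j) z)"
  proof (rule qexp_sum)
    fix j assume j: "j \<in> {- int M..int M}"
    show "qexp (\<lambda>z. of_real (Im z) powi j * expansion_term (a j) z)"
      by (rule qexp.base[of "a j" "expansion_term (a j)" _ j])
         (use 1(1)[OF _ j] in \<open>auto simp: expansion_term_def\<close>)
  qed simp
  then show "qexp f" by (rule qexp_cong) (rule 1(2))
qed

section \<open>The weight spaces and the raising and lowering operators\<close>

text \<open>An expansion implies real analyticity and moderate growth, so membership in \<open>M_weight\<close> comes down to
the transformation law and the expansion.\<close>

lemma M_weight_iff:
  "f \<in> M_weight r s \<longleftrightarrow> (\<forall>z. z \<notin> upper_half_plane \<longrightarrow> f z = 0) \<and>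
     (\<forall>\<gamma>\<in>SL2Z. \<forall>z\<in>upper_half_plane.
        f (moebius \<gamma> z) = j_factor \<gamma> z powi r * j_factor \<gamma> (cnj z) powi s * f z) \<and> qexp f"
proof -
  have "\<exists>C>0. \<exists>K Y. \<forall>z\<in>upper_half_plane. Im z \<ge> Y \<longrightarrow> norm (f z) \<le> K * Im z powr C" if "qexp f"
    using qexp_growth[OF that] by blast
  then show ?thesis
    unfolding M_weight_def R_space_def qexp_iff[symmetric] mem_Collect_eq
    using qexp_real_analytic[of f] by blast
qed

lemma SL2Z_iff: "\<gamma> \<in> SL2Z \<longleftrightarrow> \<gamma> $ 1 $ 1 * \<gamma> $ 2 $ 2 - \<gamma> $ 1 $ 2 * \<gamma> $ 2 $ 1 = 1"
  by (simp add: SL2Z_def det_2)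

lemma SL2Z_det_of_int:
  assumes "\<gamma> \<in> SL2Z"
  shows "of_int (\<gamma> $ 1 $ 1) * of_int (\<gamma> $ 2 $ 2) - of_int (\<gamma> $ 1 $ 2) * of_int (\<gamma> $ 2 $ 1) = (1 :: complex)"
proof -
  have "of_int (\<gamma> $ 1 $ 1 * \<gamma> $ 2 $ 2 - \<gamma> $ 1 $ 2 * \<gamma> $ 2 $ 1) = (1 :: complex)"
    using assms by (simp only: SL2Z_iff of_int_1)
  then show ?thesis by simp
qed

lemma j_factor_cnj: "j_factor \<gamma> (cnj z) = cnj (j_factor \<gamma> z)"
  by (simp add: j_factor_def)

lemma moebius_cnj: "moebius \<gamma> (cnj z) = cnj (moebius \<gamma> z)"
  by (simp add: moebius_def j_factor_cnj)

lemma j_factor_nonzero: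
  assumes "\<gamma> \<in> SL2Z" "Im z \<noteq> 0"
  shows "j_factor \<gamma> z \<noteq> 0"
proof
  assume 0: "j_factor \<gamma> z = 0"
  then have "Im (j_factor \<gamma> z) = 0" by simp
  then have c: "\<gamma> $ 2 $ 1 = 0" using assms(2) by (simp add: j_factor_def)
  with 0 have "\<gamma> $ 2 $ 2 = 0" by (simp add: j_factor_def)
  with c assms(1) show False by (simp add: SL2Z_iff)
qed

text \<open>The basic identity of the action: it gives the imaginary part and the derivative of \<open>moebius \<gamma>\<close>, and the
action on the basis \<open>(X - z)^i (X - cnj z)^(n - i)\<close>.\<close>

lemma moebius_diff:
  assumes "\<gamma> \<in> SL2Z" "j_factor \<gamma> z \<noteq> 0" "j_factor \<gamma> w \<noteq> 0"
  shows "moebius \<gamma> z - moebius \<gamma> w = (z - w) / (j_factor \<gamma> z * j_factor \<gamma> w)"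
proof -
  define a b c d :: complex where "a = of_int (\<gamma> $ 1 $ 1)" "b = of_int (\<gamma> $ 1 $ 2)"
    "c = of_int (\<gamma> $ 2 $ 1)" "d = of_int (\<gamma> $ 2 $ 2)"
  have det: "a * d - b * c = 1" using SL2Z_det_of_int[OF assms(1)] by (simp add: a_b_c_d_def)
  have "moebius \<gamma> z - moebius \<gamma> w =
      ((a * z + b) * j_factor \<gamma> w - (a * w + b) * j_factor \<gamma> z) / (j_factor \<gamma> z * j_factor \<gamma> w)"
    using assms(2,3) by (simp add: moebius_def a_b_c_d_def divide_simps)
  also have "(a * z + b) * j_factor \<gamma> w - (a * w + b) * j_factor \<gamma> z = (a * d - b * c) * (z - w)"
    by (simp add: j_factor_def a_b_c_d_def algebra_simps)
  finally show ?thesis by (simp add: det)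
qed

lemma Im_moebius:
  assumes "\<gamma> \<in> SL2Z" "Im z \<noteq> 0"
  shows "2 * \<i> * of_real (Im (moebius \<gamma> z)) =
           2 * \<i> * of_real (Im z) / (j_factor \<gamma> z * j_factor \<gamma> (cnj z))"
proof -
  have "w - cnj w = 2 * \<i> * of_real (Im w)" for w by (simp add: complex_eq_iff)
  moreover have "moebius \<gamma> z - moebius \<gamma> (cnj z) = (z - cnj z) / (j_factor \<gamma> z * j_factor \<gamma> (cnj z))"
    using assms by (intro moebius_diff j_factor_nonzero) auto
  ultimately show ?thesis by (simp only: moebius_cnj)
qed

lemma Im_moebius_real:
  assumes "\<gamma> \<in> SL2Z" "Im z \<noteq> 0"
  shows "Im (moebius \<gamma> z) = Im z / norm (j_factor \<gamma> z) ^ 2"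
proof -
  have "complex_of_real (Im (moebius \<gamma> z)) = of_real (Im z) / (j_factor \<gamma> z * cnj (j_factor \<gamma> z))"
  proof -
    have "2 * \<i> * of_real (Im (moebius \<gamma> z)) =
        2 * \<i> * (of_real (Im z) / (j_factor \<gamma> z * cnj (j_factor \<gamma> z)))"
      using Im_moebius[OF assms] by (simp only: times_divide_eq_right j_factor_cnj)
    then show ?thesis by (subst (asm) mult_left_cancel) auto
  qed
  also have "\<dots> = of_real (Im z / norm (j_factor \<gamma> z) ^ 2)"
    unfolding complex_norm_square[symmetric] by simp
  finally show ?thesis by (simp only: of_real_eq_iff)
qed

lemma moebius_uhp:
  assumes "\<gamma> \<in> SL2Z" "Im z > 0"
  shows "Im (moebius \<gamma> z) > 0"
  using assms j_factor_nonzero[OF assms(1), of z] by (simp add: Im_moebius_real)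

lemma moebius_has_field_derivative:
  assumes "\<gamma> \<in> SL2Z" "j_factor \<gamma> z \<noteq> 0"
  shows "(moebius \<gamma> has_field_derivative 1 / j_factor \<gamma> z ^ 2) (at z)"
proof -
  define a b c d :: complex where "a = of_int (\<gamma> $ 1 $ 1)" "b = of_int (\<gamma> $ 1 $ 2)"
    "c = of_int (\<gamma> $ 2 $ 1)" "d = of_int (\<gamma> $ 2 $ 2)"
  have det: "a * d - b * c = 1" using SL2Z_det_of_int[OF assms(1)] by (simp add: a_b_c_d_def)
  have nz: "c * z + d \<noteq> 0" using assms(2) by (simp add: j_factor_def a_b_c_d_def)
  have "((\<lambda>z. (a * z + b) / (c * z + d)) has_field_derivative
      (a * (c * z + d) - (a * z + b) * c) / ((c * z + d) * (c * z + d))) (at z)"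
    by (rule derivative_eq_intros refl nz | simp)+
  moreover have "a * (c * z + d) - (a * z + b) * c = a * d - b * c" by (simp add: algebra_simps)
  ultimately show ?thesis
    by (simp add: det moebius_def[abs_def] j_factor_def a_b_c_d_def[symmetric] power2_eq_square)
qed

lemma has_wirtinger_unique:
  assumes "has_wirtinger f A B z" "has_wirtinger f A' B' z"
  shows "A = A'" "B = B'"
proof -
  have "(\<lambda>d. A * d + B * cnj d) = (\<lambda>d. A' * d + B' * cnj d)"
    using has_derivative_unique[OF assms] .
  from fun_cong[OF this, of 1] fun_cong[OF this, of \<i>]
  have 1: "A + B = A' + B'" and "\<i> * (A - B) = \<i> * (A' - B')" by (simp_all add: algebra_simps)
  then have "A - B = A' - B'" by simp
  then have "2 * A = 2 * A'" using 1 by algebra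
  then show "A = A'" by simp
  with 1 show "B = B'" by simp
qed

lemma wirtinger_of_has_wirtinger:
  assumes "has_wirtinger f A B z"
  shows "wirtinger_z f z = A" "wirtinger_zbar f z = B"
  using frechet_derivative_at[OF assms, symmetric]
  by (simp_all add: wirtinger_z_def wirtinger_zbar_def algebra_simps)

lemma has_wirtinger_holomorphic:
  "(f has_field_derivative f') (at z) \<Longrightarrow> has_wirtinger f f' 0 z"
  by (simp add: has_field_derivative_def)

lemma has_wirtinger_cnj:
  assumes "has_wirtinger f A B z"
  shows "has_wirtinger (\<lambda>z. cnj (f z)) (cnj B) (cnj A) z"
  using bounded_linear.has_derivative[OF bounded_linear_cnj assms] by (simp add: add.commute)

lemma has_wirtinger_compose:
  assumes "(g has_field_derivative g') (at z)" "has_wirtinger f A B (g z)"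
  shows "has_wirtinger (\<lambda>z. f (g z)) (A * g') (B * cnj g') z"
  using has_derivative_compose[OF assms(1)[unfolded has_field_derivative_def] assms(2)]
  by (simp add: mult.assoc)

lemma has_wirtinger_j_factor_powi:
  assumes "j_factor \<gamma> z \<noteq> 0"
  shows "has_wirtinger (\<lambda>z. j_factor \<gamma> z powi r)
     (of_int r * of_int (\<gamma> $ 2 $ 1) * j_factor \<gamma> z powi r / j_factor \<gamma> z) 0 z"
proof (rule has_wirtinger_holomorphic)
  have "(j_factor \<gamma> has_field_derivative of_int (\<gamma> $ 2 $ 1)) (at z)"
    unfolding j_factor_def by (auto intro!: derivative_eq_intros)
  from DERIV_power_int[OF this disjI2[OF assms], of r]
  show "((\<lambda>z. j_factor \<gamma> z powi r) has_field_derivative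
      of_int r * of_int (\<gamma> $ 2 $ 1) * j_factor \<gamma> z powi r / j_factor \<gamma> z) (at z)"
    using assms by (simp add: power_int_diff mult_ac)
qed

lemma M_weight_D:
  assumes "f \<in> M_weight r s"
  shows "z \<notin> upper_half_plane \<Longrightarrow> f z = 0" "qexp f"
    "\<gamma> \<in> SL2Z \<Longrightarrow> Im z > 0 \<Longrightarrow> f (moebius \<gamma> z) = j_factor \<gamma> z powi r * j_factor \<gamma> (cnj z) powi s * f z"
  using assms unfolding M_weight_iff upper_half_plane_def by auto

text \<open>Differentiating the transformation law produces the additional term \<open>r c j^(r - 1)\<close>. It is compensated
by the summand \<open>r f\<close> of the operator, because \<open>cnj j = j - 2 \<i> y c\<close>.\<close>

lemma del_weight_M_weight:
  assumes f: "f \<in> M_weight r s"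
  shows "del_weight r f \<in> M_weight (r + 1) (s - 1)"
proof -
  obtain A B where AB: "qexp A" "\<And>z. Im z > 0 \<Longrightarrow> has_wirtinger f (A z) (B z) z"
    using qexp_has_wirtinger[OF M_weight_D(2)[OF f]] by blast
  have del: "del_weight r f z = 2 * \<i> * of_real (Im z) * A z + of_int r * f z" if "Im z > 0" for z
    using that by (simp add: del_weight_def on_uhp_def upper_half_plane_def wirtinger_of_has_wirtinger(1)[OF AB(2)])
  have "qexp (\<lambda>z. 2 * \<i> * of_real (Im z) powi 1 * A z + of_int r * f z)"
    by (intro qexp_add qexp_mult qexp_const qexp_y_powi AB(1) M_weight_D(2)[OF f])
  then have "qexp (del_weight r f)"
    by (rule qexp_cong) (simp add: del)
  moreover have "del_weight r f (moebius \<gamma> z) =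
      j_factor \<gamma> z powi (r + 1) * j_factor \<gamma> (cnj z) powi (s - 1) * del_weight r f z"
    if \<gamma>: "\<gamma> \<in> SL2Z" and z: "Im z > 0" for \<gamma> z
  proof -
    define j jb c where "j = j_factor \<gamma> z" and "jb = j_factor \<gamma> (cnj z)"
      and "c = complex_of_int (\<gamma> $ 2 $ 1)"
    have nz: "j \<noteq> 0" "jb \<noteq> 0"
      using j_factor_nonzero[OF \<gamma>] z by (simp_all add: j_def jb_def)
    define J S where "J = j powi r" and "S = jb powi s"
    have w: "Im (moebius \<gamma> z) > 0" by (rule moebius_uhp[OF \<gamma> z])
    have "has_wirtinger (\<lambda>z. f (moebius \<gamma> z)) (A (moebius \<gamma> z) * (1 / j ^ 2)) (B (moebius \<gamma> z) * cnj (1 / j ^ 2)) z"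
      unfolding j_def
      by (rule has_wirtinger_compose[OF moebius_has_field_derivative[OF \<gamma>] AB(2)[OF w]]) (use nz in \<open>simp add: j_def\<close>)
    moreover have "has_wirtinger (\<lambda>z. f (moebius \<gamma> z))
        ((J * 0 + of_int r * c * J / j * S) * f z + J * S * A z) (J * cnj (of_int s * c * cnj jb powi s / cnj jb) * f z + J * S * B z) z"
    proof (rule has_wirtinger_transform_uhp[OF _ z])
      have "has_wirtinger (\<lambda>z. j_factor \<gamma> z powi s) (of_int s * c * cnj jb powi s / cnj jb) 0 z"
        using has_wirtinger_j_factor_powi[of \<gamma> z s] nz by (simp add: j_def jb_def c_def j_factor_cnj)
      from has_wirtinger_cnj[OF this]
      have sb: "has_wirtinger (\<lambda>z. j_factor \<gamma> (cnj z) powi s) 0 (cnj (of_int s * c * cnj jb powi s / cnj jb)) z"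
        by (simp add: j_factor_cnj)
      have "has_wirtinger (\<lambda>z. j_factor \<gamma> z powi r) (of_int r * c * J / j) 0 z"
        using has_wirtinger_j_factor_powi[of \<gamma> z r] nz by (simp add: j_def c_def J_def)
      from has_wirtinger_mult[OF has_wirtinger_mult[OF this sb] AB(2)[OF z]]
      show "has_wirtinger (\<lambda>z. j_factor \<gamma> z powi r * j_factor \<gamma> (cnj z) powi s * f z)
        ((J * 0 + of_int r * c * J / j * S) * f z + J * S * A z) (J * cnj (of_int s * c * cnj jb powi s / cnj jb) * f z + J * S * B z) z"
        by (simp add: J_def S_def j_def jb_def add.commute)
      show "f (moebius \<gamma> w) = j_factor \<gamma> w powi r * j_factor \<gamma> (cnj w) powi s * f w" if "Im w > 0" for w
        by (rule M_weight_D(3)[OF f \<gamma> that])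
    qed
    ultimately have "A (moebius \<gamma> z) * (1 / j ^ 2) = (J * 0 + of_int r * c * J / j * S) * f z + J * S * A z"
      by (rule has_wirtinger_unique(1))
    then have A: "A (moebius \<gamma> z) = j * (of_int r * c * J * S * f z + j * J * S * A z)"
      using nz by (simp add: field_simps power2_eq_square)
    have jb: "jb = j - 2 * \<i> * of_real (Im z) * c"
    proof -
      have cz: "cnj z = z - 2 * \<i> * of_real (Im z)" by (simp add: complex_eq_iff)
      show ?thesis unfolding jb_def j_def c_def j_factor_def by (simp only: cz) (simp add: algebra_simps)
    qed
    have "jb * (2 * \<i> * of_real (Im (moebius \<gamma> z)) * A (moebius \<gamma> z) + of_int r * f (moebius \<gamma> z)) =
        2 * \<i> * of_real (Im z) * (of_int r * c * J * S * f z + j * J * S * A z) + jb * (of_int r * (J * S * f z))"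
    proof -
      have "2 * \<i> * of_real (Im (moebius \<gamma> z)) = 2 * \<i> * of_real (Im z) / (j * jb)"
        using Im_moebius[OF \<gamma>, of z] z by (simp add: j_def jb_def)
      moreover have "f (moebius \<gamma> z) = J * S * f z"
        using M_weight_D(3)[OF f \<gamma> z] by (simp add: J_def S_def j_def jb_def)
      ultimately show ?thesis using nz by (simp only: A) (simp add: field_simps)
    qed
    also have "\<dots> = j * J * S * (2 * \<i> * of_real (Im z) * A z + of_int r * f z)"
      unfolding jb by (simp add: algebra_simps)
    finally have "2 * \<i> * of_real (Im (moebius \<gamma> z)) * A (moebius \<gamma> z) + of_int r * f (moebius \<gamma> z) =
        (j * J) * (S / jb) * (2 * \<i> * of_real (Im z) * A z + of_int r * f z)"
      using nz by (simp add: field_simps)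
    then show ?thesis
      unfolding del[OF w] del[OF z] j_def[symmetric] jb_def[symmetric]
      using nz by (simp add: J_def S_def power_int_add power_int_diff mult_ac)
  qed
  ultimately show ?thesis
    unfolding M_weight_iff by (auto simp: del_weight_def on_uhp_def upper_half_plane_def)
qed

lemma M_weight_cnj: "f \<in> M_weight r s \<Longrightarrow> (\<lambda>z. cnj (f z)) \<in> M_weight s r"
  unfolding M_weight_iff by (auto simp: j_factor_cnj intro: qexp_cnj)

text \<open>Complex conjugation exchanges the two weights and turns the lowering operator into the raising one.\<close>

lemma delbar_weight_M_weight:
  assumes f: "f \<in> M_weight r s"
  shows "delbar_weight s f \<in> M_weight (r - 1) (s + 1)"
proof -
  have "delbar_weight s f z = cnj (del_weight s (\<lambda>z. cnj (f z)) z)" for z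
  proof (cases "z \<in> upper_half_plane")
    case True
    obtain A B where "has_wirtinger f (A z) (B z) z"
      using qexp_has_wirtinger[OF M_weight_D(2)[OF f]] True unfolding upper_half_plane_def by blast
    from wirtinger_of_has_wirtinger(2)[OF this] wirtinger_of_has_wirtinger(1)[OF has_wirtinger_cnj[OF this]]
    show ?thesis using True by (simp add: delbar_weight_def del_weight_def on_uhp_def)
  qed (simp add: delbar_weight_def del_weight_def on_uhp_def)
  then have "delbar_weight s f = (\<lambda>z. cnj (del_weight s (\<lambda>z. cnj (f z)) z))" ..
  then show ?thesis
    using M_weight_cnj[OF del_weight_M_weight[OF M_weight_cnj[OF f]]] by simp
qed

lemma M_weight_subspace: "cfun.subspace (M_weight r s)"
proof (rule cfun.subspaceI)
  show "0 \<in> M_weight r s"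
    unfolding M_weight_iff by (simp add: zero_fun_def qexp_const)
  show "f + g \<in> M_weight r s" if "f \<in> M_weight r s" "g \<in> M_weight r s" for f g
    using that unfolding M_weight_iff by (auto simp: plus_fun_def algebra_simps intro: qexp_add)
  show "(\<lambda>z. c * f z) \<in> M_weight r s" if "f \<in> M_weight r s" for c f
    using that unfolding M_weight_iff by (auto simp: algebra_simps intro: qexp_cmult)
qed

lemma M_space_decompose:
  assumes "f \<in> M_space"
  shows "\<exists>F. finite {p. F p \<noteq> 0} \<and> (\<forall>r s. F (r, s) \<in> M_weight r s) \<and> f = (\<Sum>p | F p \<noteq> 0. F p)"
proof -
  define D where "D = {f. \<exists>P F. finite P \<and> (\<forall>p. p \<notin> P \<longrightarrow> F p = 0) \<and>
      (\<forall>r s. F (r, s) \<in> M_weight r s) \<and> f = (\<Sum>p\<in>P. F p)}"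
  have DI: "f \<in> D" if "finite P" "\<And>p. p \<notin> P \<Longrightarrow> F p = 0" "\<And>r s. F (r, s) \<in> M_weight r s" "f = (\<Sum>p\<in>P. F p)"
    for f P and F :: "int \<times> int \<Rightarrow> complex \<Rightarrow> complex"
    using that unfolding D_def by blast
  have "cfun.subspace D"
    unfolding cfun.subspace_def
  proof (intro conjI ballI allI)
    show "0 \<in> D"
      by (rule DI[of "{}" "\<lambda>_. 0"]) (auto intro: cfun.subspace_0[OF M_weight_subspace])
  next
    fix f g assume "f \<in> D" "g \<in> D"
    then obtain P F Q G where
      F: "finite P" "\<And>p. p \<notin> P \<Longrightarrow> F p = 0" "\<And>r s. F (r, s) \<in> M_weight r s" "f = (\<Sum>p\<in>P. F p)" and
      G: "finite Q" "\<And>p. p \<notin> Q \<Longrightarrow> G p = 0" "\<And>r s. G (r, s) \<in> M_weight r s" "g = (\<Sum>p\<in>Q. G p)"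
      unfolding D_def by blast
    show "f + g \<in> D"
    proof (rule DI[of "P \<union> Q" "\<lambda>p. F p + G p"])
      have "f = (\<Sum>p\<in>P \<union> Q. F p)" "g = (\<Sum>p\<in>P \<union> Q. G p)"
        unfolding F(4) G(4) using F G by (auto intro!: sum.mono_neutral_left)
      then show "f + g = (\<Sum>p\<in>P \<union> Q. F p + G p)" by (simp only: sum.distrib)
    qed (use F G in \<open>auto intro: cfun.subspace_add[OF M_weight_subspace]\<close>)
  next
    fix c f assume "f \<in> D"
    then obtain P F where
      F: "finite P" "\<And>p. p \<notin> P \<Longrightarrow> F p = 0" "\<And>r s. F (r, s) \<in> M_weight r s" "f = (\<Sum>p\<in>P. F p)"
      unfolding D_def by blast
    show "(\<lambda>z. c * f z) \<in> D"
    proof (rule DI[of P "\<lambda>p z. c * F p z"])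
      show "(\<lambda>z. c * f z) = (\<Sum>p\<in>P. (\<lambda>z. c * F p z))"
        unfolding F(4) by (rule cfun.scale_sum_right)
    qed (use F in \<open>auto intro: cfun.subspace_scale[OF M_weight_subspace]\<close>)
  qed
  moreover have "(\<Union>r s. M_weight r s) \<subseteq> D"
  proof clarify
    fix f r s assume "f \<in> M_weight r s"
    then show "f \<in> D"
      by (intro DI[of "{(r, s)}" "\<lambda>p. if p = (r, s) then f else 0"])
         (auto intro: cfun.subspace_0[OF M_weight_subspace])
  qed
  ultimately have "M_space \<subseteq> D"
    unfolding M_space_def by (rule cfun.span_minimal[rotated])
  with assms obtain P F where
    F: "finite P" "\<And>p. p \<notin> P \<Longrightarrow> F p = 0" "\<And>r s. F (r, s) \<in> M_weight r s" "f = (\<Sum>p\<in>P. F p)"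
    unfolding D_def by blast
  have "{p. F p \<noteq> 0} \<subseteq> P" using F(2) by blast
  then have "finite {p. F p \<noteq> 0}" "f = (\<Sum>p | F p \<noteq> 0. F p)"
    using F(1) unfolding F(4) by (auto intro: finite_subset sum.mono_neutral_right)
  with F(3) show ?thesis by blast
qed

lemma weight_components:
  assumes "f \<in> M_space"
  shows "finite {p. weight_components f p \<noteq> 0}" "weight_components f (r, s) \<in> M_weight r s"
  using someI_ex[OF M_space_decompose[OF assms]] unfolding weight_components_def by auto

lemma M_weight_subset_M_space: "M_weight r s \<subseteq> M_space"
  unfolding M_space_def by (rule order.trans[OF _ cfun.span_superset]) auto

lemma del_M_space:
  assumes "f \<in> M_space"
  shows "del f \<in> M_space" "delbar f \<in> M_space"
proof -
  have sub: "cfun.subspace M_space" unfolding M_space_def by (rule cfun.subspace_span)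
  have "del_weight r (weight_components f (r, s)) \<in> M_space"
    "delbar_weight s (weight_components f (r, s)) \<in> M_space" for r s
    using del_weight_M_weight delbar_weight_M_weight weight_components(2)[OF assms] M_weight_subset_M_space by blast+
  then show "del f \<in> M_space" "delbar f \<in> M_space"
    unfolding del_def delbar_def Let_def by (auto intro!: cfun.subspace_sum[OF sub])
qed

text \<open>\<open>M_space\<close> is stable under both operators, so it satisfies the two inclusions with second summand zero,
and every competing subspace is contained in it by definition.\<close>

lemma MI2'_eq: "MI2' = M_space"
  unfolding MI2'_def
proof (rule Greatest_equality)
  have "f \<in> {v + w | v w. v \<in> M_space \<and> w \<in> Eisenstein_multiples V}" if "f \<in> M_space" for f V
  proof -
    have "f = f + 0" "(0 :: complex \<Rightarrow> complex) \<in> Eisenstein_multiples V"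
      by (simp_all add: Eisenstein_multiples_def cfun.span_zero)
    with that show ?thesis by blast
  qed
  then show "cfun.subspace M_space \<and> M_space \<subseteq> M_space \<and>
     del ` M_space \<subseteq> {v + w | v w. v \<in> M_space \<and> w \<in> Eisenstein_multiples S_space} \<and>
     delbar ` M_space \<subseteq> {v + w | v w. v \<in> M_space \<and> w \<in> Eisenstein_multiples S_conj_space}"
    using del_M_space by (auto simp: M_space_def[symmetric] image_subset_iff simp del: mem_Collect_eq)
      (simp add: M_space_def)
qed blast

section \<open>Lattice sums over the translates of a point\<close>

text \<open>The lower bound for \<open>c z + d\<close> that makes all sums over lattice points converge: \<open>c\<close> is controlled by the
imaginary part, and then \<open>d\<close> by the triangle inequality.\<close>

lemma max_coords_le_norm:
  assumes "Im z > 0"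
  shows "max \<bar>c\<bar> \<bar>d\<bar> \<le> (1 / Im z + 1 + norm z / Im z) * norm (of_real c * z + of_real d)"
proof -
  let ?w = "of_real c * z + of_real d"
  have "\<bar>c * Im z\<bar> \<le> norm ?w" using abs_Im_le_cmod[of ?w] by simp
  then have c: "\<bar>c\<bar> \<le> norm ?w / Im z" using assms by (simp add: field_simps abs_mult)
  have "\<bar>d\<bar> = norm (?w - of_real c * z)" by simp
  also have "\<dots> \<le> norm ?w + \<bar>c\<bar> * norm z"
    using norm_triangle_ineq4[of ?w "of_real c * z"] by (simp add: norm_mult)
  also have "\<dots> \<le> norm ?w + norm ?w / Im z * norm z"
    using c by (intro add_left_mono mult_right_mono) auto
  finally have d: "\<bar>d\<bar> \<le> norm ?w + norm ?w / Im z * norm z" .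
  have "norm ?w \<ge> 0" "norm ?w / Im z \<ge> 0" "norm ?w / Im z * norm z \<ge> 0" using assms by auto
  then have "max \<bar>c\<bar> \<bar>d\<bar> \<le> norm ?w / Im z + norm ?w + norm ?w / Im z * norm z"
    using c d by simp
  then show ?thesis by (simp add: algebra_simps)
qed

lemma summable_int_inverse_square: "(\<lambda>m::int. 1 / (max 1 \<bar>real_of_int m\<bar>) ^ 2) summable_on UNIV"
proof -
  let ?f = "\<lambda>m::int. 1 / (max 1 \<bar>real_of_int m\<bar>) ^ 2"
  have "summable (\<lambda>n. ?f (int (Suc n)))"
    using inverse_squares_sums[THEN sums_summable] by (simp add: max_def)
  then have "summable (\<lambda>n. ?f (int n))" by (subst (asm) summable_Suc_iff)
  then have nat: "(\<lambda>n. ?f (int n)) summable_on UNIV"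
    by (subst summable_on_UNIV_nonneg_real_iff) auto
  have "?f summable_on (range int)"
    using nat by (subst summable_on_reindex) (auto simp: o_def)
  moreover have "?f summable_on (range (\<lambda>n. - int n))"
    using nat by (subst summable_on_reindex) (auto simp: o_def inj_on_def)
  moreover have "(UNIV :: int set) = range int \<union> range (\<lambda>n. - int n)"
  proof -
    have "m \<in> range int \<union> range (\<lambda>n. - int n)" for m :: int
      by (cases m rule: int_cases2) auto
    then show ?thesis by blast
  qed
  ultimately show ?thesis using summable_on_union by metis
qed

lemma infsum_int_split:
  fixes f :: "int \<Rightarrow> complex"
  assumes "f summable_on UNIV" "(\<lambda>k. f (int k)) sums A" "(\<lambda>k. f (- int k - 1)) sums B"
  shows "infsum f UNIV = A + B"
proof -
  have "(f has_sum A) (range int)"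
  proof -
    have "(\<lambda>k. f (int k)) summable_on UNIV"
      using summable_on_subset[OF assms(1) subset_UNIV, of "range int"] summable_on_reindex[of int UNIV f] by (auto simp: o_def)
    then obtain S where S: "((\<lambda>k. f (int k)) has_sum S) UNIV" by (auto simp: summable_on_def)
    then have "S = A" using has_sum_imp_sums assms(2) sums_unique2 by blast
    with S show ?thesis by (subst has_sum_reindex) (auto simp: o_def)
  qed
  moreover have "(f has_sum B) (range (\<lambda>k. - int k - 1))"
  proof -
    have "(\<lambda>k. f (- int k - 1)) summable_on UNIV"
      using summable_on_subset[OF assms(1) subset_UNIV, of "range (\<lambda>k. - int k - 1)"]
        summable_on_reindex[of "\<lambda>k. - int k - 1" UNIV f] by (auto simp: o_def inj_on_def)
    then obtain S where S: "((\<lambda>k. f (- int k - 1)) has_sum S) UNIV" by (auto simp: summable_on_def)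
    then have "S = B" using has_sum_imp_sums assms(3) sums_unique2 by blast
    with S show ?thesis by (subst has_sum_reindex) (auto simp: o_def inj_on_def)
  qed
  ultimately have "(f has_sum (A + B)) (range int \<union> range (\<lambda>k. - int k - 1))"
    by (rule has_sum_Un_disjoint) auto
  moreover have "range int \<union> range (\<lambda>k. - int k - 1) = UNIV"
  proof -
    have "m \<in> range int \<union> range (\<lambda>k. - int k - 1)" for m :: int
      by (cases m) auto
    then show ?thesis by blast
  qed
  ultimately show ?thesis by (simp add: infsumI)
qed

lemma infsum_diff_complex:
  fixes f g :: "'a \<Rightarrow> complex"
  assumes "f summable_on A" "g summable_on A"
  shows "infsum (\<lambda>x. f x - g x) A = infsum f A - infsum g A"
  using infsum_add[OF assms(1) summable_on_uminus[THEN iffD2, OF assms(2)]]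
  by (simp add: infsum_uminus)

definition lattice_sum :: "int \<Rightarrow> int \<Rightarrow> complex \<Rightarrow> complex" where
  "lattice_sum a b z = (\<Sum>\<^sub>\<infinity>m::int. (z + of_int m) powi (- a) * (cnj z + of_int m) powi (- b))"

lemma uhp_add_of_int_nonzero:
  assumes "Im z \<noteq> 0"
  shows "z + of_int m \<noteq> 0" "cnj z + of_int m \<noteq> 0"
  using assms by (auto simp: complex_eq_iff)

lemma norm_powi_conjugates:
  fixes w v :: complex
  assumes "w \<noteq> 0" "norm v = norm w" "0 \<le> a + b"
  shows "norm (w powi (- a) * v powi (- b)) = 1 / norm w ^ nat (a + b)"
proof -
  have "norm (w powi (- a) * v powi (- b)) = norm w powi (- (a + b))"
    using assms(1,2) by (simp add: norm_mult norm_power_int power_int_add[symmetric])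
  then show ?thesis
    using assms(3) by (simp only: power_int_minus power_int_nonneg_exp divide_inverse mult_1)
qed

lemma norm_cnj_linear: "norm (of_int c * cnj z + of_int d) = norm (of_int c * z + of_int d)"
  by (metis complex_cnj_add complex_cnj_mult complex_cnj_of_int complex_mod_cnj)

lemma lattice_term_summable:
  assumes z: "Im z > 0" and ab: "a + b \<ge> 2"
  shows "(\<lambda>m::int. (z + of_int m) powi (- a) * (cnj z + of_int m) powi (- b)) summable_on UNIV"
proof -
  define K where "K = 1 / Im z + 1 + norm z / Im z"
  have K: "K \<ge> 1" using z by (simp add: K_def)
  have "(\<lambda>m::int. K ^ nat (a + b) * (1 / (max 1 \<bar>real_of_int m\<bar>) ^ 2)) summable_on UNIV"
    by (intro summable_on_cmult_right summable_int_inverse_square)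
  then have "(\<lambda>m::int. norm ((z + of_int m) powi (- a) * (cnj z + of_int m) powi (- b))) summable_on UNIV"
  proof (rule summable_on_comparison_test)
    fix m :: int
    let ?w = "z + of_int m" and ?M = "max 1 \<bar>real_of_int m\<bar>"
    have w: "?w \<noteq> 0" using uhp_add_of_int_nonzero z by simp
    have "norm (?w powi (- a) * (cnj z + of_int m) powi (- b)) = 1 / norm ?w ^ nat (a + b)"
      using w ab norm_cnj_linear[of 1 z m] by (intro norm_powi_conjugates) auto
    also have "\<dots> \<le> K ^ nat (a + b) * (1 / ?M ^ nat (a + b))"
    proof -
      have "?M \<le> K * norm ?w" using max_coords_le_norm[OF z, of 1 "of_int m"] by (simp add: K_def)
      then have "?M ^ nat (a + b) \<le> (K * norm ?w) ^ nat (a + b)" by (rule power_mono) simp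
      then show ?thesis using w by (simp add: field_simps power_mult_distrib)
    qed
    also have "\<dots> \<le> K ^ nat (a + b) * (1 / ?M ^ 2)"
      using K ab by (intro mult_left_mono divide_left_mono power_increasing) auto
    finally show "norm (?w powi (- a) * (cnj z + of_int m) powi (- b)) \<le> K ^ nat (a + b) * (1 / ?M ^ 2)" .
  qed auto
  then show ?thesis by (rule abs_summable_summable)
qed

lemma lattice_sum_cnj: "lattice_sum a b z = cnj (lattice_sum b a z)"
  unfolding lattice_sum_def infsum_cnj[symmetric] by (simp add: mult.commute)

text \<open>A partial fraction step: the difference of \<open>z + m\<close> and its conjugate is \<open>2 \<i> y\<close> for every \<open>m\<close>.\<close>

lemma lattice_sum_rec:
  assumes z: "Im z > 0" and ab: "a + b \<ge> 3"
  shows "lattice_sum (a - 1) b z - lattice_sum a (b - 1) z = 2 * \<i> * of_real (Im z) * lattice_sum a b z"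
proof -
  have "lattice_sum (a - 1) b z - lattice_sum a (b - 1) z =
     (\<Sum>\<^sub>\<infinity>m::int. (z + of_int m) powi (- (a - 1)) * (cnj z + of_int m) powi (- b) -
        (z + of_int m) powi (- a) * (cnj z + of_int m) powi (- (b - 1)))"
    unfolding lattice_sum_def using ab by (intro infsum_diff_complex[symmetric] lattice_term_summable z) auto
  also have "\<dots> = (\<Sum>\<^sub>\<infinity>m::int. 2 * \<i> * of_real (Im z) * ((z + of_int m) powi (- a) * (cnj z + of_int m) powi (- b)))"
  proof (rule infsum_cong)
    fix m :: int
    let ?w = "z + of_int m" and ?wb = "cnj z + of_int m"
    have w: "?w \<noteq> 0" "?wb \<noteq> 0" using uhp_add_of_int_nonzero z by auto
    have "?w powi (- (a - 1)) = ?w powi (- a) * ?w"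
      using w power_int_add[of ?w "- a" 1] by simp
    moreover have "?wb powi (- (b - 1)) = ?wb powi (- b) * ?wb"
      using w power_int_add[of ?wb "- b" 1] by simp
    moreover have "?w - ?wb = 2 * \<i> * of_real (Im z)" by (simp add: complex_eq_iff)
    moreover have factor: "A * W * B - A * (B * V) = (W - V) * (A * B)" for A B W V :: complex
      by (simp add: algebra_simps)
    ultimately show "?w powi (- (a - 1)) * ?wb powi (- b) - ?w powi (- a) * ?wb powi (- (b - 1)) =
        2 * \<i> * of_real (Im z) * (?w powi (- a) * ?wb powi (- b))"
      by (simp only: factor)
  qed
  also have "\<dots> = 2 * \<i> * of_real (Im z) * lattice_sum a b z"
    unfolding lattice_sum_def by (rule infsum_cmult_right')
  finally show ?thesis .
qed

lemma q_series_derivative: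
  assumes h: "\<And>z. Im z > 0 \<Longrightarrow> (\<lambda>n. a n * nome z ^ n) sums h z" and z: "Im z > 0"
  obtains D where "(\<lambda>n. 2 * of_real pi * \<i> * of_nat n * a n * nome z ^ n) sums D"
    "(h has_field_derivative D) (at z)"
proof -
  let ?q = "nome z" and ?w = "z - \<i> * of_real (Im z / 2)"
  define F where "F x = (\<Sum>n. a n * x ^ n)" for x
  have sw: "summable (\<lambda>n. a n * nome ?w ^ n)"
    using h[of ?w] z by (auto intro: sums_summable)
  have lt: "norm ?q < norm (nome ?w)" using z by (simp add: norm_nome)
  have 1: "(F has_field_derivative (\<Sum>n. diffs a n * ?q ^ n)) (at ?q)"
    unfolding F_def using sw lt by (rule termdiffs_strong)
  have "summable (\<lambda>n. diffs a n * ?q ^ n)"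
    by (rule termdiff_converges[OF lt]) (rule powser_inside[OF sw])
  from diffs_equiv[OF this]
  have 2: "(\<lambda>n. of_nat n * a n * ?q ^ (n - Suc 0)) sums (\<Sum>n. diffs a n * ?q ^ n)" .
  define D where "D = 2 * of_real pi * \<i> * ?q * (\<Sum>n. diffs a n * ?q ^ n)"
  have "(\<lambda>n. 2 * of_real pi * \<i> * ?q * (of_nat n * a n * ?q ^ (n - Suc 0))) sums D"
    unfolding D_def by (rule sums_mult[OF 2])
  moreover have "2 * of_real pi * \<i> * ?q * (of_nat n * a n * ?q ^ (n - Suc 0)) =
      2 * of_real pi * \<i> * of_nat n * a n * ?q ^ n" for n
    by (cases n) auto
  ultimately have sums: "(\<lambda>n. 2 * of_real pi * \<i> * of_nat n * a n * ?q ^ n) sums D" by simp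
  have "(nome has_field_derivative ?q * (2 * of_real pi * \<i>)) (at z)"
    unfolding nome_def[abs_def] by (auto intro!: derivative_eq_intros)
  from DERIV_chain2[OF 1 this] have d: "((\<lambda>z. F (nome z)) has_field_derivative D) (at z)"
    by (simp add: D_def mult_ac)
  have e: "F (nome u) = h u" if "Im u > 0" for u
    unfolding F_def by (rule sums_unique[symmetric]) (rule h[OF that])
  have "(h has_field_derivative D) (at z)"
    by (rule has_field_derivative_transform_within_open[OF d open_halfspace_Im_gt[of 0]]) (use z e in auto)
  with sums show thesis by (rule that)
qed

text \<open>The \<open>n\<close>-th derivative of \<open>\<pi> cot (\<pi> z)\<close>, written with polygamma functions because those are series over
the half-lattices of which \<open>lattice_sum\<close> is composed.\<close>

definition cot_deriv :: "nat \<Rightarrow> complex \<Rightarrow> complex" where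
  "cot_deriv n z = (-1) ^ n * Polygamma n (1 - z) - Polygamma n z"

lemma not_Ints_of_Im: "Im z \<noteq> 0 \<Longrightarrow> z \<notin> \<int>"
  by (auto elim!: Ints_cases)

lemma not_nonpos_Ints_of_Im: "Im z \<noteq> 0 \<Longrightarrow> z \<notin> \<int>\<^sub>\<le>\<^sub>0"
  using not_Ints_of_Im nonpos_Ints_Int by blast

lemma cot_deriv_has_field_derivative:
  assumes "Im z \<noteq> 0"
  shows "(cot_deriv n has_field_derivative cot_deriv (Suc n) z) (at z)"
proof -
  have 1: "z \<notin> \<int>\<^sub>\<le>\<^sub>0" "1 - z \<notin> \<int>\<^sub>\<le>\<^sub>0" using assms by (auto intro!: not_nonpos_Ints_of_Im)
  have "((\<lambda>z. Polygamma n (1 - z)) has_field_derivative Polygamma (Suc n) (1 - z) * (0 - 1)) (at z)"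
    by (rule DERIV_chain2[where g = "\<lambda>z. 1 - z", OF has_field_derivative_Polygamma[OF 1(2)]]) (intro derivative_intros)
  from DERIV_diff[OF DERIV_cmult[OF this, of "(-1) ^ n"] has_field_derivative_Polygamma[OF 1(1), of n]]
  show ?thesis by (simp add: cot_deriv_def[abs_def])
qed

text \<open>Logarithmic differentiation of the reflection formula \<open>Gamma z * Gamma (1 - z) = \<pi> / sin (\<pi> z)\<close>.\<close>

lemma cot_deriv_0:
  assumes "Im z \<noteq> 0"
  shows "cot_deriv 0 z = of_real pi * cos (of_real pi * z) / sin (of_real pi * z)"
proof -
  have 1: "z \<notin> \<int>\<^sub>\<le>\<^sub>0" "1 - z \<notin> \<int>\<^sub>\<le>\<^sub>0" using assms by (auto intro!: not_nonpos_Ints_of_Im)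
  have s: "sin (of_real pi * z) \<noteq> 0"
  proof
    assume "sin (of_real pi * z) = 0"
    then obtain n where "of_real pi * z = of_real (of_int n * pi)" by (auto simp: sin_eq_0)
    then have "Im (of_real pi * z) = 0" by (metis Im_complex_of_real)
    with assms show False by simp
  qed
  have "((\<lambda>z. Gamma (1 - z)) has_field_derivative Gamma (1 - z) * Digamma (1 - z) * (0 - 1)) (at z)"
    by (rule DERIV_chain2[where g = "\<lambda>z. 1 - z", OF has_field_derivative_Gamma[OF 1(2)]]) (intro derivative_intros)
  from DERIV_mult[OF has_field_derivative_Gamma[OF 1(1)] this]
  have "((\<lambda>z. Gamma z * Gamma (1 - z)) has_field_derivative - (Gamma z * Gamma (1 - z) * cot_deriv 0 z)) (at z)"
    by (rule DERIV_cong) (simp add: cot_deriv_def algebra_simps)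
  then have d1: "((\<lambda>z. of_real pi / sin (of_real pi * z)) has_field_derivative
      - (of_real pi / sin (of_real pi * z) * cot_deriv 0 z)) (at z)"
    unfolding Gamma_reflection_complex .
  have "((\<lambda>z. of_real pi / sin (of_real pi * z)) has_field_derivative
      - (of_real pi * (cos (of_real pi * z) * of_real pi) / (sin (of_real pi * z) * sin (of_real pi * z)))) (at z)"
    using s by (auto intro!: derivative_eq_intros)
  from DERIV_unique[OF d1 this] show ?thesis using s by (simp add: field_simps)
qed

text \<open>The geometric series of \<open>\<pi> cot (\<pi> z) = \<pi> \<i> (q + 1) / (q - 1)\<close>.\<close>

lemma cot_q_series:
  assumes "Im z > 0"
  shows "(\<lambda>n. (if n = 0 then - (of_real pi * \<i>) else - (2 * of_real pi * \<i>)) * nome z ^ n) sums cot_deriv 0 z"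
proof -
  define e where "e = exp (\<i> * of_real pi * z)"
  have q: "nome z = e * e" unfolding nome_def e_def exp_add[symmetric] by (simp add: algebra_simps)
  have e: "exp (\<i> * (of_real pi * z)) = e" "exp (- (\<i> * (of_real pi * z))) = inverse e" "e \<noteq> 0"
    by (simp_all add: e_def exp_minus mult.assoc)
  have nq: "norm (nome z) < 1" using assms by (simp add: norm_nome)
  then have q1: "nome z \<noteq> 1" by auto
  have "cot_deriv 0 z = of_real pi * ((e + inverse e) / 2) / ((e - inverse e) / (2 * \<i>))"
    using assms unfolding cot_deriv_0[OF less_imp_neq[OF assms, symmetric]] cos_exp_eq sin_exp_eq e by simp
  also have "\<dots> = - (of_real pi * \<i>) * (1 + nome z) / (1 - nome z)"
  proof -
    have "e + inverse e = (1 + nome z) / e" "e - inverse e = - (1 - nome z) / e"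
      using e(3) by (simp_all add: q field_simps)
    then have "of_real pi * ((e + inverse e) / 2) / ((e - inverse e) / (2 * \<i>)) =
        of_real pi * ((1 + nome z) / e / 2) / (- (1 - nome z) / e / (2 * \<i>))" by (simp only:)
    also have "\<dots> = - (of_real pi * \<i>) * (1 + nome z) / (1 - nome z)"
      using e(3) q1 by (simp add: divide_simps)
    finally show ?thesis .
  qed
  also have "\<dots> = - (2 * of_real pi * \<i>) * (1 / (1 - nome z)) + of_real pi * \<i>"
    using q1 by (simp add: field_simps)
  finally have eq: "cot_deriv 0 z = - (2 * of_real pi * \<i>) * (1 / (1 - nome z)) + of_real pi * \<i>" .
  have "(\<lambda>n. if n = 0 then of_real pi * \<i> else 0) sums (of_real pi * \<i> :: complex)"
    using sums_single[of 0 "\<lambda>_. of_real pi * \<i> :: complex"] by simp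
  from sums_add[OF sums_mult[OF geometric_sums[OF nq], of "- (2 * of_real pi * \<i>)"] this]
  have "(\<lambda>n. - (2 * of_real pi * \<i>) * nome z ^ n + (if n = 0 then of_real pi * \<i> else 0)) sums cot_deriv 0 z"
    unfolding eq .
  moreover have "- (2 * of_real pi * \<i>) * nome z ^ n + (if n = 0 then of_real pi * \<i> else 0) =
      (if n = 0 then - (of_real pi * \<i>) else - (2 * of_real pi * \<i>)) * nome z ^ n" for n
    by (cases "n = 0") simp_all
  ultimately show ?thesis by (simp only:)
qed

lemma cot_deriv_q_series:
  "\<exists>a. \<forall>z. Im z > 0 \<longrightarrow> (\<lambda>\<nu>. a \<nu> * nome z ^ \<nu>) sums cot_deriv n z"
proof (induction n)
  case 0
  show ?case by (intro exI allI impI) (rule cot_q_series)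
next
  case (Suc n)
  then obtain a where a: "\<And>z. Im z > 0 \<Longrightarrow> (\<lambda>\<nu>. a \<nu> * nome z ^ \<nu>) sums cot_deriv n z" by (elim exE) blast
  have "(\<lambda>\<nu>. 2 * of_real pi * \<i> * of_nat \<nu> * a \<nu> * nome z ^ \<nu>) sums cot_deriv (Suc n) z" if z: "Im z > 0" for z
  proof -
    obtain D where D: "(\<lambda>\<nu>. 2 * of_real pi * \<i> * of_nat \<nu> * a \<nu> * nome z ^ \<nu>) sums D"
      "(cot_deriv n has_field_derivative D) (at z)"
      using q_series_derivative[OF a z] .
    have "D = cot_deriv (Suc n) z"
      using D(2) cot_deriv_has_field_derivative[of z n] z by (intro DERIV_unique) auto
    with D(1) show ?thesis by simp
  qed
  then show ?case by (intro exI allI impI)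
qed

lemma qexp_cot_deriv: "qexp (cot_deriv n)"
proof -
  obtain a where "\<forall>z. Im z > 0 \<longrightarrow> (\<lambda>\<nu>. a \<nu> * nome z ^ \<nu>) sums cot_deriv n z"
    using cot_deriv_q_series[of n] by (elim exE)
  then show ?thesis by (intro qexp_qseries[of a]) simp
qed

text \<open>Together with \<open>cot_deriv_q_series\<close> this is Lipschitz's formula. The terms with \<open>m \<ge> 0\<close> form a polygamma
series at \<open>z\<close>, those with \<open>m < 0\<close> one at \<open>1 - z\<close>.\<close>

lemma lattice_sum_pure:
  assumes z: "Im z > 0"
  shows "lattice_sum (int n + 2) 0 z = (-1) ^ Suc n / fact (Suc n) * cot_deriv (Suc n) z"
proof -
  define c :: complex where "c = (-1) ^ Suc (Suc n) * fact (Suc n)"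
  have c: "c \<noteq> 0" by (simp add: c_def del: fact_Suc)
  have powi: "w powi (- (int n + 2)) = inverse (w ^ Suc (Suc n))" for w :: complex
  proof -
    have "int n + 2 = int (Suc (Suc n))" by simp
    then show ?thesis by (simp only: power_int_minus power_int_of_nat)
  qed
  have P: "(\<lambda>k. inverse ((w + of_nat k) ^ Suc (Suc n))) sums (Polygamma (Suc n) w / c)" if "w \<noteq> 0" for w :: complex
  proof -
    have "summable (\<lambda>k. inverse ((w + of_nat k) ^ Suc (Suc n)))"
      using that by (rule Polygamma_converges') simp
    moreover have "Polygamma (Suc n) w = c * (\<Sum>k. inverse ((w + of_nat k) ^ Suc (Suc n)))"
      by (simp add: Polygamma_def c_def)
    ultimately show ?thesis using c by (simp add: sums_iff)
  qed
  have "lattice_sum (int n + 2) 0 z = Polygamma (Suc n) z / c + (-1) ^ Suc (Suc n) * (Polygamma (Suc n) (1 - z) / c)"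
    unfolding lattice_sum_def
  proof (rule infsum_int_split)
    show "(\<lambda>m. (z + of_int m) powi - (int n + 2) * (cnj z + of_int m) powi - 0) summable_on UNIV"
      by (rule lattice_term_summable[OF z]) simp
    show "(\<lambda>k. (z + of_int (int k)) powi - (int n + 2) * (cnj z + of_int (int k)) powi - 0) sums (Polygamma (Suc n) z / c)"
    proof -
      have "z \<noteq> 0" using z by auto
      from P[OF this] show ?thesis unfolding powi by simp
    qed
    have "(\<lambda>k. (-1) ^ Suc (Suc n) * inverse ((1 - z + of_nat k) ^ Suc (Suc n))) sums ((-1) ^ Suc (Suc n) * (Polygamma (Suc n) (1 - z) / c))"
      using z by (intro sums_mult P) (auto simp: complex_eq_iff)
    moreover have "(-1) ^ Suc (Suc n) * inverse ((1 - z + of_nat k) ^ Suc (Suc n)) =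
        inverse ((z + of_int (- int k - 1)) ^ Suc (Suc n))" for k
    proof -
      have "z + of_int (- int k - 1) = (-1) * (1 - z + of_nat k)" by simp
      then have "(z + of_int (- int k - 1)) ^ Suc (Suc n) = (-1) ^ Suc (Suc n) * (1 - z + of_nat k) ^ Suc (Suc n)"
        by (metis power_mult_distrib)
      moreover have "inverse ((-1) ^ Suc (Suc n)) = ((-1) ^ Suc (Suc n) :: complex)"
        unfolding power_inverse[symmetric] by simp
      ultimately show ?thesis by (simp only: inverse_mult_distrib)
    qed
    ultimately show "(\<lambda>k. (z + of_int (- int k - 1)) powi - (int n + 2) * (cnj z + of_int (- int k - 1)) powi - 0) sums
        ((-1) ^ Suc (Suc n) * (Polygamma (Suc n) (1 - z) / c))"
      unfolding powi by simp
  qed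
  also have "\<dots> = (-1) ^ Suc n / fact (Suc n) * cot_deriv (Suc n) z"
  proof -
    define s F :: complex where "s = (-1) ^ n" and "F = fact (Suc n)"
    have s: "s * s = 1" by (simp add: s_def power_mult_distrib[symmetric])
    have F: "F \<noteq> 0" by (simp add: F_def del: fact_Suc)
    have "c = s * F" by (simp add: c_def s_def F_def del: fact_Suc)
    moreover have "s \<noteq> 0" by (simp add: s_def)
    ultimately have div: "X / c = s * X / F" for X
      using s F by (simp add: divide_simps)
    have "Polygamma (Suc n) z / c + (-1) ^ Suc (Suc n) * (Polygamma (Suc n) (1 - z) / c) =
        (s * Polygamma (Suc n) z + (s * s) * Polygamma (Suc n) (1 - z)) / F"
      unfolding div by (simp add: s_def add_divide_distrib del: fact_Suc)
    also have "\<dots> = - s / F * (- s * Polygamma (Suc n) (1 - z) - Polygamma (Suc n) z)"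
      using F by (simp add: field_simps)
    finally show ?thesis by (simp add: s_def F_def cot_deriv_def del: fact_Suc)
  qed
  finally show ?thesis .
qed

text \<open>Partial fractions lead to the reciprocals of \<open>z + m\<close>, whose sum diverges. The differences of
conjugate reciprocals are summable, and these are what a difference of two digamma values adds up.\<close>

lemma lattice_sum_1_1:
  assumes z: "Im z > 0"
  shows "lattice_sum 1 1 z = (cnj (cot_deriv 0 z) - cot_deriv 0 z) / (2 * \<i> * of_real (Im z))"
proof -
  have nz: "z \<noteq> 0" "cnj z \<noteq> 0" "1 - z \<noteq> 0" "1 - cnj z \<noteq> 0" using z by (auto simp: complex_eq_iff)
  have D: "(\<lambda>k. inverse (w + of_nat k) - inverse (w' + of_nat k)) sums (Digamma w' - Digamma w)"
    if "w \<noteq> 0" "w' \<noteq> 0" for w w' :: complex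
  proof -
    have "(\<lambda>k. inverse (of_nat (Suc k)) - inverse (v + of_nat k)) sums (Digamma v + euler_mascheroni)"
      if "v \<noteq> 0" for v :: complex
      using summable_Digamma[OF that] by (simp add: Digamma_def sums_iff)
    from sums_diff[OF this[OF that(2)] this[OF that(1)]] show ?thesis by simp
  qed
  define y where "y = 2 * \<i> * complex_of_real (Im z)"
  have y: "y \<noteq> 0" using z by (simp add: y_def)
  have t: "(z + of_int m) powi - 1 * (cnj z + of_int m) powi - 1 =
      (inverse (cnj z + of_int m) - inverse (z + of_int m)) / y" for m
  proof -
    have "z + of_int m \<noteq> 0" "cnj z + of_int m \<noteq> 0" using uhp_add_of_int_nonzero z by auto
    moreover have "(z + of_int m) - (cnj z + of_int m) = y" by (simp add: y_def complex_eq_iff)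
    moreover have "inverse W * inverse V = (inverse V - inverse W) / (W - V)" if "W \<noteq> 0" "V \<noteq> 0" "W \<noteq> V" for W V :: complex
      using that by (simp add: field_simps)
    ultimately show ?thesis using y by (metis eq_iff_diff_eq_0 power_int_minus power_int_1_right)
  qed
  have "lattice_sum 1 1 z = (Digamma z - Digamma (cnj z)) / y + (Digamma (1 - cnj z) - Digamma (1 - z)) / y"
    unfolding lattice_sum_def
  proof (rule infsum_int_split)
    show "(\<lambda>m. (z + of_int m) powi - 1 * (cnj z + of_int m) powi - 1) summable_on UNIV"
      by (rule lattice_term_summable[OF z]) simp
    show "(\<lambda>k. (z + of_int (int k)) powi - 1 * (cnj z + of_int (int k)) powi - 1) sums ((Digamma z - Digamma (cnj z)) / y)"
      unfolding t using D[OF nz(2,1)] by (intro sums_divide) simp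
    have "inverse (cnj z + of_int (- int k - 1)) - inverse (z + of_int (- int k - 1)) =
        inverse (1 - z + of_nat k) - inverse (1 - cnj z + of_nat k)" for k
    proof -
      have "w + of_int (- int k - 1) = - (1 - w + of_nat k)" for w :: complex by simp
      then show ?thesis by (simp only: inverse_minus_eq) simp
    qed
    then show "(\<lambda>k. (z + of_int (- int k - 1)) powi - 1 * (cnj z + of_int (- int k - 1)) powi - 1) sums ((Digamma (1 - cnj z) - Digamma (1 - z)) / y)"
      unfolding t using D[OF nz(3,4)] by (intro sums_divide) simp
  qed
  also have "\<dots> = (cot_deriv 0 (cnj z) - cot_deriv 0 z) / y"
    by (simp add: cot_deriv_def add_divide_distrib diff_divide_distrib)
  also have "cot_deriv 0 (cnj z) = cnj (cot_deriv 0 z)"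
  proof -
    show ?thesis
      using z by (simp add: cot_deriv_0 cnj_cos cnj_sin)
  qed
  finally show ?thesis by (simp add: y_def)
qed

lemma qexp_divide_y:
  assumes "qexp f"
  shows "qexp (\<lambda>z. f z / (2 * \<i> * of_real (Im z)))"
proof -
  have "qexp (\<lambda>z. 1 / (2 * \<i>) * (of_real (Im z) powi (-1) * f z))"
    by (intro qexp_mult qexp_const qexp_y_powi assms)
  then show ?thesis by (rule qexp_cong) (simp add: power_int_minus field_simps)
qed

text \<open>The recursion lowers \<open>a + b\<close> until one exponent is zero or both are 1.\<close>

lemma qexp_lattice_sum_nonneg:
  "a + b = N \<Longrightarrow> N \<ge> 2 \<Longrightarrow> qexp (lattice_sum (int a) (int b))"
proof (induction N arbitrary: a b)
  case (Suc N)
  have pure: "qexp (lattice_sum (int a) 0)" if "a \<ge> 2" for a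
  proof -
    from that obtain n where a: "int a = int n + 2" by (metis add.commute le_Suc_ex of_nat_add of_nat_numeral)
    have "qexp (\<lambda>z. (-1) ^ Suc n / fact (Suc n) * cot_deriv (Suc n) z)"
      by (intro qexp_cmult qexp_cot_deriv)
    then show ?thesis unfolding a by (rule qexp_cong) (rule lattice_sum_pure)
  qed
  consider "b = 0" | "a = 0" | "a = 1 \<and> b = 1" | "a \<ge> 1 \<and> b \<ge> 1 \<and> N \<ge> 2"
    using Suc.prems by linarith
  then show ?case
  proof cases
    case 1
    then have "a \<ge> 2" using Suc.prems by simp
    from pure[OF this] 1 show ?thesis by (simp only: of_nat_0)
  next
    case 2
    then have "b \<ge> 2" using Suc.prems by simp
    from qexp_cnj[OF pure[OF this]] have "qexp (lattice_sum 0 (int b))"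
      by (rule qexp_cong) (rule lattice_sum_cnj)
    with 2 show ?thesis by (simp only: of_nat_0)
  next
    case 3
    have "qexp (\<lambda>z. (cnj (cot_deriv 0 z) - cot_deriv 0 z) / (2 * \<i> * of_real (Im z)))"
      by (intro qexp_divide_y qexp_diff qexp_cnj qexp_cot_deriv)
    then show ?thesis using 3 by (auto intro: qexp_cong lattice_sum_1_1)
  next
    case 4
    have 1: "qexp (lattice_sum (int a - 1) (int b))"
      using Suc.IH[of "a - 1" b] Suc.prems 4 by (simp add: of_nat_diff)
    have 2: "qexp (lattice_sum (int a) (int b - 1))"
      using Suc.IH[of a "b - 1"] Suc.prems 4 by (simp add: of_nat_diff)
    have "qexp (\<lambda>z. (lattice_sum (int a - 1) (int b) z - lattice_sum (int a) (int b - 1) z) / (2 * \<i> * of_real (Im z)))"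
      by (intro qexp_divide_y qexp_diff 1 2)
    then show ?thesis
    proof (rule qexp_cong)
      fix z :: complex assume z: "Im z > 0"
      have "int a + int b \<ge> 3" using 4 Suc.prems by linarith
      from lattice_sum_rec[OF z this] z
      show "lattice_sum (int a) (int b) z =
          (lattice_sum (int a - 1) (int b) z - lattice_sum (int a) (int b - 1) z) / (2 * \<i> * of_real (Im z))"
        by simp
    qed
  qed
qed simp

text \<open>For a negative second exponent the recursion is solved for the sum with the smaller one.\<close>

lemma qexp_lattice_sum_neg:
  "a - int n \<ge> 2 \<Longrightarrow> qexp (lattice_sum a (- int n))"
proof (induction n arbitrary: a)
  case 0
  then show ?case using qexp_lattice_sum_nonneg[of "nat a" 0 "nat a"] by simp
next
  case (Suc n)
  have 1: "qexp (lattice_sum (a - 1) (- int n))" "qexp (lattice_sum a (- int n))"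
    using Suc by auto
  have "qexp (\<lambda>z. lattice_sum (a - 1) (- int n) z - 2 * \<i> * of_real (Im z) powi 1 * lattice_sum a (- int n) z)"
    by (intro qexp_diff qexp_mult qexp_const qexp_y_powi 1)
  then show ?case
  proof (rule qexp_cong)
    fix z :: complex assume z: "Im z > 0"
    have "a + - int n \<ge> 3" using Suc.prems by simp
    from lattice_sum_rec[OF z this]
    have "lattice_sum a (- int n - 1) z = lattice_sum (a - 1) (- int n) z - 2 * \<i> * of_real (Im z) * lattice_sum a (- int n) z"
      by (simp add: algebra_simps)
    moreover have "- int (Suc n) = - int n - 1" by simp
    ultimately show "lattice_sum a (- int (Suc n)) z =
        lattice_sum (a - 1) (- int n) z - 2 * \<i> * of_real (Im z) powi 1 * lattice_sum a (- int n) z"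
      by (simp only: power_int_1_right)
  qed
qed

lemma qexp_lattice_sum:
  assumes "a + b \<ge> 2"
  shows "qexp (lattice_sum a b)"
proof -
  consider "a \<ge> 0 \<and> b \<ge> 0" | "b < 0" | "a < 0" by linarith
  then show ?thesis
  proof cases
    case 1
    then show ?thesis using qexp_lattice_sum_nonneg[of "nat a" "nat b" "nat (a + b)"] assms by auto
  next
    case 2
    then show ?thesis using qexp_lattice_sum_neg[of a "nat (- b)"] assms by simp
  next
    case 3
    then have "qexp (lattice_sum b a)" using qexp_lattice_sum_neg[of b "nat (- a)"] assms by simp
    then show ?thesis by (auto intro: qexp_cong[OF qexp_cnj] lattice_sum_cnj)
  qed
qed

section \<open>Sums over pairs of integers\<close>

lemma summable_pairs_inverse_square:
  "(\<lambda>p::int \<times> int. 1 / (max 1 \<bar>real_of_int (fst p)\<bar>) ^ 2 * (1 / (max 1 \<bar>real_of_int (snd p)\<bar>) ^ 2)) summable_on UNIV"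
proof -
  let ?f = "\<lambda>m::int. 1 / (max 1 \<bar>real_of_int m\<bar>) ^ 2"
  have "(?f has_sum infsum ?f UNIV) UNIV" "(\<lambda>m. norm (?f m)) summable_on UNIV"
    using summable_int_inverse_square by simp_all
  from has_sum_product[OF this this] show ?thesis
    by (auto intro: has_sum_imp_summable)
qed

lemma uhp_linear_nonzero:
  assumes "Im z \<noteq> 0" "c \<noteq> 0"
  shows "of_int c * z + of_int d \<noteq> 0" "of_int c * cnj z + of_int d \<noteq> 0"
  using assms by (auto simp: complex_eq_iff)

abbreviation pair_powers :: "int \<Rightarrow> int \<Rightarrow> complex \<Rightarrow> int \<Rightarrow> int \<Rightarrow> complex" where
  "pair_powers a b z c d \<equiv>
     (of_int c * z + of_int d) powi (- a) * (of_int c * cnj z + of_int d) powi (- b)"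

text \<open>With \<open>M = max |c| |d|\<close> the term is at most a constant times \<open>M^(- 4)\<close>, and \<open>M^4\<close> is at least the product of the
squares of \<open>max 1 |c|\<close> and \<open>max 1 |d|\<close>; the resulting double sum factors.\<close>

lemma pair_term_bound:
  assumes z: "Im z > 0" and ab: "a + b \<ge> 4"
  shows "\<exists>K. \<forall>c d. (c, d) \<noteq> (0, 0) \<longrightarrow>
    norm (pair_powers a b z c d) \<le>
    K * (1 / (max 1 \<bar>real_of_int c\<bar>) ^ 2 * (1 / (max 1 \<bar>real_of_int d\<bar>) ^ 2))"
proof -
  define K where "K = 1 / Im z + 1 + norm z / Im z"
  have K: "K \<ge> 1" using z by (simp add: K_def)
  show ?thesis
  proof (intro exI[of _ "K ^ nat (a + b)"] allI impI)
    fix c d :: int assume cd: "(c, d) \<noteq> (0, 0)"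
    let ?w = "of_int c * z + of_int d" and ?C = "max 1 \<bar>real_of_int c\<bar>" and ?D = "max 1 \<bar>real_of_int d\<bar>"
    define M where "M = max \<bar>real_of_int c\<bar> \<bar>real_of_int d\<bar>"
    have M1: "M \<ge> 1" using cd unfolding M_def by (cases "c = 0"; cases "d = 0"; simp; linarith)
    have MK: "M \<le> K * norm ?w"
      using max_coords_le_norm[OF z, of "of_int c" "of_int d"] by (simp add: K_def M_def)
    have w: "?w \<noteq> 0" using M1 MK by auto
    have "norm (?w powi (- a) * (of_int c * cnj z + of_int d) powi (- b)) = 1 / norm ?w ^ nat (a + b)"
      using w ab by (intro norm_powi_conjugates norm_cnj_linear) auto
    also have "\<dots> \<le> K ^ nat (a + b) * (1 / M ^ nat (a + b))"
    proof -
      have "M ^ nat (a + b) \<le> (K * norm ?w) ^ nat (a + b)" using MK M1 by (intro power_mono) auto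
      then show ?thesis using w M1 by (simp add: field_simps power_mult_distrib)
    qed
    also have "\<dots> \<le> K ^ nat (a + b) * (1 / M ^ 4)"
      using K ab M1 by (intro mult_left_mono divide_left_mono power_increasing) auto
    also have "\<dots> \<le> K ^ nat (a + b) * (1 / (?C ^ 2 * ?D ^ 2))"
    proof (intro mult_left_mono divide_left_mono)
      have "?C ^ 2 * ?D ^ 2 \<le> M ^ 2 * M ^ 2"
        using M1 by (intro mult_mono power_mono) (auto simp: M_def)
      also have "\<dots> = M ^ 4" by (simp add: power_add[symmetric])
      finally show "?C ^ 2 * ?D ^ 2 \<le> M ^ 4" .
    qed (use K M1 in auto)
    finally show "norm (?w powi (- a) * (of_int c * cnj z + of_int d) powi (- b)) \<le>
        K ^ nat (a + b) * (1 / ?C ^ 2 * (1 / ?D ^ 2))" by simp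
  qed
qed

lemma pair_sum_summable:
  assumes z: "Im z > 0" and ab: "a + b \<ge> 4" and p: "\<And>c d. norm (p c d) \<le> B"
    and D: "(0, 0) \<notin> D"
  shows "(\<lambda>(c, d). p c d * pair_powers a b z c d)
           summable_on D"
proof -
  obtain K where K: "\<forall>c d. (c, d) \<noteq> (0, 0) \<longrightarrow>
      norm (pair_powers a b z c d) \<le>
      K * (1 / (max 1 \<bar>real_of_int c\<bar>) ^ 2 * (1 / (max 1 \<bar>real_of_int d\<bar>) ^ 2))"
    using pair_term_bound[OF z ab] by (elim exE)
  have dom: "(\<lambda>p::int \<times> int. B * (K * (1 / (max 1 \<bar>real_of_int (fst p)\<bar>) ^ 2 * (1 / (max 1 \<bar>real_of_int (snd p)\<bar>) ^ 2)))) summable_on D"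
    by (rule summable_on_cmult_right, rule summable_on_cmult_right,
        rule summable_on_subset[OF summable_pairs_inverse_square subset_UNIV])
  show ?thesis
  proof (rule abs_summable_summable, rule summable_on_comparison_test[OF dom])
    fix u :: "int \<times> int" assume u: "u \<in> D"
    obtain c d where cd: "u = (c, d)" by (cases u)
    have "(c, d) \<noteq> (0, 0)" using u D cd by auto
    from mult_mono[OF p[of c d] K[rule_format, OF this]] order.trans[OF norm_ge_zero p[of c d]]
    show "norm (case u of (c, d) \<Rightarrow> p c d * pair_powers a b z c d) \<le>
        B * (K * (1 / (max 1 \<bar>real_of_int (fst u)\<bar>) ^ 2 * (1 / (max 1 \<bar>real_of_int (snd u)\<bar>) ^ 2)))"
      by (simp add: cd norm_mult)
  qed auto
qed

text \<open>Put \<open>d = d0 + c m\<close> with \<open>0 \<le> d0 < c\<close>. For fixed \<open>c\<close> and \<open>d0\<close> the sum over \<open>m\<close> is \<open>c^(- a - b)\<close> times the lattice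
sum at \<open>z + d0 / c\<close>. The whole sum is therefore an average of real translates of a single lattice sum.
The weights are absolutely summable, since the \<open>c\<close> residues of modulus at most \<open>B c^(- 4)\<close> each contribute
\<open>B c^(- 3)\<close>.\<close>

lemma qexp_pair_sum:
  fixes p :: "int \<Rightarrow> int \<Rightarrow> complex"
  assumes ab: "a + b \<ge> 4" and p: "\<And>c d. norm (p c d) \<le> B"
    and periodic: "\<And>c d m. c \<ge> 1 \<Longrightarrow> p c (d + c * m) = p c d"
  shows "qexp (\<lambda>z. \<Sum>\<^sub>\<infinity>(c, d)\<in>{1..} \<times> UNIV.
     p c d * pair_powers a b z c d)"
proof -
  define I where "I = (SIGMA c:{1::int..}. {0..<c})"
  define w where "w i = p (fst i) (snd i) * of_int (fst i) powi (- (a + b))" for i :: "int \<times> int"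
  define x where "x i = real_of_int (snd i) / real_of_int (fst i)" for i :: "int \<times> int"
  have B: "B \<ge> 0" using order.trans[OF norm_ge_zero p] .
  have norm_w: "norm (w (c, d)) \<le> B / real_of_int c ^ 4" if "c \<ge> 1" for c d
  proof -
    have c: "real_of_int c \<ge> 1" using that by simp
    have "norm (w (c, d)) = norm (p c d) * real_of_int c powi (- (a + b))"
      using that by (simp add: w_def norm_mult norm_power_int)
    also have "\<dots> = norm (p c d) * (1 / real_of_int c ^ nat (a + b))"
    proof -
      have "0 \<le> a + b" using ab by simp
      then show ?thesis by (simp only: power_int_minus power_int_nonneg_exp divide_inverse mult_1)
    qed
    also have "\<dots> \<le> B * (1 / real_of_int c ^ 4)"
      using p[of c d] c ab B by (intro mult_mono divide_left_mono power_increasing) auto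
    finally show ?thesis by simp
  qed
  have w: "(\<lambda>i. norm (w i)) summable_on I"
    unfolding I_def
  proof (rule summable_on_SigmaI[where g = "\<lambda>c. \<Sum>d\<in>{0..<c}. norm (w (c, d))"])
    show "((\<lambda>d. norm (w (c, d))) has_sum (\<Sum>d\<in>{0..<c}. norm (w (c, d)))) {0..<c}" for c
      by (rule has_sum_finite) simp
    have "(\<lambda>c::int. B * (1 / (max 1 \<bar>real_of_int c\<bar>) ^ 2)) summable_on {1..}"
      by (rule summable_on_cmult_right, rule summable_on_subset[OF summable_int_inverse_square subset_UNIV])
    then show "(\<lambda>c. \<Sum>d\<in>{0..<c}. norm (w (c, d))) summable_on {1..}"
    proof (rule summable_on_comparison_test)
      fix c :: int assume "c \<in> {1..}"
      then have c: "c \<ge> 1" "real_of_int c \<ge> 1" by simp_all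
      have "(\<Sum>d\<in>{0..<c}. norm (w (c, d))) \<le> (\<Sum>d\<in>{0..<c}. B / real_of_int c ^ 4)"
        using norm_w[OF c(1)] by (intro sum_mono) auto
      also have "\<dots> = B * (1 / real_of_int c ^ 3)"
        using c by (simp add: field_simps eval_nat_numeral)
      also have "\<dots> \<le> B * (1 / real_of_int c ^ 2)"
        using c B by (intro mult_left_mono divide_left_mono power_increasing) auto
      finally show "(\<Sum>d\<in>{0..<c}. norm (w (c, d))) \<le> B * (1 / (max 1 \<bar>real_of_int c\<bar>) ^ 2)"
        using c by (simp add: max_def)
    qed (auto intro: sum_nonneg)
  qed auto
  have "qexp (\<lambda>z. \<Sum>\<^sub>\<infinity>i\<in>I. w i * lattice_sum a b (z + of_real (x i)))"
    by (rule qexp_average[OF w qexp_lattice_sum]) (use ab in simp)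
  then show ?thesis
  proof (rule qexp_cong)
    fix z :: complex assume z: "Im z > 0"
    define t where "t u = (case u of (c, d) \<Rightarrow>
        p c d * pair_powers a b z c d)" for u
    have "t summable_on ({1..} \<times> UNIV)"
      unfolding t_def by (rule pair_sum_summable[OF z ab p]) auto
    then obtain S where S: "(t has_sum S) ({1..} \<times> UNIV)" by (auto simp: summable_on_def)
    \<comment> \<open>Division with remainder of \<open>d\<close> by \<open>c\<close>.\<close>
    have "bij_betw (\<lambda>(i, m). (fst i, snd i + fst i * m)) (I \<times> UNIV) ({1..} \<times> UNIV)"
      by (rule bij_betwI[where g = "\<lambda>(c, d). ((c, d mod c), d div c)"]) (auto simp: I_def)
    from has_sum_reindex_bij_betw[OF this, of t S] S
    have S': "((\<lambda>u. t (fst (fst u), snd (fst u) + fst (fst u) * snd u)) has_sum S) (I \<times> UNIV)"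
      by (simp add: case_prod_unfold)
    have "((\<lambda>i. w i * lattice_sum a b (z + of_real (x i))) has_sum S) I"
    proof (rule has_sum_SigmaD[OF S'])
      fix i assume i: "i \<in> I"
      obtain c d where cd: "i = (c, d)" by (cases i)
      have c: "c \<ge> 1" using i by (simp add: cd I_def)
      define z' where "z' = z + of_real (x i)"
      have z': "Im z' > 0" using z by (simp add: z'_def)
      have eq: "t (fst i, snd i + fst i * m) = w i * ((z' + of_int m) powi (- a) * (cnj z' + of_int m) powi (- b))" for m
      proof -
        have 1: "of_int c * z + of_int (d + c * m) = of_int c * (z' + of_int m)"
          "of_int c * cnj z + of_int (d + c * m) = of_int c * (cnj z' + of_int m)"
          using c by (simp_all add: z'_def x_def cd field_simps)
        have 2: "complex_of_int c powi (- (a + b)) = of_int c powi (- a) * of_int c powi (- b)"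
          using c by (simp add: power_int_add[symmetric])
        show ?thesis
          unfolding t_def w_def cd fst_conv snd_conv prod.case 1 2 periodic[OF c] power_int_mult_distrib
          by (simp add: mult_ac)
      qed
      show "((\<lambda>m. t (fst (fst (i, m)), snd (fst (i, m)) + fst (fst (i, m)) * snd (i, m))) has_sum
          w i * lattice_sum a b (z + of_real (x i))) UNIV"
        unfolding fst_conv snd_conv eq[unfolded fst_conv snd_conv] z'_def[symmetric] lattice_sum_def
        by (intro has_sum_cmult_right has_sum_infsum lattice_term_summable z') (use ab in simp)
    qed
    then have "(\<Sum>\<^sub>\<infinity>i\<in>I. w i * lattice_sum a b (z + of_real (x i))) = S" by (rule infsumI)
    with infsumI[OF S] show "(\<Sum>\<^sub>\<infinity>(c, d)\<in>{1..} \<times> UNIV.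
        p c d * pair_powers a b z c d) =
        (\<Sum>\<^sub>\<infinity>i\<in>I. w i * lattice_sum a b (z + of_real (x i)))"
      by (simp add: t_def[abs_def])
  qed
qed

section \<open>Iterated primitives of a cusp form\<close>

lemma power_le_fact_exp:
  assumes "y \<ge> (0::real)"
  shows "y ^ h \<le> fact h * exp y"
proof -
  have "(\<Sum>n\<in>{h}. y ^ n / fact n) \<le> exp y"
    by (rule finite_sum_le_has_sum[OF has_sum_exp(1)]) (use assms in auto)
  then show ?thesis by (simp add: field_simps)
qed

text \<open>The improper form of the fundamental theorem, by dominated convergence of the truncated integrals.\<close>

lemma has_integral_from_0_to_infinity:
  fixes F f :: "real \<Rightarrow> complex"
  assumes F: "\<And>t. t \<ge> 0 \<Longrightarrow> (F has_vector_derivative f t) (at t)"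
    and le: "\<And>t. t \<ge> 0 \<Longrightarrow> norm (f t) \<le> C * exp (- t)"
    and lim: "(\<lambda>N. F (real N)) \<longlonglongrightarrow> 0"
  shows "(f has_integral (- F 0)) {0..}"
proof (rule has_integral_dominated_convergence)
  show "((\<lambda>t. if t \<in> {0..real N} then f t else 0) has_integral (F (real N) - F 0)) {0..}" for N
  proof (subst has_integral_restrict)
    show "(f has_integral (F (real N) - F 0)) {0..real N}"
      by (rule fundamental_theorem_of_calculus) (auto intro: has_vector_derivative_at_within F)
  qed auto
  have "(\<lambda>t::real. exp (- 1 * t)) integrable_on {0..}"
    using has_integral_exp_minus_to_infinity[of 1 0] by (auto simp: integrable_on_def)
  then show "(\<lambda>t. C * exp (- t)) integrable_on {0..}"
    using integrable_on_mult_right[of "\<lambda>t. exp (- t)" "{0..}" C] by simp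
  have C: "C \<ge> 0" using order.trans[OF norm_ge_zero le[of 0]] by simp
  show "\<forall>t\<in>{0..}. norm (if t \<in> {0..real N} then f t else 0) \<le> C * exp (- t)" for N
    using le C by auto
  show "\<forall>t\<in>{0..}. (\<lambda>N. if t \<in> {0..real N} then f t else 0) \<longlonglongrightarrow> f t"
  proof
    fix t :: real assume t: "t \<in> {0..}"
    have "eventually (\<lambda>N. f t = (if t \<in> {0..real N} then f t else 0)) sequentially"
      using eventually_ge_at_top[of "nat \<lceil>t\<rceil>"] by eventually_elim (use t in \<open>auto simp: nat_le_iff ceiling_le_iff\<close>)
    then show "(\<lambda>N. if t \<in> {0..real N} then f t else 0) \<longlonglongrightarrow> f t"
      by (rule Lim_transform_eventually[OF tendsto_const])
  qed
  show "(\<lambda>N. F (real N) - F 0) \<longlonglongrightarrow> - F 0"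
    using tendsto_diff[OF lim tendsto_const[of "F 0"]] by simp
qed

lemma nome_of_int [simp]: "nome (of_int N) = 1"
  using exp_integer_2pi[of "of_int N"] by (simp add: nome_def mult_ac)

locale cusp_form =
  fixes f :: "complex \<Rightarrow> complex" and k :: nat and a :: "nat \<Rightarrow> complex"
  assumes k: "k \<ge> 12" "even k"
    and cusp_form: "f \<in> cusp_forms (int k)"
    and a_0: "a 0 = 0"
    and f_sums: "\<And>z. Im z > 0 \<Longrightarrow> (\<lambda>\<nu>. a \<nu> * nome z ^ \<nu>) sums f z"
begin

text \<open>Up to a power of \<open>\<i>\<close>, the \<open>m\<close>-th iterated primitive of \<open>f\<close> that vanishes at the cusp. At \<open>\<nu> = 0\<close> the division by
zero has the value 0, in agreement with \<open>a 0 = 0\<close>.\<close>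

definition A :: "nat \<Rightarrow> complex \<Rightarrow> complex" where
  "A m z = (\<Sum>\<nu>. a \<nu> / of_real (2 * pi * real \<nu>) ^ m * nome z ^ \<nu>)"

lemma abs_summable:
  assumes "Im z > 0"
  shows "summable (\<lambda>\<nu>. norm (a \<nu>) * norm (nome z) ^ \<nu>)"
proof -
  let ?w = "z - \<i> * of_real (Im z / 2)"
  have "summable (\<lambda>\<nu>. a \<nu> * nome ?w ^ \<nu>)"
    using f_sums[of ?w] assms by (auto intro: sums_summable)
  moreover have "norm (nome z) < norm (nome ?w)"
    using assms by (simp add: norm_nome)
  ultimately have "summable (\<lambda>\<nu>. norm (a \<nu> * nome z ^ \<nu>))"
    by (rule powser_insidea)
  then show ?thesis by (simp add: norm_mult norm_power)
qed

lemma norm_coeff_le: "norm (a \<nu> / of_real (2 * pi * real \<nu>) ^ m) \<le> norm (a \<nu>)"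
proof (cases "\<nu> = 0")
  case False
  then have "1 \<le> 2 * pi * real \<nu>"
    using pi_ge_two mult_mono[of 1 "2 * pi" 1 "real \<nu>"] by simp
  then have "1 \<le> (2 * pi * real \<nu>) ^ m" by (rule one_le_power)
  then have "norm (a \<nu>) / (2 * pi * real \<nu>) ^ m \<le> norm (a \<nu>) / 1"
    by (intro divide_left_mono) auto
  then show ?thesis by (simp add: norm_divide norm_power norm_mult)
qed (simp add: a_0)

lemma norm_term_le:
  "norm (a \<nu> / of_real (2 * pi * real \<nu>) ^ m * nome z ^ \<nu>) \<le> norm (a \<nu>) * norm (nome z) ^ \<nu>"
  unfolding norm_mult norm_power by (rule mult_right_mono[OF norm_coeff_le]) simp

lemma A_sums:
  assumes "Im z > 0"
  shows "(\<lambda>\<nu>. a \<nu> / of_real (2 * pi * real \<nu>) ^ m * nome z ^ \<nu>) sums A m z"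
  unfolding A_def
  by (rule summable_sums, rule summable_comparison_test'[OF abs_summable[OF assms], of 0]) (rule norm_term_le)

lemma A_0: "Im z > 0 \<Longrightarrow> A 0 z = f z"
  using A_sums[of z 0] f_sums[of z] sums_unique2 by simp blast

lemma qexp_A: "qexp (A m)"
  by (rule qexp_qseries[of "\<lambda>\<nu>. a \<nu> / of_real (2 * pi * real \<nu>) ^ m"]) (rule A_sums)

lemma A_has_field_derivative:
  assumes z: "Im z > 0"
  shows "(A (Suc m) has_field_derivative \<i> * A m z) (at z)"
proof -
  obtain D where D: "(\<lambda>\<nu>. 2 * of_real pi * \<i> * of_nat \<nu> * (a \<nu> / of_real (2 * pi * real \<nu>) ^ Suc m) * nome z ^ \<nu>) sums D"
    "(A (Suc m) has_field_derivative D) (at z)"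
    using q_series_derivative[OF A_sums z] .
  have "2 * of_real pi * \<i> * of_nat \<nu> * (a \<nu> / of_real (2 * pi * real \<nu>) ^ Suc m) * nome z ^ \<nu> =
      \<i> * (a \<nu> / of_real (2 * pi * real \<nu>) ^ m * nome z ^ \<nu>)" for \<nu>
    by (cases "\<nu> = 0") (simp_all add: a_0 field_simps)
  then have "(\<lambda>\<nu>. \<i> * (a \<nu> / of_real (2 * pi * real \<nu>) ^ m * nome z ^ \<nu>)) sums D"
    using D(1) by (simp only:)
  then have "D = \<i> * A m z"
    using sums_mult[OF A_sums[OF z]] sums_unique2 by blast
  with D(2) show ?thesis by simp
qed

lemma A_periodic: "A m (z + of_int N) = A m z"
  unfolding A_def nome_shift by simp

text \<open>The constant term vanishes, so \<open>q\<close> can be split off; what remains is bounded by the absolute series at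
\<open>\<i> / 2\<close>, whatever \<open>m\<close> is.\<close>

lemma A_decay: "\<exists>C\<ge>0. \<forall>m z. Im z \<ge> 1/2 \<longrightarrow> norm (A m z) \<le> C * exp (- 2 * pi * Im z)"
proof -
  define w where "w = \<i> / 2"
  define C where "C = (\<Sum>\<nu>. norm (a \<nu>) * norm (nome w) ^ \<nu>) * exp pi"
  have sw: "summable (\<lambda>\<nu>. norm (a \<nu>) * norm (nome w) ^ \<nu>)"
    by (rule abs_summable) (simp add: w_def)
  have "norm (A m z) \<le> C * exp (- 2 * pi * Im z)" if z: "Im z \<ge> 1/2" for m z
  proof -
    have le: "norm (a \<nu> / of_real (2 * pi * real \<nu>) ^ m * nome z ^ \<nu>) \<le>
        norm (a \<nu>) * norm (nome w) ^ \<nu> * exp (pi - 2 * pi * Im z)" for \<nu>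
    proof (cases \<nu>)
      case (Suc n)
      have "norm (nome z) ^ \<nu> = norm (nome w) ^ \<nu> * exp (pi - 2 * pi * Im z) ^ \<nu>"
        by (simp add: power_mult_distrib[symmetric] norm_nome w_def exp_add[symmetric])
      also have "\<dots> \<le> norm (nome w) ^ \<nu> * exp (pi - 2 * pi * Im z) ^ 1"
        using z Suc by (intro mult_left_mono power_decreasing) auto
      finally have "norm (nome z) ^ \<nu> \<le> norm (nome w) ^ \<nu> * exp (pi - 2 * pi * Im z)" by simp
      from mult_left_mono[OF this, of "norm (a \<nu>)"] norm_term_le[of \<nu> m z] show ?thesis
        by (simp add: mult.assoc)
    qed (simp add: a_0)
    have "norm (A m z) \<le> (\<Sum>\<nu>. norm (a \<nu>) * norm (nome w) ^ \<nu> * exp (pi - 2 * pi * Im z))"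
      unfolding A_def by (rule norm_suminf_le[OF le]) (rule summable_mult2[OF sw])
    also have "\<dots> = C * exp (- 2 * pi * Im z)"
      by (subst suminf_mult2[OF sw, symmetric]) (simp add: C_def exp_diff exp_minus divide_inverse)
    finally show ?thesis .
  qed
  moreover have "C \<ge> 0" unfolding C_def by (intro mult_nonneg_nonneg suminf_nonneg[OF sw]) auto
  ultimately show ?thesis by blast
qed

lemma f_modular:
  assumes "\<gamma> \<in> SL2Z" "Im z > 0"
  shows "f (moebius \<gamma> z) = j_factor \<gamma> z ^ k * f z"
  using cusp_form assms unfolding cusp_forms_def upper_half_plane_def by simp

definition S_mat :: int_mat where "S_mat = vector [vector [0, - 1], vector [1, 0]]"

lemma f_inversion: "Im z > 0 \<Longrightarrow> f (- 1 / z) = z ^ k * f z"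
  using f_modular[of S_mat z]
  by (simp add: S_mat_def SL2Z_iff moebius_def j_factor_def vector_2)

text \<open>Hecke's estimate. The function \<open>y^(k / 2) |f|\<close> does not change under \<open>z \<mapsto> z + 1\<close> and \<open>z \<mapsto> - 1 / z\<close>. If
\<open>Im z < 1 / 2\<close>, then some integral translate \<open>w\<close> has \<open>|w|^2 < 1 / 2\<close>, and inverting it at least doubles the
imaginary part. Finitely many steps lead to height \<open>1 / 2\<close>, above which \<open>f\<close> decays exponentially.\<close>

lemma hecke_bound: "\<exists>K. \<forall>z. Im z > 0 \<longrightarrow> Im z ^ (k div 2) * norm (f z) \<le> K"
proof -
  define h where "h = k div 2"
  have k2: "k = 2 * h" using k by (simp add: h_def)
  define g where "g z = Im z ^ h * norm (f z)" for z
  obtain C where C: "C \<ge> 0" "\<And>m z. Im z \<ge> 1/2 \<Longrightarrow> norm (A m z) \<le> C * exp (- 2 * pi * Im z)"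
    using A_decay by blast
  have top: "g z \<le> fact h * C" if z: "Im z \<ge> 1/2" for z
  proof -
    have "g z \<le> (fact h * exp (Im z)) * (C * exp (- 2 * pi * Im z))"
      unfolding g_def using C(2)[of z 0] z A_0[of z] C(1)
      by (intro mult_mono power_le_fact_exp) auto
    also have "\<dots> = fact h * C * exp (Im z - 2 * pi * Im z)"
      by (simp add: exp_add[symmetric])
    also have "\<dots> \<le> fact h * C * 1"
    proof -
      have "1 * Im z \<le> 2 * pi * Im z" using z pi_ge_two by (intro mult_right_mono) auto
      then show ?thesis using C(1) by (intro mult_left_mono) auto
    qed
    finally show ?thesis by simp
  qed
  have g_shift: "g (z + of_int N) = g z" if "Im z > 0" for z N
    using A_periodic[of 0 z N] A_0[of z] A_0[of "z + of_int N"] that by (simp add: g_def)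
  have g_inv: "g (- 1 / z) = g z" if z: "Im z > 0" for z
  proof -
    have "z \<noteq> 0" using z by auto
    then have n: "norm z > 0" by simp
    have "Im (- 1 / z) = Im z / norm z ^ 2" by (simp add: Im_divide cmod_power2)
    then have "g (- 1 / z) = (Im z / norm z ^ 2) ^ h * (norm z ^ k * norm (f z))"
      by (simp only: g_def f_inversion[OF z] norm_mult norm_power)
    then show ?thesis using n by (simp add: g_def k2 power_divide power_mult)
  qed
  \<comment> \<open>Induction on the number of doublings that are needed to reach height 1/2.\<close>
  have "g z \<le> fact h * C" if "Im z * 2 ^ N \<ge> 1/2" for N z
    using that
  proof (induction N arbitrary: z)
    case 0
    then show ?case by (intro top) simp
  next
    case (Suc N)
    show ?case
    proof (cases "Im z \<ge> 1/2")
      case False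
      define w where "w = z + of_int (- round (Re z))"
      have "0 < Im z * 2 ^ Suc N" using Suc.prems by linarith
      then have z: "Im z > 0" by (simp add: zero_less_mult_iff)
      have Imw: "Im w = Im z" by (simp add: w_def)
      have "\<bar>Re w\<bar> \<le> 1/2" using of_int_round_abs_le[of "Re z"] by (simp add: w_def abs_minus_commute)
      then have "Re w ^ 2 \<le> (1/2) ^ 2" by (intro power2_le_iff_abs_le[THEN iffD2]) auto
      moreover have "Im w ^ 2 < (1/2) ^ 2" using False z Imw by (intro power_strict_mono) auto
      ultimately have n2: "norm w ^ 2 < 1/2" by (simp add: cmod_power2 power_divide)
      have n0: "norm w ^ 2 > 0" using z Imw by (auto simp: complex_eq_iff)
      have "Im w * 2 \<le> Im w / norm w ^ 2"
      proof -
        have "Im w * (2 * norm w ^ 2) \<le> Im w * 1"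
          using n2 z Imw by (intro mult_left_mono) auto
        then show ?thesis using n0 by (simp add: field_simps)
      qed
      also have "Im w / norm w ^ 2 = Im (- 1 / w)" by (simp add: Im_divide cmod_power2)
      finally have "Im w * 2 * 2 ^ N \<le> Im (- 1 / w) * 2 ^ N" by (rule mult_right_mono) simp
      then have "Im (- 1 / w) * 2 ^ N \<ge> 1/2" using Suc.prems Imw by simp
      from Suc.IH[OF this] g_inv[of w] g_shift[OF z, of "- round (Re z)"] z Imw show ?thesis
        by (simp add: w_def)
    qed (rule top)
  qed
  moreover have "\<exists>N. Im z * 2 ^ N \<ge> 1/2" if "Im z > 0" for z
  proof -
    obtain N where "1 / (2 * Im z) < 2 ^ N" using real_arch_pow[of 2] by auto
    then show ?thesis using that by (intro exI[of _ N]) (simp add: field_simps)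
  qed
  ultimately show ?thesis unfolding g_def h_def by blast
qed

text \<open>Near the real line this is Hecke's estimate, as \<open>k - 2 \<ge> k / 2\<close>; near the cusp it is the decay of \<open>f\<close>.\<close>

lemma f_bound: "\<exists>K\<ge>0. \<forall>z. Im z > 0 \<longrightarrow> norm (f z) * Im z ^ (k - 2) \<le> K * exp (- Im z)"
proof -
  obtain H where H: "\<And>z. Im z > 0 \<Longrightarrow> Im z ^ (k div 2) * norm (f z) \<le> H"
    using hecke_bound by blast
  obtain C where C: "C \<ge> 0" "\<And>m z. Im z \<ge> 1/2 \<Longrightarrow> norm (A m z) \<le> C * exp (- 2 * pi * Im z)"
    using A_decay by blast
  have "norm (f \<i>) \<le> H" using H[of \<i>] by simp
  from order.trans[OF norm_ge_zero this] have H0: "H \<ge> 0" .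
  have "norm (f z) * Im z ^ (k - 2) \<le> (H * exp 1 + C * fact (k - 2)) * exp (- Im z)" if z: "Im z > 0" for z
  proof (cases "Im z \<le> 1")
    case True
    have "norm (f z) * Im z ^ (k - 2) \<le> norm (f z) * Im z ^ (k div 2)"
      using z True k by (intro mult_left_mono power_decreasing) auto
    also have "\<dots> \<le> H" using H[OF z] by (simp add: mult.commute)
    also have "\<dots> = H * exp 1 * exp (- 1)" by (simp add: exp_minus)
    also have "\<dots> \<le> (H * exp 1 + C * fact (k - 2)) * exp (- Im z)"
      using True H0 C(1) by (intro mult_mono) auto
    finally show ?thesis .
  next
    case False
    have "norm (f z) * Im z ^ (k - 2) \<le> (C * exp (- 2 * pi * Im z)) * (fact (k - 2) * exp (Im z))"
      using C(2)[of z 0] A_0[OF z] False C(1)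
      by (intro mult_mono power_le_fact_exp) auto
    also have "\<dots> = C * fact (k - 2) * exp (- 2 * pi * Im z + Im z)"
      by (simp only: exp_add) simp
    also have "\<dots> \<le> (H * exp 1 + C * fact (k - 2)) * exp (- Im z)"
    proof (intro mult_mono)
      have "2 * Im z \<le> 2 * pi * Im z" using z pi_ge_two by (intro mult_right_mono) auto
      then show "exp (- 2 * pi * Im z + Im z) \<le> exp (- Im z)" by simp
    qed (use H0 C(1) in auto)
    finally show ?thesis .
  qed
  moreover have "H * exp 1 + C * fact (k - 2) \<ge> 0" using H0 C(1) by simp
  ultimately show ?thesis by blast
qed

text \<open>Both \<open>y\<close> and \<open>t\<close> are at most the height \<open>y + t\<close> of the point at which \<open>f\<close> is evaluated.\<close>

lemma f_moment_bound:
  "\<exists>K\<ge>0. \<forall>m z t. m \<le> k - 2 \<longrightarrow> Im z > 0 \<longrightarrow> t \<ge> 0 \<longrightarrow>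
     norm (f (z + \<i> * of_real t) * of_real t ^ m) * Im z ^ (k - 2 - m) \<le> K * exp (- t)"
proof -
  obtain K where K: "K \<ge> 0" "\<And>z. Im z > 0 \<Longrightarrow> norm (f z) * Im z ^ (k - 2) \<le> K * exp (- Im z)"
    using f_bound by blast
  have "norm (f (z + \<i> * of_real t) * of_real t ^ m) * Im z ^ (k - 2 - m) \<le> K * exp (- t)"
    if m: "m \<le> k - 2" and z: "Im z > 0" and t: "t \<ge> 0" for m z t
  proof -
    let ?w = "z + \<i> * of_real t"
    have "norm (f ?w * of_real t ^ m) * Im z ^ (k - 2 - m) = norm (f ?w) * (t ^ m * Im z ^ (k - 2 - m))"
      using t by (simp add: norm_mult norm_power)
    also have "\<dots> \<le> norm (f ?w) * (Im ?w ^ m * Im ?w ^ (k - 2 - m))"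
      using z t by (intro mult_left_mono mult_mono power_mono) auto
    also have "\<dots> = norm (f ?w) * Im ?w ^ (k - 2)"
      by (simp only: power_add[symmetric] le_add_diff_inverse[OF m])
    also have "\<dots> \<le> K * exp (- Im ?w)" using z t by (intro K) auto
    also have "\<dots> \<le> K * exp (- t)" using z K(1) by (intro mult_left_mono) auto
    finally show ?thesis .
  qed
  with K(1) show ?thesis by blast
qed

text \<open>Iterated integration by parts, carried out at once: as \<open>d/dt A (l + 1) (z + \<i> t) = - A l (z + \<i> t)\<close>, the
derivative of the sum \<open>F\<close> below telescopes to the integrand.\<close>

lemma f_moment:
  assumes z: "Im z > 0" and m: "m \<le> k - 2"
  shows "((\<lambda>t. f (z + \<i> * of_real t) * of_real t ^ m) has_integral (fact m * A (Suc m) z)) {0..}"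
    (is "(?f has_integral _) _")
proof -
  obtain K where K: "K \<ge> 0" "\<forall>m z t. m \<le> k - 2 \<longrightarrow> Im z > 0 \<longrightarrow> t \<ge> 0 \<longrightarrow>
      norm (f (z + \<i> * of_real t) * of_real t ^ m) * Im z ^ (k - 2 - m) \<le> K * exp (- t)"
    using f_moment_bound by (elim exE conjE)
  obtain C where C: "C \<ge> 0" "\<And>m z. Im z \<ge> 1/2 \<Longrightarrow> norm (A m z) \<le> C * exp (- 2 * pi * Im z)"
    using A_decay by blast
  define c where "c l = (fact m / fact (m - l) :: complex)" for l
  define F where "F t = - (\<Sum>l\<le>m. c l * of_real t ^ (m - l) * A (Suc l) (z + \<i> * of_real t))" for t :: real
  have der: "(F has_vector_derivative ?f t) (at t)" if t: "t \<ge> 0" for t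
  proof -
    let ?w = "z + \<i> * of_real t"
    have w: "Im ?w > 0" using z t by simp
    have dA: "((\<lambda>t. A (Suc l) (z + \<i> * of_real t)) has_vector_derivative (- A l ?w)) (at t)" for l
    proof -
      have "((\<lambda>u. A (Suc l) (z + \<i> * u)) has_field_derivative (\<i> * A l ?w * \<i>)) (at (of_real t))"
        by (rule DERIV_chain2[where g = "\<lambda>u. z + \<i> * u", OF A_has_field_derivative[OF w]]) (auto intro!: derivative_eq_intros)
      from has_vector_derivative_real_field[OF this] show ?thesis by (simp add: mult_ac)
    qed
    have dt: "((\<lambda>t. complex_of_real t ^ j) has_vector_derivative (of_nat j * of_real t ^ (j - 1))) (at t)" for j
    proof -
      have "((\<lambda>u. u ^ j) has_field_derivative (of_nat j * of_real t ^ (j - 1))) (at (complex_of_real t))"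
        by (auto intro!: derivative_eq_intros)
      from has_vector_derivative_real_field[OF this] show ?thesis .
    qed
    have "(F has_vector_derivative - (\<Sum>l\<le>m. c l * (of_real t ^ (m - l) * (- A l ?w) +
        of_nat (m - l) * of_real t ^ (m - l - 1) * A (Suc l) ?w))) (at t)"
      unfolding F_def mult.assoc
      by (intro has_vector_derivative_minus has_vector_derivative_sum has_vector_derivative_mult_right
          has_vector_derivative_mult[OF dt dA, unfolded mult.assoc])
    also have "- (\<Sum>l\<le>m. c l * (of_real t ^ (m - l) * (- A l ?w) +
        of_nat (m - l) * of_real t ^ (m - l - 1) * A (Suc l) ?w)) =
        - (\<Sum>l\<le>m. (if l < m then c (Suc l) * of_real t ^ (m - Suc l) * A (Suc l) ?w else 0) -
            c l * of_real t ^ (m - l) * A l ?w)"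
    proof (intro arg_cong[of _ _ uminus] sum.cong refl)
      fix l assume "l \<in> {..m}"
      have "c l * of_nat (m - l) = (if l < m then c (Suc l) else 0)"
      proof (cases "l < m")
        case True
        then obtain j where "m - l = Suc j" "m - Suc l = j" by (metis Suc_diff_Suc)
        moreover have "1 + of_nat j \<noteq> (0 :: complex)" by (metis of_nat_Suc of_nat_neq_0)
        ultimately show ?thesis using True by (simp add: c_def)
      qed simp
      then have "c l * (of_nat (m - l) * of_real t ^ (m - l - 1) * A (Suc l) ?w) =
          (if l < m then c (Suc l) * of_real t ^ (m - Suc l) * A (Suc l) ?w else 0)"
        by (simp add: mult.assoc[symmetric])
      then show "c l * (of_real t ^ (m - l) * (- A l ?w) + of_nat (m - l) * of_real t ^ (m - l - 1) * A (Suc l) ?w) =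
          (if l < m then c (Suc l) * of_real t ^ (m - Suc l) * A (Suc l) ?w else 0) - c l * of_real t ^ (m - l) * A l ?w"
        by (simp only: distrib_left) (simp add: mult.assoc)
    qed
    also have "\<dots> = ?f t"
    proof -
      have "(\<Sum>l\<le>m. (if l < m then c (Suc l) * of_real t ^ (m - Suc l) * A (Suc l) ?w else 0)) =
          (\<Sum>l<m. c (Suc l) * of_real t ^ (m - Suc l) * A (Suc l) ?w)"
        by (rule sum.mono_neutral_cong_right) auto
      moreover have "(\<Sum>l\<le>m. c l * of_real t ^ (m - l) * A l ?w) =
          c 0 * of_real t ^ m * A 0 ?w + (\<Sum>l<m. c (Suc l) * of_real t ^ (m - Suc l) * A (Suc l) ?w)"
        by (simp add: sum.atMost_shift)
      ultimately show ?thesis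
        using A_0[OF w] by (simp add: sum_subtractf c_def mult.commute)
    qed
    finally show ?thesis .
  qed
  have le: "norm (?f t) \<le> K / Im z ^ (k - 2 - m) * exp (- t)" if t: "t \<ge> 0" for t
    using K(2)[rule_format, OF m z t] z by (simp add: field_simps)
  have lim: "(\<lambda>N. F (real N)) \<longlonglongrightarrow> 0"
  proof -
    have "(\<lambda>N. c l * of_real (real N) ^ (m - l) * A (Suc l) (z + \<i> * of_real (real N))) \<longlonglongrightarrow> 0" for l
    proof (rule Lim_null_comparison)
      show "\<forall>\<^sub>F N in sequentially. norm (c l * of_real (real N) ^ (m - l) * A (Suc l) (z + \<i> * of_real (real N)))
          \<le> norm (c l) * C * fact (m - l) * exp (- real N)"
        using eventually_ge_at_top[of 1]
      proof eventually_elim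
        case (elim N)
        let ?w = "z + \<i> * of_real (real N)"
        have "norm (A (Suc l) ?w) \<le> C * exp (- 2 * pi * Im ?w)"
          using elim z by (intro C(2)) auto
        also have "\<dots> \<le> C * exp (- 2 * real N)"
        proof -
          have "2 * real N \<le> 2 * pi * Im ?w"
            using elim z pi_ge_two by (intro mult_mono) auto
          then show ?thesis using C(1) by (intro mult_left_mono) auto
        qed
        finally have "norm (A (Suc l) ?w) \<le> C * exp (- 2 * real N)" .
        then have "real N ^ (m - l) * norm (A (Suc l) ?w) \<le> (fact (m - l) * exp (real N)) * (C * exp (- 2 * real N))"
          by (intro mult_mono power_le_fact_exp) auto
        also have "\<dots> = C * fact (m - l) * exp (- real N)"
          by (simp add: exp_add[symmetric])
        finally have "norm (c l) * (real N ^ (m - l) * norm (A (Suc l) ?w)) \<le> norm (c l) * (C * fact (m - l) * exp (- real N))"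
          by (rule mult_left_mono) simp
        then show ?case by (simp add: norm_mult norm_power mult.assoc)
      qed
      have "(\<lambda>N. exp (- real N)) \<longlonglongrightarrow> 0"
        by (rule filterlim_compose[OF exp_at_bot]) (simp add: filterlim_uminus_at_bot filterlim_real_sequentially)
      from tendsto_mult_right_zero[OF this, of "norm (c l) * C * fact (m - l)"]
      show "(\<lambda>N. norm (c l) * C * fact (m - l) * exp (- real N)) \<longlonglongrightarrow> 0" .
    qed
    then have "(\<lambda>N. - (\<Sum>l\<le>m. c l * of_real (real N) ^ (m - l) * A (Suc l) (z + \<i> * of_real (real N)))) \<longlonglongrightarrow> - (\<Sum>l\<le>m. 0)"
      by (intro tendsto_minus tendsto_sum)
    then show ?thesis by (simp add: F_def)
  qed
  have "(?f has_integral - F 0) {0..}"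
    by (rule has_integral_from_0_to_infinity[OF der le lim])
  moreover have "- F 0 = fact m * A (Suc m) z"
  proof -
    have "- F 0 = (\<Sum>l\<le>m. if l = m then c m * A (Suc m) z else 0)"
      unfolding F_def minus_minus by (rule sum.cong) auto
    then show ?thesis by (simp add: c_def)
  qed
  ultimately show ?thesis by simp
qed

text \<open>The integral representation turns the bound for \<open>f\<close> into one for its primitives. It is uniform down to
the real line, which makes the period polynomials uniformly bounded.\<close>

lemma A_bound: "\<exists>K. \<forall>m z. m \<le> k - 2 \<longrightarrow> Im z > 0 \<longrightarrow> Im z ^ (k - 2 - m) * norm (fact m * A (Suc m) z) \<le> K"
proof -
  obtain K where K: "K \<ge> 0" "\<forall>m z t. m \<le> k - 2 \<longrightarrow> Im z > 0 \<longrightarrow> t \<ge> 0 \<longrightarrow>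
      norm (f (z + \<i> * of_real t) * of_real t ^ m) * Im z ^ (k - 2 - m) \<le> K * exp (- t)"
    using f_moment_bound by (elim exE conjE)
  have "Im z ^ (k - 2 - m) * norm (fact m * A (Suc m) z) \<le> K" if m: "m \<le> k - 2" and z: "Im z > 0" for m z
  proof -
    let ?y = "Im z ^ (k - 2 - m)"
    have i: "((\<lambda>t. of_real ?y * (f (z + \<i> * of_real t) * of_real t ^ m)) has_integral (of_real ?y * (fact m * A (Suc m) z))) {0..}"
      by (rule has_integral_mult_right[OF f_moment[OF z m]])
    have e: "((\<lambda>t. K * exp (- t)) has_integral K) {0..}"
      using has_integral_mult_right[OF has_integral_exp_minus_to_infinity[of 1 0], of K] by simp
    have "norm (integral {0..} (\<lambda>t. of_real ?y * (f (z + \<i> * of_real t) * of_real t ^ m))) \<le> integral {0..} (\<lambda>t. K * exp (- t))"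
    proof (rule integral_norm_bound_integral)
      fix t :: real assume "t \<in> {0..}"
      then have t: "t \<ge> 0" by simp
      have "norm (of_real ?y * (f (z + \<i> * of_real t) * of_real t ^ m)) =
          norm (f (z + \<i> * of_real t) * of_real t ^ m) * ?y"
        using z by (simp only: norm_mult norm_of_real) (simp add: mult.commute)
      with K(2)[rule_format, OF m z t]
      show "norm (of_real ?y * (f (z + \<i> * of_real t) * of_real t ^ m)) \<le> K * exp (- t)"
        by (simp only:)
    qed (use i e in \<open>auto simp: integrable_on_def\<close>)
    then show ?thesis
      using z unfolding integral_unique[OF i] integral_unique[OF e] by (simp add: norm_mult norm_power)
  qed
  then show ?thesis by blast
qed

end

section \<open>Eichler integrals and period polynomials\<close>

lemma poly_eq_infinite:
  fixes p q :: "complex poly"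
  assumes "infinite S" "\<And>x. x \<in> S \<Longrightarrow> poly p x = poly q x"
  shows "p = q"
proof (rule ccontr)
  assume "p \<noteq> q"
  then have "finite {x. poly (p - q) x = 0}" by (intro poly_roots_finite) auto
  moreover have "S \<subseteq> {x. poly (p - q) x = 0}" using assms(2) by auto
  ultimately show False using assms(1) finite_subset by blast
qed

lemma poly_eq_sum_coeff:
  fixes p :: "complex poly"
  assumes "degree p \<le> n"
  shows "poly p x = (\<Sum>i\<le>n. coeff p i * x ^ i)"
proof -
  have "poly p x = (\<Sum>i\<le>degree p. coeff p i * x ^ i)" by (rule poly_altdef)
  also have "\<dots> = (\<Sum>i\<le>n. coeff p i * x ^ i)"
    using assms by (intro sum.mono_neutral_left) (auto simp: coeff_eq_0)
  finally show ?thesis .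
qed

lemma degree_mult_powers_le:
  fixes p q :: "complex poly"
  assumes "degree p \<le> 1" "degree q \<le> 1"
  shows "degree (p ^ i * q ^ j) \<le> i + j"
proof -
  have "degree (p ^ i * q ^ j) \<le> degree (p ^ i) + degree (q ^ j)" by (rule degree_mult_le)
  also have "\<dots> \<le> degree p * i + degree q * j" by (intro add_mono degree_power_le)
  also have "\<dots> \<le> 1 * i + 1 * j" by (intro add_mono mult_right_mono assms) auto
  finally show ?thesis by simp
qed

lemma linear_power_expand:
  fixes u v :: complex
  shows "[:u, v:] ^ l = (\<Sum>i\<le>l. monom (of_nat (l choose i) * v ^ i * u ^ (l - i)) i)"
proof -
  have "[:u, v:] = monom v 1 + [:u:]" by (simp add: monom_Suc monom_0)
  then have "[:u, v:] ^ l = (\<Sum>i\<le>l. of_nat (l choose i) * monom v 1 ^ i * [:u:] ^ (l - i))"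
    by (simp only: binomial_ring)
  also have "\<dots> = (\<Sum>i\<le>l. monom (of_nat (l choose i) * v ^ i * u ^ (l - i)) i)"
    by (intro sum.cong refl)
       (simp add: monom_power poly_const_pow of_nat_poly monom_0[symmetric] mult_monom del: monom_0)
  finally show ?thesis .
qed

context cusp_form
begin

text \<open>The degree of the polynomials in \<open>X\<close>.\<close>

definition n :: nat where "n = k - 2"

lemma n_facts: "even n" "n \<ge> 10" "k = n + 2"
  using k by (auto simp: n_def)

definition eichler_coeff :: "nat \<Rightarrow> complex" where
  "eichler_coeff \<mu> = - \<i> * of_nat (n choose \<mu>) * \<i> ^ \<mu> * fact \<mu>"

text \<open>The value of \<open>F_plus k f z\<close> at \<open>X\<close>, in terms of the primitives of \<open>f\<close>: expand \<open>(w - X)^n\<close> at \<open>w = z + \<i> t\<close> in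
powers of \<open>z - X\<close> and integrate over \<open>t\<close>.\<close>

definition eichler :: "complex \<Rightarrow> complex \<Rightarrow> complex" where
  "eichler z X = (\<Sum>\<mu>\<le>n. eichler_coeff \<mu> * A (Suc \<mu>) z * (z - X) ^ (n - \<mu>))"

lemma F_plus_eq:
  assumes z: "Im z > 0"
  shows "F_plus k f z = (\<Sum>\<mu>\<le>n. smult (eichler_coeff \<mu> * A (Suc \<mu>) z) ([:z, -1:] ^ (n - \<mu>)))"
proof (rule poly_eqI)
  fix m
  let ?c = "\<lambda>\<mu>. coeff ([:z, -1:] ^ (n - \<mu>)) m"
  have "coeff ([:z, -1:] ^ (n - \<mu>)) m = 0" if "m > n" for \<mu>
  proof (rule coeff_eq_0)
    have "degree ([:z, -1:] ^ (n - \<mu>)) \<le> n - \<mu>"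
      using degree_power_le[of "[:z, -1:]" "n - \<mu>"] by simp
    then show "degree ([:z, -1:] ^ (n - \<mu>)) < m" using that by simp
  qed
  then have large: "coeff (F_plus k f z) m = 0 \<and>
      coeff (\<Sum>\<mu>\<le>n. smult (eichler_coeff \<mu> * A (Suc \<mu>) z) ([:z, -1:] ^ (n - \<mu>))) m = 0" if "m > n"
    using that by (auto simp: F_plus_def n_def[symmetric] coeff_sum intro!: sum.neutral)
  have "coeff (F_plus k f z) m = (\<Sum>\<mu>\<le>n. eichler_coeff \<mu> * A (Suc \<mu>) z * ?c \<mu>)" if m: "m \<le> n"
  proof -
    have expand: "coeff ([:z + \<i> * of_real t, -1:] ^ n) m =
        (\<Sum>\<mu>\<le>n. of_nat (n choose \<mu>) * (\<i> * of_real t) ^ \<mu> * ?c \<mu>)" for t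
    proof -
      have "[:z + \<i> * of_real t, -1:] = [:\<i> * of_real t:] + [:z, -1:]" by simp
      then have "[:z + \<i> * of_real t, -1:] ^ n =
          (\<Sum>\<mu>\<le>n. of_nat (n choose \<mu>) * [:\<i> * of_real t:] ^ \<mu> * [:z, -1:] ^ (n - \<mu>))"
        by (simp only: binomial_ring)
      also have "\<dots> = (\<Sum>\<mu>\<le>n. smult (of_nat (n choose \<mu>) * (\<i> * of_real t) ^ \<mu>) ([:z, -1:] ^ (n - \<mu>)))"
        by (intro sum.cong refl) (simp add: poly_const_pow of_nat_poly mult.commute)
      finally show ?thesis by (simp add: coeff_sum)
    qed
    have "((\<lambda>t. \<Sum>\<mu>\<le>n. (of_nat (n choose \<mu>) * \<i> ^ \<mu> * ?c \<mu> * \<i>) * (f (z + \<i> * of_real t) * of_real t ^ \<mu>))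
        has_integral (\<Sum>\<mu>\<le>n. (of_nat (n choose \<mu>) * \<i> ^ \<mu> * ?c \<mu> * \<i>) * (fact \<mu> * A (Suc \<mu>) z))) {0..}"
      by (intro has_integral_sum has_integral_mult_right f_moment z) (auto simp: n_def)
    moreover have "(\<Sum>\<mu>\<le>n. (of_nat (n choose \<mu>) * \<i> ^ \<mu> * ?c \<mu> * \<i>) * (f (z + \<i> * of_real t) * of_real t ^ \<mu>)) =
        f (z + \<i> * of_real t) * coeff ([:z + \<i> * of_real t, -1:] ^ n) m * \<i>" for t
      unfolding expand sum_distrib_left sum_distrib_right
      by (intro sum.cong refl) (simp add: power_mult_distrib mult_ac)
    ultimately have "integral {0..} (\<lambda>t. f (z + \<i> * of_real t) * coeff ([:z + \<i> * of_real t, -1:] ^ n) m * \<i>) =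
        (\<Sum>\<mu>\<le>n. (of_nat (n choose \<mu>) * \<i> ^ \<mu> * ?c \<mu> * \<i>) * (fact \<mu> * A (Suc \<mu>) z))"
      by (simp only: integral_unique)
    then have "cusp_integral (\<lambda>w. f w * coeff ([:w, -1:] ^ n) m) z =
        - (\<Sum>\<mu>\<le>n. (of_nat (n choose \<mu>) * \<i> ^ \<mu> * ?c \<mu> * \<i>) * (fact \<mu> * A (Suc \<mu>) z))"
      by (simp only: cusp_integral_def)
    also have "\<dots> = (\<Sum>\<mu>\<le>n. eichler_coeff \<mu> * A (Suc \<mu>) z * ?c \<mu>)"
      unfolding sum_negf[symmetric] by (intro sum.cong refl) (simp add: eichler_coeff_def mult_ac)
    finally show ?thesis using m by (simp add: F_plus_def n_def[symmetric] coeff_sum)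
  qed
  with large show "coeff (F_plus k f z) m = coeff (\<Sum>\<mu>\<le>n. smult (eichler_coeff \<mu> * A (Suc \<mu>) z) ([:z, -1:] ^ (n - \<mu>))) m"
    by (cases "m \<le> n") (auto simp: coeff_sum)
qed

lemma poly_F_plus: "Im z > 0 \<Longrightarrow> poly (F_plus k f z) X = eichler z X"
  by (simp add: F_plus_eq eichler_def poly_sum)

lemma degree_F_plus: "degree (F_plus k f z) \<le> n"
  unfolding F_plus_def n_def[symmetric] by (intro degree_sum_le) (auto intro: order.trans[OF degree_monom_le])

text \<open>The derivative telescopes, and the term with \<open>A 0 = f\<close> remains.\<close>

lemma eichler_has_field_derivative:
  assumes z: "Im z > 0"
  shows "((\<lambda>z. eichler z X) has_field_derivative f z * (z - X) ^ n) (at z)"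
proof -
  have "((\<lambda>z. eichler z X) has_field_derivative (\<Sum>\<mu>\<le>n. eichler_coeff \<mu> * (\<i> * A \<mu> z) * (z - X) ^ (n - \<mu>) +
      of_nat (n - \<mu>) * (z - X) ^ (n - \<mu> - 1) * (eichler_coeff \<mu> * A (Suc \<mu>) z))) (at z)"
  proof -
    have p: "((\<lambda>z. (z - X) ^ j) has_field_derivative of_nat j * (z - X) ^ (j - 1)) (at z)" for j
      by (auto intro!: derivative_eq_intros)
    show ?thesis
      unfolding eichler_def
      by (intro DERIV_sum DERIV_mult DERIV_cmult A_has_field_derivative[OF z] p)
  qed
  also have "(\<Sum>\<mu>\<le>n. eichler_coeff \<mu> * (\<i> * A \<mu> z) * (z - X) ^ (n - \<mu>) +
      of_nat (n - \<mu>) * (z - X) ^ (n - \<mu> - 1) * (eichler_coeff \<mu> * A (Suc \<mu>) z)) =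
      (\<Sum>\<mu>\<le>n. eichler_coeff \<mu> * (\<i> * A \<mu> z) * (z - X) ^ (n - \<mu>) -
        (if \<mu> < n then eichler_coeff (Suc \<mu>) * (\<i> * A (Suc \<mu>) z) * (z - X) ^ (n - Suc \<mu>) else 0))"
  proof (intro sum.cong refl)
    fix \<mu> assume "\<mu> \<in> {..n}"
    have Ne: "of_nat (n - \<mu>) * eichler_coeff \<mu> = (if \<mu> < n then - \<i> * eichler_coeff (Suc \<mu>) else 0)"
    proof (cases "\<mu> < n")
      case True
      have "Suc \<mu> * (n choose Suc \<mu>) = (n - \<mu>) * (n choose \<mu>)"
        by (simp only: binomial_absorption binomial_absorb_comp)
      then have binom: "of_nat (n - \<mu>) * of_nat (n choose \<mu>) = (of_nat (Suc \<mu>) * of_nat (n choose Suc \<mu>) :: complex)"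
        by (metis of_nat_mult)
      have "of_nat (n - \<mu>) * eichler_coeff \<mu> = - \<i> * (of_nat (n - \<mu>) * of_nat (n choose \<mu>)) * (\<i> ^ \<mu> * fact \<mu>)"
        unfolding eichler_coeff_def by (simp only: mult_ac)
      also have "\<dots> = - \<i> * eichler_coeff (Suc \<mu>)"
        unfolding binom by (simp add: eichler_coeff_def mult_ac del: of_nat_Suc)
      finally show ?thesis using True by simp
    qed simp
    have der_term: "of_nat (n - \<mu>) * (z - X) ^ (n - \<mu> - 1) * (eichler_coeff \<mu> * A (Suc \<mu>) z) =
       (if \<mu> < n then - \<i> * eichler_coeff (Suc \<mu>) else 0) * ((z - X) ^ (n - \<mu> - 1) * A (Suc \<mu>) z)"
      unfolding Ne[symmetric] by (simp only: mult_ac)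
    show "eichler_coeff \<mu> * (\<i> * A \<mu> z) * (z - X) ^ (n - \<mu>) +
        of_nat (n - \<mu>) * (z - X) ^ (n - \<mu> - 1) * (eichler_coeff \<mu> * A (Suc \<mu>) z) =
      eichler_coeff \<mu> * (\<i> * A \<mu> z) * (z - X) ^ (n - \<mu>) -
        (if \<mu> < n then eichler_coeff (Suc \<mu>) * (\<i> * A (Suc \<mu>) z) * (z - X) ^ (n - Suc \<mu>) else 0)"
      unfolding der_term by (simp add: mult_ac)
  qed
  also have "\<dots> = f z * (z - X) ^ n"
  proof -
    have "(\<Sum>\<mu>\<le>n. (if \<mu> < n then eichler_coeff (Suc \<mu>) * (\<i> * A (Suc \<mu>) z) * (z - X) ^ (n - Suc \<mu>) else 0)) =
        (\<Sum>\<mu><n. eichler_coeff (Suc \<mu>) * (\<i> * A (Suc \<mu>) z) * (z - X) ^ (n - Suc \<mu>))"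
      by (rule sum.mono_neutral_cong_right) auto
    moreover have "(\<Sum>\<mu>\<le>n. eichler_coeff \<mu> * (\<i> * A \<mu> z) * (z - X) ^ (n - \<mu>)) =
        eichler_coeff 0 * (\<i> * A 0 z) * (z - X) ^ n + (\<Sum>\<mu><n. eichler_coeff (Suc \<mu>) * (\<i> * A (Suc \<mu>) z) * (z - X) ^ (n - Suc \<mu>))"
      by (simp add: sum.atMost_shift)
    ultimately show ?thesis
      using A_0[OF z] by (simp add: sum_subtractf eichler_coeff_def)
  qed
  finally show ?thesis .
qed

text \<open>By the modularity of \<open>f\<close> and \<open>moebius_diff\<close>, both terms of the difference have the derivative
\<open>f z * (z - X)^n\<close> with respect to \<open>z\<close>. So the difference is a function of \<open>\<gamma>\<close> and \<open>X\<close> alone, the period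
polynomial of \<open>\<gamma>\<close>, and may be computed at any convenient point.\<close>

lemma eichler_cocycle_const:
  assumes \<gamma>: "\<gamma> \<in> SL2Z" and X: "j_factor \<gamma> X \<noteq> 0" and z: "Im z > 0" and w: "Im w > 0"
  shows "eichler (moebius \<gamma> z) (moebius \<gamma> X) * j_factor \<gamma> X ^ n - eichler z X =
         eichler (moebius \<gamma> w) (moebius \<gamma> X) * j_factor \<gamma> X ^ n - eichler w X"
proof -
  let ?D = "\<lambda>z. eichler (moebius \<gamma> z) (moebius \<gamma> X) * j_factor \<gamma> X ^ n - eichler z X"
  have "\<exists>c. \<forall>z\<in>{z. Im z > 0}. ?D z = c"
  proof (rule has_field_derivative_zero_constant)
    show "convex {z. Im z > 0}" by (rule convex_halfspace_Im_gt)
    fix u assume "u \<in> {z. Im z > 0}"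
    then have u: "Im u > 0" by simp
    have ju: "j_factor \<gamma> u \<noteq> 0" using j_factor_nonzero[OF \<gamma>] u by simp
    have "(?D has_field_derivative
        f (moebius \<gamma> u) * (moebius \<gamma> u - moebius \<gamma> X) ^ n * (1 / j_factor \<gamma> u ^ 2) * j_factor \<gamma> X ^ n -
        f u * (u - X) ^ n) (at u)"
      by (intro DERIV_diff DERIV_cmult_right eichler_has_field_derivative u
          DERIV_chain2[where g = "moebius \<gamma>", OF eichler_has_field_derivative[OF moebius_uhp[OF \<gamma> u]]]
          moebius_has_field_derivative[OF \<gamma> ju])
    also have "f (moebius \<gamma> u) * (moebius \<gamma> u - moebius \<gamma> X) ^ n * (1 / j_factor \<gamma> u ^ 2) * j_factor \<gamma> X ^ n -
        f u * (u - X) ^ n = 0"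
    proof -
      have "j_factor \<gamma> u ^ k = j_factor \<gamma> u ^ n * j_factor \<gamma> u ^ 2"
        using power_add[of "j_factor \<gamma> u" n 2] by (simp only: n_facts(3)[symmetric])
      then show ?thesis
        unfolding f_modular[OF \<gamma> u] moebius_diff[OF \<gamma> ju X]
        using ju X by (simp add: power_divide power_mult_distrib)
    qed
    finally show "(?D has_field_derivative 0) (at u within {z. Im z > 0})"
      by (rule has_field_derivative_at_within)
  qed
  then show ?thesis using z w by (metis (mono_tags, lifting) mem_Collect_eq)
qed

text \<open>The period polynomial of a matrix with first column \<open>(p, c)\<close> and lower right entry \<open>d\<close>, in the variable
\<open>v = c X + d\<close>. The factor \<open>1 ^ \<mu>\<close> lets \<open>degree_mult_powers_le\<close> bound the degrees of both halves.\<close>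

definition period_poly :: "int \<Rightarrow> int \<Rightarrow> int \<Rightarrow> complex poly" where
  "period_poly p c d = (\<Sum>\<mu>\<le>n. smult (eichler_coeff \<mu> / of_int c ^ (n - \<mu>))
     (smult (A (Suc \<mu>) ((of_int p + \<i>) / of_int c)) ([:1, \<i>:] ^ (n - \<mu>) * [:0, 1:] ^ \<mu>) -
      smult (A (Suc \<mu>) ((- of_int d + \<i>) / of_int c)) ([:\<i>, -1:] ^ (n - \<mu>) * 1 ^ \<mu>)))"

lemma degree_period_poly: "degree (period_poly p c d) \<le> n"
proof -
  have "degree ([:1, \<i>:] ^ (n - \<mu>) * [:0, 1:] ^ \<mu>) \<le> n" "degree ([:\<i>, -1:] ^ (n - \<mu>) * 1 ^ \<mu>) \<le> n"
    if "\<mu> \<le> n" for \<mu>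
    using degree_mult_powers_le[of "[:1, \<i>:]" "[:0, 1:]" "n - \<mu>" \<mu>]
      degree_mult_powers_le[of "[:\<i>, -1:]" 1 "n - \<mu>" \<mu>] that by simp_all
  then show ?thesis
    unfolding period_poly_def
    by (intro degree_sum_le order.trans[OF degree_smult_le] degree_diff_le) auto
qed

text \<open>The primitives have period 1.\<close>

lemma period_poly_periodic:
  assumes "c \<noteq> 0"
  shows "period_poly (p + c * l) c (d + c * m) = period_poly p c d"
proof -
  have "A \<mu> ((of_int (p + c * l) + \<i>) / of_int c) = A \<mu> ((of_int p + \<i>) / of_int c)"
    "A \<mu> ((- of_int (d + c * m) + \<i>) / of_int c) = A \<mu> ((- of_int d + \<i>) / of_int c)" for \<mu>
  proof -
    have "(of_int (p + c * l) + \<i>) / of_int c = (of_int p + \<i>) / of_int c + of_int l"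
      "(- of_int (d + c * m) + \<i>) / of_int c = (- of_int d + \<i>) / of_int c + of_int (- m)"
      using assms by (simp_all add: field_simps)
    then show "A \<mu> ((of_int (p + c * l) + \<i>) / of_int c) = A \<mu> ((of_int p + \<i>) / of_int c)"
      "A \<mu> ((- of_int (d + c * m) + \<i>) / of_int c) = A \<mu> ((- of_int d + \<i>) / of_int c)"
      by (simp_all only: A_periodic)
  qed
  then show ?thesis unfolding period_poly_def by (simp only:)
qed

text \<open>The primitives are evaluated at height \<open>y = 1 / c\<close>, so the quotient by \<open>c^(n - \<mu>)\<close> is the factor
\<open>y^(n - \<mu>)\<close> of \<open>A_bound\<close>.\<close>

lemma period_poly_bound: "\<exists>B. \<forall>p c d l. c \<ge> 1 \<longrightarrow> norm (coeff (period_poly p c d) l) \<le> B"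
proof -
  obtain K where K: "\<And>m z. m \<le> n \<Longrightarrow> Im z > 0 \<Longrightarrow> Im z ^ (n - m) * norm (fact m * A (Suc m) z) \<le> K"
    using A_bound unfolding n_def[symmetric] by blast
  have K0: "K \<ge> 0"
    using order.trans[OF norm_ge_zero, of "fact n * A (Suc n) \<i>" K] K[of n \<i>] by simp
  define P where "P l \<mu> = norm (coeff ([:1, \<i>:] ^ (n - \<mu>) * [:0, 1:] ^ \<mu>) l) + norm (coeff ([:\<i>, -1:] ^ (n - \<mu>) * 1 ^ \<mu>) l)"
    for l \<mu> :: nat
  define B where "B = (\<Sum>l\<le>n. \<Sum>\<mu>\<le>n. norm (eichler_coeff \<mu>) * K * P l \<mu>)"
  have P0: "P l \<mu> \<ge> 0" for l \<mu> by (simp add: P_def)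
  have "norm (coeff (period_poly p c d) l) \<le> B" if c: "c \<ge> 1" for p c d l
  proof (cases "l \<le> n")
    case False
    then have "coeff (period_poly p c d) l = 0"
      using degree_period_poly[of p c d] by (intro coeff_eq_0) simp
    moreover have "B \<ge> 0" unfolding B_def using K0 P0 by (intro sum_nonneg mult_nonneg_nonneg) auto
    ultimately show ?thesis by simp
  next
    case True
    have A_le: "norm (A (Suc \<mu>) ((x + \<i>) / of_int c)) / of_int c ^ (n - \<mu>) \<le> K" if "x \<in> \<real>" "\<mu> \<le> n" for x \<mu>
    proof -
      have Im: "Im ((x + \<i>) / of_int c) = 1 / of_int c"
        using that(1) by (simp add: complex_is_Real_iff)
      have "norm (A (Suc \<mu>) ((x + \<i>) / of_int c)) * 1 \<le> norm (A (Suc \<mu>) ((x + \<i>) / of_int c)) * fact \<mu>"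
        by (intro mult_left_mono fact_ge_1) auto
      then have "(1 / of_int c) ^ (n - \<mu>) * norm (A (Suc \<mu>) ((x + \<i>) / of_int c)) \<le>
          (1 / of_int c) ^ (n - \<mu>) * norm (fact \<mu> * A (Suc \<mu>) ((x + \<i>) / of_int c))"
        using c by (intro mult_left_mono) (auto simp: norm_mult mult.commute)
      also have "\<dots> \<le> K" using K[OF that(2), of "(x + \<i>) / of_int c"] c unfolding Im by simp
      finally show ?thesis by (simp add: divide_inverse power_inverse mult.commute)
    qed
    have "norm (coeff (period_poly p c d) l) \<le> (\<Sum>\<mu>\<le>n. norm (eichler_coeff \<mu>) * K * P l \<mu>)"
      unfolding period_poly_def coeff_sum
    proof (rule sum_norm_le)
      fix \<mu> assume "\<mu> \<in> {..n}"
      then have \<mu>: "\<mu> \<le> n" by simp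
      define A1 A2 C1 C2 where "A1 = A (Suc \<mu>) ((of_int p + \<i>) / of_int c)" and "A2 = A (Suc \<mu>) ((- of_int d + \<i>) / of_int c)"
        and "C1 = coeff ([:1, \<i>:] ^ (n - \<mu>) * [:0, 1:] ^ \<mu>) l" and "C2 = coeff ([:\<i>, -1:] ^ (n - \<mu>) * 1 ^ \<mu>) l"
      define q where "q = real_of_int c ^ (n - \<mu>)"
      have q: "q > 0" using c by (simp add: q_def)
      have "norm A1 / q \<le> K" "norm A2 / q \<le> K"
        unfolding A1_def A2_def q_def by (rule A_le[OF _ \<mu>], simp)+
      then have "norm A1 / q * norm C1 + norm A2 / q * norm C2 \<le> K * norm C1 + K * norm C2"
        by (intro add_mono mult_right_mono) auto
      then have "norm (eichler_coeff \<mu>) * (norm A1 / q * norm C1 + norm A2 / q * norm C2) \<le> norm (eichler_coeff \<mu>) * (K * norm C1 + K * norm C2)"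
        by (rule mult_left_mono) simp
      moreover have "norm (eichler_coeff \<mu> / of_int c ^ (n - \<mu>) * (A1 * C1 - A2 * C2)) \<le>
          norm (eichler_coeff \<mu>) * (norm A1 / q * norm C1 + norm A2 / q * norm C2)"
      proof -
        have "norm (A1 * C1 - A2 * C2) \<le> norm A1 * norm C1 + norm A2 * norm C2"
          using norm_triangle_ineq4[of "A1 * C1" "A2 * C2"] by (simp add: norm_mult)
        then have "norm (eichler_coeff \<mu>) / q * norm (A1 * C1 - A2 * C2) \<le> norm (eichler_coeff \<mu>) / q * (norm A1 * norm C1 + norm A2 * norm C2)"
          using q by (intro mult_left_mono) auto
        moreover have "norm (eichler_coeff \<mu> / of_int c ^ (n - \<mu>)) = norm (eichler_coeff \<mu>) / q"
          using c by (simp add: norm_divide norm_power q_def)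
        ultimately have "norm (eichler_coeff \<mu> / of_int c ^ (n - \<mu>) * (A1 * C1 - A2 * C2)) \<le>
            norm (eichler_coeff \<mu>) / q * (norm A1 * norm C1 + norm A2 * norm C2)"
          by (simp only: norm_mult)
        then show ?thesis by (simp add: add_divide_distrib distrib_left mult.assoc)
      qed
      ultimately show "norm (coeff (smult (eichler_coeff \<mu> / of_int c ^ (n - \<mu>))
          (smult (A (Suc \<mu>) ((of_int p + \<i>) / of_int c)) ([:1, \<i>:] ^ (n - \<mu>) * [:0, 1:] ^ \<mu>) -
           smult (A (Suc \<mu>) ((- of_int d + \<i>) / of_int c)) ([:\<i>, -1:] ^ (n - \<mu>) * 1 ^ \<mu>))) l) \<le> norm (eichler_coeff \<mu>) * K * P l \<mu>"
        unfolding P_def coeff_smult coeff_diff A1_def[symmetric] A2_def[symmetric] C1_def[symmetric] C2_def[symmetric]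
        by (simp add: distrib_left mult.assoc)
    qed
    also have "\<dots> \<le> B"
      unfolding B_def using True K0 P0
      by (intro member_le_sum[of l "{..n}" "\<lambda>l. \<Sum>\<mu>\<le>n. norm (eichler_coeff \<mu>) * K * P l \<mu>"])
         (auto intro!: sum_nonneg mult_nonneg_nonneg)
    finally show ?thesis .
  qed
  then show ?thesis by blast
qed

text \<open>The cocycle is evaluated at \<open>w = (- d + \<i>) / c\<close>. There \<open>j_factor \<gamma> w = \<i>\<close> and \<open>moebius \<gamma> w = (p + \<i>) / c\<close>, so that
\<open>w\<close> and its image both have height \<open>1 / c\<close>.\<close>

lemma eichler_period:
  assumes \<gamma>: "\<gamma> \<in> SL2Z" and c: "\<gamma> $ 2 $ 1 \<ge> 1" and X: "j_factor \<gamma> X \<noteq> 0" and z: "Im z > 0"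
  shows "eichler (moebius \<gamma> z) (moebius \<gamma> X) * j_factor \<gamma> X ^ n =
         eichler z X + poly (period_poly (\<gamma> $ 1 $ 1) (\<gamma> $ 2 $ 1) (\<gamma> $ 2 $ 2)) (j_factor \<gamma> X)"
proof -
  define p b c d :: complex where pbcd: "p = of_int (\<gamma> $ 1 $ 1)" "b = of_int (\<gamma> $ 1 $ 2)"
    "c = of_int (\<gamma> $ 2 $ 1)" "d = of_int (\<gamma> $ 2 $ 2)"
  have det: "p * d - b * c = 1" using SL2Z_det_of_int[OF \<gamma>] by (simp add: pbcd)
  have c0: "c \<noteq> 0" using c by (simp add: pbcd)
  define v where "v = j_factor \<gamma> X"
  define w where "w = (- d + \<i>) / c"
  have w: "Im w > 0" using c by (simp add: w_def pbcd)
  have jw: "j_factor \<gamma> w = \<i>" using c0 by (simp add: j_factor_def w_def pbcd[symmetric])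
  have mw: "moebius \<gamma> w = (p + \<i>) / c"
  proof -
    have "(p * w + b) = (- (p * d - b * c) + \<i> * p) / c" using c0 by (simp add: w_def field_simps)
    then have "p * w + b = (- 1 + \<i> * p) / c" by (simp only: det)
    then have "moebius \<gamma> w = (- 1 + \<i> * p) / c / \<i>"
      unfolding moebius_def jw by (simp only: pbcd)
    also have "\<dots> = (p + \<i>) / c" using c0 by (simp add: field_simps)
    finally show ?thesis .
  qed
  have wX: "w - X = (\<i> - v) / c"
    using c0 by (simp add: w_def v_def j_factor_def pbcd[symmetric] field_simps)
  have v0: "v \<noteq> 0" using X by (simp add: v_def)
  have mwX: "(p + \<i>) / c - moebius \<gamma> X = (1 + \<i> * v) / (c * v)"
  proof -
    have "(p + \<i>) / c - moebius \<gamma> X = (w - X) / (\<i> * v)"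
      using moebius_diff[OF \<gamma>, of w X] X unfolding jw mw v_def by simp
    also have "\<dots> = (1 + \<i> * v) / (c * v)"
      unfolding wX using v0 c0 by (simp add: field_simps)
    finally show ?thesis .
  qed
  have "eichler (moebius \<gamma> z) (moebius \<gamma> X) * v ^ n - eichler z X =
      eichler ((p + \<i>) / c) (moebius \<gamma> X) * v ^ n - eichler w X"
    using eichler_cocycle_const[OF \<gamma> X z w] by (simp only: mw v_def)
  also have "\<dots> = (\<Sum>\<mu>\<le>n. eichler_coeff \<mu> * A (Suc \<mu>) ((p + \<i>) / c) * ((1 + \<i> * v) / (c * v)) ^ (n - \<mu>) * v ^ n -
      eichler_coeff \<mu> * A (Suc \<mu>) w * ((\<i> - v) / c) ^ (n - \<mu>))"
    unfolding eichler_def mwX wX by (simp add: sum_subtractf sum_distrib_right)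
  also have "\<dots> = poly (period_poly (\<gamma> $ 1 $ 1) (\<gamma> $ 2 $ 1) (\<gamma> $ 2 $ 2)) v"
    unfolding period_poly_def poly_sum
  proof (intro sum.cong refl)
    fix \<mu> assume "\<mu> \<in> {..n}"
    then have "v ^ n = v ^ (n - \<mu>) * v ^ \<mu>" by (simp add: power_add[symmetric])
    then have 1: "((1 + \<i> * v) / (c * v)) ^ (n - \<mu>) * v ^ n = (1 + \<i> * v) ^ (n - \<mu>) * v ^ \<mu> / c ^ (n - \<mu>)"
      using v0 c0 by (simp add: power_divide power_mult_distrib)
    have "eichler_coeff \<mu> * A (Suc \<mu>) ((p + \<i>) / c) * ((1 + \<i> * v) / (c * v)) ^ (n - \<mu>) * v ^ n -
        eichler_coeff \<mu> * A (Suc \<mu>) w * ((\<i> - v) / c) ^ (n - \<mu>) =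
        eichler_coeff \<mu> * A (Suc \<mu>) ((p + \<i>) / c) * ((1 + \<i> * v) ^ (n - \<mu>) * v ^ \<mu> / c ^ (n - \<mu>)) -
        eichler_coeff \<mu> * A (Suc \<mu>) w * ((\<i> - v) ^ (n - \<mu>) / c ^ (n - \<mu>))"
      by (simp only: 1[symmetric] power_divide mult.assoc)
    also have "\<dots> = eichler_coeff \<mu> / c ^ (n - \<mu>) * (A (Suc \<mu>) ((p + \<i>) / c) * ((1 + \<i> * v) ^ (n - \<mu>) * v ^ \<mu>) -
        A (Suc \<mu>) w * (\<i> - v) ^ (n - \<mu>))"
      by (simp add: right_diff_distrib mult_ac)
    finally show "eichler_coeff \<mu> * A (Suc \<mu>) ((p + \<i>) / c) * ((1 + \<i> * v) / (c * v)) ^ (n - \<mu>) * v ^ n -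
        eichler_coeff \<mu> * A (Suc \<mu>) w * ((\<i> - v) / c) ^ (n - \<mu>) =
        poly (smult (eichler_coeff \<mu> / of_int (\<gamma> $ 2 $ 1) ^ (n - \<mu>))
          (smult (A (Suc \<mu>) ((of_int (\<gamma> $ 1 $ 1) + \<i>) / of_int (\<gamma> $ 2 $ 1))) ([:1, \<i>:] ^ (n - \<mu>) * [:0, 1:] ^ \<mu>) -
           smult (A (Suc \<mu>) ((- of_int (\<gamma> $ 2 $ 2) + \<i>) / of_int (\<gamma> $ 2 $ 1))) ([:\<i>, -1:] ^ (n - \<mu>) * 1 ^ \<mu>))) v"
      by (simp add: pbcd[symmetric] w_def mult.commute[of v])
  qed
  finally show ?thesis by (simp add: v_def algebra_simps)
qed

end

section \<open>Coordinates of polynomials and the action of the modular group\<close>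

lemma cross_ratio_inj:
  assumes "z \<noteq> w"
  shows "inj_on (\<lambda>x. (x - z) / (x - w)) (- {w :: complex})"
proof (rule inj_onI)
  fix x y assume "x \<in> - {w}" "y \<in> - {w}" "(x - z) / (x - w) = (y - z) / (y - w)"
  then have "(x - z) * (y - w) = (y - z) * (x - w)" by (simp add: frac_eq_eq)
  then have "(x - y) * (z - w) = 0" by algebra
  with assms show "x = y" by simp
qed

text \<open>Identities between polynomials in \<open>T = (X - z) / (X - cnj z)\<close> are checked at real \<open>X\<close>, where \<open>X - cnj z\<close> does
not vanish; finitely many \<open>X\<close> may be left out.\<close>

lemma infinite_cross_ratios:
  assumes "Im z > 0" "finite F"
  shows "infinite ((\<lambda>x. (x - z) / (x - cnj z)) ` (\<real> - F))"
proof -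
  have "infinite (\<real> :: complex set)"
  proof -
    have "(\<real> :: complex set) = range of_real" by (simp add: Reals_def)
    moreover have "inj (of_real :: real \<Rightarrow> complex)" by (rule inj_of_real)
    ultimately show ?thesis using finite_imageD infinite_UNIV_char_0 by metis
  qed
  then have "infinite (\<real> - F)" using assms(2) by (rule Diff_infinite_finite[rotated])
  moreover have "inj_on (\<lambda>x. (x - z) / (x - cnj z)) (\<real> - F)"
  proof (rule inj_on_subset[OF cross_ratio_inj])
    show "z \<noteq> cnj z" using assms(1) by (auto simp: complex_eq_iff)
    show "\<real> - F \<subseteq> - {cnj z}" using assms(1) by (auto simp: complex_is_Real_iff)
  qed
  ultimately show ?thesis by (simp add: finite_image_iff)
qed

lemma real_minus_cnj_nonzero: "Im z > 0 \<Longrightarrow> x \<in> \<real> \<Longrightarrow> x - cnj z \<noteq> 0"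
  by (auto simp: complex_eq_iff complex_is_Real_iff)

definition basis_poly :: "nat \<Rightarrow> complex \<Rightarrow> nat \<Rightarrow> complex poly" where
  "basis_poly n z i = [:- z, 1:] ^ i * [:- cnj z, 1:] ^ (n - i)"

lemma poly_basis_poly: "poly (basis_poly n z i) x = (x - z) ^ i * (x - cnj z) ^ (n - i)"
  by (simp add: basis_poly_def)

lemma basis_poly_sum_cross_ratio:
  assumes "x - cnj z \<noteq> 0"
  shows "(\<Sum>i\<le>n. c i * ((x - z) ^ i * (x - cnj z) ^ (n - i))) =
         (x - cnj z) ^ n * (\<Sum>i\<le>n. c i * ((x - z) / (x - cnj z)) ^ i)"
  unfolding sum_distrib_left
proof (rule sum.cong)
  fix i assume "i \<in> {..n}"
  then have "(x - cnj z) ^ n = (x - cnj z) ^ (n - i) * (x - cnj z) ^ i"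
    by (simp add: power_add[symmetric])
  then show "c i * ((x - z) ^ i * (x - cnj z) ^ (n - i)) = (x - cnj z) ^ n * (c i * ((x - z) / (x - cnj z)) ^ i)"
    using assms by (simp add: power_divide)
qed simp

lemma basis_poly_coords_unique:
  assumes z: "Im z > 0" and i: "i \<le> n"
    and eq: "(\<Sum>i\<le>n. smult (c i) (basis_poly n z i)) = (\<Sum>i\<le>n. smult (c' i) (basis_poly n z i))"
  shows "c i = c' i"
proof -
  have "(\<Sum>i\<le>n. monom (c i) i) = (\<Sum>i\<le>n. monom (c' i) i)"
  proof (rule poly_eq_infinite[OF infinite_cross_ratios[OF z finite.emptyI]], elim imageE)
    fix T x assume x: "x \<in> \<real> - {}" and T: "T = (x - z) / (x - cnj z)"
    have V: "x - cnj z \<noteq> 0" using real_minus_cnj_nonzero[OF z] x by simp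
    from arg_cong[OF eq, of "\<lambda>p. poly p x"]
    have "(x - cnj z) ^ n * (\<Sum>i\<le>n. c i * T ^ i) = (x - cnj z) ^ n * (\<Sum>i\<le>n. c' i * T ^ i)"
      by (simp add: poly_sum poly_basis_poly basis_poly_sum_cross_ratio[OF V] T)
    then show "poly (\<Sum>i\<le>n. monom (c i) i) T = poly (\<Sum>i\<le>n. monom (c' i) i) T"
      using V by (simp add: poly_sum poly_monom)
  qed
  from arg_cong[OF this, of "\<lambda>p. coeff p i"] show ?thesis
    using i by (simp add: coeff_sum)
qed

lemma poly_poly_act:
  assumes "degree P \<le> n" "j_factor \<gamma> x \<noteq> 0"
  shows "poly (poly_act n P \<gamma>) x = j_factor \<gamma> x ^ n * poly P (moebius \<gamma> x)"
proof -
  have "poly (poly_act n P \<gamma>) x = (\<Sum>m\<le>n. coeff P m *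
      ((of_int (\<gamma> $ 1 $ 1) * x + of_int (\<gamma> $ 1 $ 2)) ^ m * j_factor \<gamma> x ^ (n - m)))"
    by (simp add: poly_act_def poly_sum j_factor_def algebra_simps)
  also have "\<dots> = (\<Sum>m\<le>n. j_factor \<gamma> x ^ n * (coeff P m * moebius \<gamma> x ^ m))"
  proof (rule sum.cong)
    fix m assume "m \<in> {..n}"
    then have "j_factor \<gamma> x ^ n = j_factor \<gamma> x ^ (n - m) * j_factor \<gamma> x ^ m"
      by (simp add: power_add[symmetric])
    then show "coeff P m * ((of_int (\<gamma> $ 1 $ 1) * x + of_int (\<gamma> $ 1 $ 2)) ^ m * j_factor \<gamma> x ^ (n - m)) =
        j_factor \<gamma> x ^ n * (coeff P m * moebius \<gamma> x ^ m)"
      using assms(2) by (simp add: moebius_def power_divide)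
  qed simp
  also have "\<dots> = j_factor \<gamma> x ^ n * poly P (moebius \<gamma> x)"
    by (simp add: poly_eq_sum_coeff[OF assms(1)] sum_distrib_left)
  finally show ?thesis .
qed

lemma finite_j_factor_zeros:
  assumes "\<gamma> \<in> SL2Z"
  shows "finite {x. j_factor \<gamma> x = 0}"
proof -
  have "[:of_int (\<gamma> $ 2 $ 2), of_int (\<gamma> $ 2 $ 1):] \<noteq> (0 :: complex poly)"
    using assms by (auto simp: SL2Z_iff)
  from poly_roots_finite[OF this] show ?thesis
    by (simp add: j_factor_def algebra_simps)
qed

context cusp_form
begin

text \<open>The Eichler integral divided by \<open>(X - cnj z)^n\<close>, as a polynomial in \<open>T = (X - z) / (X - cnj z)\<close>. Its
coefficients \<open>G i\<close> are the coordinates of the Eichler integral in the basis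
\<open>(X - z)^i (X - cnj z)^(n - i)\<close>.\<close>

definition coord_poly :: "complex \<Rightarrow> complex poly" where
  "coord_poly z = (\<Sum>\<mu>\<le>n. smult (eichler_coeff \<mu> * (-1) ^ (n - \<mu>) * (A (Suc \<mu>) z / (z - cnj z) ^ \<mu>))
     ([:0, 1:] ^ (n - \<mu>) * [:1, -1:] ^ \<mu>))"

definition G :: "nat \<Rightarrow> complex \<Rightarrow> complex" where
  "G i z = coeff (coord_poly z) i"

lemma degree_coord_poly: "degree (coord_poly z) \<le> n"
  unfolding coord_poly_def
proof (intro degree_sum_le order.trans[OF degree_smult_le])
  fix \<mu> assume "\<mu> \<in> {..n}"
  then show "degree ([:0, 1:] ^ (n - \<mu>) * [:1, -1:] ^ \<mu> :: complex poly) \<le> n"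
    using degree_mult_powers_le[of "[:0, 1:]" "[:1, -1:]" "n - \<mu>" \<mu>] by simp
qed simp

lemma poly_coord_poly: "poly (coord_poly z) T = (\<Sum>i\<le>n. G i z * T ^ i)"
  unfolding G_def by (rule poly_eq_sum_coeff[OF degree_coord_poly])

lemma G_periodic: "G i (z + of_int N) = G i z"
  by (simp add: G_def coord_poly_def A_periodic)

lemma qexp_G: "qexp (G i)"
proof -
  have "qexp (\<lambda>z. \<Sum>\<mu>\<le>n. eichler_coeff \<mu> * (-1) ^ (n - \<mu>) * (A (Suc \<mu>) z * (1 / (2 * \<i>) ^ \<mu> * of_real (Im z) powi (- int \<mu>))) *
      coeff ([:0, 1:] ^ (n - \<mu>) * [:1, -1:] ^ \<mu>) i)"
    by (intro qexp_sum qexp_mult qexp_const qexp_A qexp_y_powi) auto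
  then show ?thesis
  proof (rule qexp_cong)
    fix z :: complex
    have "z - cnj z = 2 * \<i> * of_real (Im z)" by (simp add: complex_eq_iff)
    then show "G i z = (\<Sum>\<mu>\<le>n. eichler_coeff \<mu> * (-1) ^ (n - \<mu>) * (A (Suc \<mu>) z * (1 / (2 * \<i>) ^ \<mu> * of_real (Im z) powi (- int \<mu>))) *
      coeff ([:0, 1:] ^ (n - \<mu>) * [:1, -1:] ^ \<mu>) i)"
      by (simp add: G_def coord_poly_def coeff_sum power_int_minus power_mult_distrib divide_inverse)
  qed
qed

text \<open>With \<open>V = X - cnj z\<close> one has \<open>X - z = V T\<close> and \<open>z - cnj z = V (1 - T)\<close>.\<close>

lemma eichler_coords:
  assumes z: "Im z > 0" and V: "x - cnj z \<noteq> 0"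
  shows "eichler z x = (\<Sum>i\<le>n. G i z * ((x - z) ^ i * (x - cnj z) ^ (n - i)))"
proof -
  define D V T where "D = z - cnj z" and "V = x - cnj z" and "T = (x - z) / (x - cnj z)"
  have D: "D \<noteq> 0" and V0: "V \<noteq> 0" using z V by (auto simp: D_def V_def complex_eq_iff)
  have U: "x - z = V * T" using V by (simp add: V_def T_def)
  have VD: "V * (1 - T) = D"
  proof -
    have "V * (1 - T) = V - (x - z)" by (simp add: U algebra_simps)
    then show ?thesis by (simp add: V_def D_def)
  qed
  have "eichler z x = (\<Sum>\<mu>\<le>n. V ^ n * (eichler_coeff \<mu> * (-1) ^ (n - \<mu>) * (A (Suc \<mu>) z / D ^ \<mu>) * (T ^ (n - \<mu>) * (1 - T) ^ \<mu>)))"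
    unfolding eichler_def
  proof (rule sum.cong)
    fix \<mu> assume "\<mu> \<in> {..n}"
    then have Vn: "V ^ n = V ^ (n - \<mu>) * V ^ \<mu>" by (simp add: power_add[symmetric])
    have "(z - x) ^ (n - \<mu>) = ((-1) * (V * T)) ^ (n - \<mu>)" by (simp add: U[symmetric])
    also have "\<dots> = (-1) ^ (n - \<mu>) * (V ^ (n - \<mu>) * T ^ (n - \<mu>))" by (simp only: power_mult_distrib)
    finally have 1: "(z - x) ^ (n - \<mu>) = (-1) ^ (n - \<mu>) * (V ^ (n - \<mu>) * T ^ (n - \<mu>))" .
    have 2: "D ^ \<mu> = V ^ \<mu> * (1 - T) ^ \<mu>" by (simp only: VD[symmetric] power_mult_distrib)
    have "1 - T \<noteq> 0" using VD D by auto
    then show "eichler_coeff \<mu> * A (Suc \<mu>) z * (z - x) ^ (n - \<mu>) =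
        V ^ n * (eichler_coeff \<mu> * (-1) ^ (n - \<mu>) * (A (Suc \<mu>) z / D ^ \<mu>) * (T ^ (n - \<mu>) * (1 - T) ^ \<mu>))"
      unfolding 1 2 Vn using V0 by simp
  qed simp
  also have "\<dots> = V ^ n * poly (coord_poly z) T"
    by (simp add: coord_poly_def poly_sum sum_distrib_left D_def)
  finally show ?thesis
    unfolding basis_poly_sum_cross_ratio[OF V] poly_coord_poly by (simp add: V_def T_def)
qed

text \<open>In these coordinates the action is diagonal, as \<open>moebius_diff\<close> shows for each factor of the basis.\<close>

lemma eichler_act_coords:
  assumes \<gamma>: "\<gamma> \<in> SL2Z" and z: "Im z > 0" and x: "x \<in> \<real>" "j_factor \<gamma> x \<noteq> 0"
  shows "eichler (moebius \<gamma> z) (moebius \<gamma> x) * j_factor \<gamma> x ^ n =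
    (\<Sum>i\<le>n. G i (moebius \<gamma> z) / (j_factor \<gamma> z ^ i * j_factor \<gamma> (cnj z) ^ (n - i)) *
       ((x - z) ^ i * (x - cnj z) ^ (n - i)))"
proof -
  have j: "j_factor \<gamma> z \<noteq> 0" "j_factor \<gamma> (cnj z) \<noteq> 0" using j_factor_nonzero[OF \<gamma>] z by auto
  have U: "moebius \<gamma> x - moebius \<gamma> z = (x - z) / (j_factor \<gamma> x * j_factor \<gamma> z)"
    by (rule moebius_diff[OF \<gamma> x(2) j(1)])
  have V: "moebius \<gamma> x - cnj (moebius \<gamma> z) = (x - cnj z) / (j_factor \<gamma> x * j_factor \<gamma> (cnj z))"
    unfolding moebius_cnj[symmetric] by (rule moebius_diff[OF \<gamma> x(2) j(2)])
  have coords: "eichler (moebius \<gamma> z) (moebius \<gamma> x) = (\<Sum>i\<le>n. G i (moebius \<gamma> z) *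
      ((moebius \<gamma> x - moebius \<gamma> z) ^ i * (moebius \<gamma> x - cnj (moebius \<gamma> z)) ^ (n - i)))"
    using real_minus_cnj_nonzero[OF z x(1)] x(2) j
    by (intro eichler_coords moebius_uhp[OF \<gamma> z]) (simp add: V)
  show ?thesis
    unfolding coords sum_distrib_right U V
  proof (rule sum.cong)
    fix i assume "i \<in> {..n}"
    then have pw: "j_factor \<gamma> x ^ n = j_factor \<gamma> x ^ i * j_factor \<gamma> x ^ (n - i)" by (simp add: power_add[symmetric])
    show "G i (moebius \<gamma> z) * (((x - z) / (j_factor \<gamma> x * j_factor \<gamma> z)) ^ i *
        ((x - cnj z) / (j_factor \<gamma> x * j_factor \<gamma> (cnj z))) ^ (n - i)) * j_factor \<gamma> x ^ n =
        G i (moebius \<gamma> z) / (j_factor \<gamma> z ^ i * j_factor \<gamma> (cnj z) ^ (n - i)) *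
        ((x - z) ^ i * (x - cnj z) ^ (n - i))"
      unfolding pw power_divide power_mult_distrib using x(2) j by simp
  qed simp
qed

lemma poly_act_F_plus_coords:
  assumes \<gamma>: "\<gamma> \<in> SL2Z" and z: "Im z > 0"
  shows "poly_act n (F_plus k f (moebius \<gamma> z)) \<gamma> =
    (\<Sum>i\<le>n. smult (G i (moebius \<gamma> z) / (j_factor \<gamma> z ^ i * j_factor \<gamma> (cnj z) ^ (n - i))) (basis_poly n z i))"
proof (rule poly_eq_infinite)
  let ?S = "\<real> - {x. j_factor \<gamma> x = 0}"
  show "infinite ?S"
  proof
    assume "finite ?S"
    then have "finite ((\<lambda>x. (x - z) / (x - cnj z)) ` ?S)" by (rule finite_imageI)
    with infinite_cross_ratios[OF z finite_j_factor_zeros[OF \<gamma>]] show False by simp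
  qed
  fix x assume "x \<in> ?S"
  then have x: "x \<in> \<real>" "j_factor \<gamma> x \<noteq> 0" by auto
  show "poly (poly_act n (F_plus k f (moebius \<gamma> z)) \<gamma>) x =
    poly (\<Sum>i\<le>n. smult (G i (moebius \<gamma> z) / (j_factor \<gamma> z ^ i * j_factor \<gamma> (cnj z) ^ (n - i))) (basis_poly n z i)) x"
    unfolding poly_poly_act[OF degree_F_plus x(2)] poly_F_plus[OF moebius_uhp[OF \<gamma> z]] poly_sum poly_smult poly_basis_poly
      mult.commute[of "j_factor \<gamma> x ^ n"]
    by (rule eichler_act_coords[OF \<gamma> z x])
qed

text \<open>The identity \<open>eichler_period\<close> read as one between polynomials in \<open>T\<close>, where
\<open>c X + d = (X - cnj z) (j - cnj j * T) / (z - cnj z)\<close>; then the coefficients of \<open>T ^ i\<close> are compared. The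
right-hand side depends on \<open>\<gamma>\<close> through a period polynomial and monomials in \<open>j\<close> and its conjugate.\<close>

lemma G_expansion:
  assumes \<gamma>: "\<gamma> \<in> SL2Z" and c: "\<gamma> $ 2 $ 1 \<ge> 1" and z: "Im z > 0" and i: "i \<le> n"
  shows "G i (moebius \<gamma> z) / (j_factor \<gamma> z ^ i * j_factor \<gamma> (cnj z) ^ (n - i)) =
    G i z + 1 / (z - cnj z) ^ n * (\<Sum>l\<le>n. \<Sum>u\<le>l.
      (of_nat (l choose u) * (-1) ^ u * (if u \<le> i then coeff ([:1, -1:] ^ (n - l)) (i - u) else 0)) *
      (coeff (period_poly (\<gamma> $ 1 $ 1) (\<gamma> $ 2 $ 1) (\<gamma> $ 2 $ 2)) l *
       (j_factor \<gamma> z ^ (l - u) * j_factor \<gamma> (cnj z) ^ u)))"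
proof -
  define j jb D where "j = j_factor \<gamma> z" and "jb = j_factor \<gamma> (cnj z)" and "D = z - cnj z"
  define \<pi> where "\<pi> = period_poly (\<gamma> $ 1 $ 1) (\<gamma> $ 2 $ 1) (\<gamma> $ 2 $ 2)"
  define g where "g i = G i (moebius \<gamma> z) / (j ^ i * jb ^ (n - i))" for i
  have D: "D \<noteq> 0" using z by (auto simp: D_def complex_eq_iff)
  have "(\<Sum>i\<le>n. monom (g i) i) = coord_poly z +
      smult (1 / D ^ n) (\<Sum>l\<le>n. smult (coeff \<pi> l) ([:j, - jb:] ^ l * [:1, -1:] ^ (n - l)))"
  proof (rule poly_eq_infinite[OF infinite_cross_ratios[OF z finite_j_factor_zeros[OF \<gamma>]]], elim imageE)
    fix T x assume x: "x \<in> \<real> - {x. j_factor \<gamma> x = 0}" and T: "T = (x - z) / (x - cnj z)"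
    define V v where "V = x - cnj z" and "v = j_factor \<gamma> x"
    have V: "V \<noteq> 0" using real_minus_cnj_nonzero[OF z] x by (simp add: V_def)
    have VT: "V * T = x - z" using V by (simp add: V_def T)
    have VD: "V * (1 - T) / D = 1"
    proof -
      have "V * (1 - T) = V - (x - z)" using VT by (simp add: algebra_simps)
      then show ?thesis using D by (simp add: V_def D_def)
    qed
    have v: "v = V * (j - jb * T) / D"
    proof -
      have "V * (j - jb * T) = V * j - jb * (x - z)" by (simp add: VT[symmetric] algebra_simps)
      also have "\<dots> = v * D"
        unfolding V_def v_def j_def jb_def D_def j_factor_def by (simp add: algebra_simps)
      finally show ?thesis using D by (simp add: field_simps)
    qed
    have "V ^ n * (\<Sum>i\<le>n. g i * T ^ i) = eichler (moebius \<gamma> z) (moebius \<gamma> x) * v ^ n"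
      unfolding v_def using eichler_act_coords[OF \<gamma> z] x
        basis_poly_sum_cross_ratio[where x = x and z = z and n = n and c = g] V
      by (simp add: g_def j_def jb_def V_def T)
    also have "\<dots> = eichler z x + poly \<pi> v"
      unfolding v_def \<pi>_def using x by (intro eichler_period[OF \<gamma> c _ z]) auto
    also have "eichler z x = V ^ n * poly (coord_poly z) T"
      using eichler_coords[OF z, of x] basis_poly_sum_cross_ratio[where x = x and z = z and n = n and c = "\<lambda>i. G i z"] V
      by (simp add: V_def T poly_coord_poly)
    also have "poly \<pi> v = V ^ n * (1 / D ^ n * (\<Sum>l\<le>n. coeff \<pi> l * ((j - jb * T) ^ l * (1 - T) ^ (n - l))))"
    proof -
      have "poly \<pi> v = (\<Sum>l\<le>n. coeff \<pi> l * v ^ l)"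
        unfolding \<pi>_def by (rule poly_eq_sum_coeff[OF degree_period_poly])
      also have "\<dots> = (\<Sum>l\<le>n. V ^ n * (1 / D ^ n * (coeff \<pi> l * ((j - jb * T) ^ l * (1 - T) ^ (n - l)))))"
      proof (rule sum.cong)
        fix l assume "l \<in> {..n}"
        then have pw: "y ^ n = y ^ l * y ^ (n - l)" for y :: complex by (simp add: power_add[symmetric])
        have "v ^ l = v ^ l * (V * (1 - T) / D) ^ (n - l)" by (simp add: VD)
        also have "\<dots> = V ^ n * (1 / D ^ n * ((j - jb * T) ^ l * (1 - T) ^ (n - l)))"
          unfolding v pw by (simp add: power_divide power_mult_distrib)
        finally show "coeff \<pi> l * v ^ l = V ^ n * (1 / D ^ n * (coeff \<pi> l * ((j - jb * T) ^ l * (1 - T) ^ (n - l))))"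
          by simp
      qed simp
      finally show ?thesis by (simp only: sum_distrib_left)
    qed
    finally have "V ^ n * (\<Sum>i\<le>n. g i * T ^ i) = V ^ n * (poly (coord_poly z) T +
        1 / D ^ n * (\<Sum>l\<le>n. coeff \<pi> l * ((j - jb * T) ^ l * (1 - T) ^ (n - l))))"
      by (simp only: distrib_left)
    then have "(\<Sum>i\<le>n. g i * T ^ i) = poly (coord_poly z) T +
        1 / D ^ n * (\<Sum>l\<le>n. coeff \<pi> l * ((j - jb * T) ^ l * (1 - T) ^ (n - l)))"
      using V by simp
    then show "poly (\<Sum>i\<le>n. monom (g i) i) T = poly (coord_poly z +
      smult (1 / D ^ n) (\<Sum>l\<le>n. smult (coeff \<pi> l) ([:j, - jb:] ^ l * [:1, -1:] ^ (n - l)))) T"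
      by (simp add: poly_sum poly_monom mult.commute[of T])
  qed
  from arg_cong[OF this, of "\<lambda>p. coeff p i"]
  have "g i = G i z + 1 / D ^ n * (\<Sum>l\<le>n. coeff \<pi> l * coeff ([:j, - jb:] ^ l * [:1, -1:] ^ (n - l)) i)"
    using i by (simp add: coeff_sum G_def)
  also have "(\<Sum>l\<le>n. coeff \<pi> l * coeff ([:j, - jb:] ^ l * [:1, -1:] ^ (n - l)) i) =
      (\<Sum>l\<le>n. \<Sum>u\<le>l. (of_nat (l choose u) * (-1) ^ u * (if u \<le> i then coeff ([:1, -1:] ^ (n - l)) (i - u) else 0)) *
        (coeff \<pi> l * (j ^ (l - u) * jb ^ u)))"
  proof (rule sum.cong)
    fix l
    have "coeff ([:j, - jb:] ^ l * [:1, -1:] ^ (n - l)) i =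
        (\<Sum>u\<le>l. of_nat (l choose u) * (- jb) ^ u * j ^ (l - u) * (if u \<le> i then coeff ([:1, -1:] ^ (n - l)) (i - u) else 0))"
      unfolding linear_power_expand[of j "- jb"] sum_distrib_right coeff_sum coeff_monom_mult
      by (rule sum.cong) auto
    moreover have "(- jb) ^ u = (-1) ^ u * jb ^ u" for u
      by (metis mult_minus1 power_mult_distrib)
    ultimately show "coeff \<pi> l * coeff ([:j, - jb:] ^ l * [:1, -1:] ^ (n - l)) i =
        (\<Sum>u\<le>l. (of_nat (l choose u) * (-1) ^ u * (if u \<le> i then coeff ([:1, -1:] ^ (n - l)) (i - u) else 0)) *
          (coeff \<pi> l * (j ^ (l - u) * jb ^ u)))"
      by (simp only: sum_distrib_left mult_ac)
  qed simp
  finally show ?thesis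
    by (simp only: g_def j_def jb_def D_def \<pi>_def)
qed

end

section \<open>Cosets of the translation subgroup\<close>

lemma mat2_mult: "(M ** N) $ i $ j = M $ i $ 1 * N $ 1 $ j + M $ i $ 2 * N $ 2 $ j" for M N :: int_mat
  by (simp add: matrix_matrix_mult_def sum_2)

lemma mat2_eq_iff: "M = N \<longleftrightarrow> M $ 1 $ 1 = N $ 1 $ 1 \<and> M $ 1 $ 2 = N $ 1 $ 2 \<and> M $ 2 $ 1 = N $ 2 $ 1 \<and> M $ 2 $ 2 = N $ 2 $ 2"
  for M N :: int_mat
  by (auto simp: vec_eq_iff forall_2)

lemma T_power_entries [simp]:
  "T_power m $ 1 $ 1 = 1" "T_power m $ 1 $ 2 = m" "T_power m $ 2 $ 1 = 0" "T_power m $ 2 $ 2 = 1"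
  by (simp_all add: T_power_def)

lemma SL2Z_mult: "\<gamma> \<in> SL2Z \<Longrightarrow> \<gamma>' \<in> SL2Z \<Longrightarrow> \<gamma> ** \<gamma>' \<in> SL2Z"
  by (simp add: SL2Z_def det_mul)

lemma SL2Z_uminus: "\<gamma> \<in> SL2Z \<Longrightarrow> - \<gamma> \<in> SL2Z"
  by (simp add: SL2Z_iff)

lemma T_power_SL2Z: "T_power m \<in> SL2Z"
  by (simp add: SL2Z_iff)

lemma mat_1_SL2Z: "mat 1 \<in> SL2Z"
  by (simp add: SL2Z_def)

lemma SL2Z_right_inverse:
  assumes "\<gamma> \<in> SL2Z"
  obtains \<delta> where "\<delta> \<in> SL2Z" "\<gamma> ** \<delta> = mat 1" "\<delta> ** \<gamma> = mat 1"
proof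
  let ?\<delta> = "vector [vector [\<gamma> $ 2 $ 2, - \<gamma> $ 1 $ 2], vector [- \<gamma> $ 2 $ 1, \<gamma> $ 1 $ 1]] :: int_mat"
  show "?\<delta> \<in> SL2Z" "\<gamma> ** ?\<delta> = mat 1" "?\<delta> ** \<gamma> = mat 1"
    using assms by (simp_all add: SL2Z_iff mat2_eq_iff mat2_mult mat_def algebra_simps)
qed

lemma j_factor_mult:
  assumes "j_factor \<gamma>' z \<noteq> 0"
  shows "j_factor (\<gamma> ** \<gamma>') z = j_factor \<gamma> (moebius \<gamma>' z) * j_factor \<gamma>' z"
  using assms by (simp add: j_factor_def[of \<gamma>] j_factor_def[of "\<gamma> ** \<gamma>'"] moebius_def mat2_mult field_simps)
     (simp add: j_factor_def algebra_simps)

lemma moebius_mult: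
  assumes "j_factor \<gamma>' z \<noteq> 0"
  shows "moebius (\<gamma> ** \<gamma>') z = moebius \<gamma> (moebius \<gamma>' z)"
proof -
  have "of_int ((\<gamma> ** \<gamma>') $ 1 $ 1) * z + of_int ((\<gamma> ** \<gamma>') $ 1 $ 2) =
      (of_int (\<gamma> $ 1 $ 1) * moebius \<gamma>' z + of_int (\<gamma> $ 1 $ 2)) * j_factor \<gamma>' z"
    using assms by (simp add: moebius_def mat2_mult field_simps) (simp add: j_factor_def algebra_simps)
  then show ?thesis
    unfolding moebius_def[of "\<gamma> ** \<gamma>'"] moebius_def[of \<gamma>] j_factor_mult[OF assms]
    using assms by simp
qed

lemma moebius_T_power_mult:
  assumes "j_factor \<gamma> z \<noteq> 0"
  shows "moebius (T_power N ** \<gamma>) z = moebius \<gamma> z + of_int N"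
  unfolding moebius_mult[OF assms] by (simp add: moebius_def[of "T_power N"] j_factor_def)

lemma j_factor_uminus: "j_factor (- \<gamma>) z = - j_factor \<gamma> z"
  by (simp add: j_factor_def)

lemma moebius_uminus: "moebius (- \<gamma>) z = moebius \<gamma> z"
proof -
  have "of_int ((- \<gamma>) $ 1 $ 1) * z + of_int ((- \<gamma>) $ 1 $ 2) = - (of_int (\<gamma> $ 1 $ 1) * z + of_int (\<gamma> $ 1 $ 2))"
    by simp
  then show ?thesis unfolding moebius_def j_factor_uminus by (simp only: minus_divide_divide)
qed

lemma same_row_imp_T_power:
  assumes "\<gamma> \<in> SL2Z" "\<gamma>' \<in> SL2Z" "\<gamma>' $ 2 = \<gamma> $ 2"
  shows "\<exists>N. \<gamma>' = T_power N ** \<gamma>"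
proof -
  define a b c d a' b' where "a = \<gamma> $ 1 $ 1" "b = \<gamma> $ 1 $ 2" "c = \<gamma> $ 2 $ 1" "d = \<gamma> $ 2 $ 2"
    "a' = \<gamma>' $ 1 $ 1" "b' = \<gamma>' $ 1 $ 2"
  note entry_defs = this
  have det: "a * d - b * c = 1" "a' * d - b' * c = 1"
    using assms by (simp_all add: SL2Z_iff entry_defs)
  \<comment> \<open>The exponent: if \<open>a' = a + N c\<close> and \<open>b' = b + N d\<close>, then \<open>a b' - a' b = N\<close>.\<close>
  have "a' = a + (a * b' - a' * b) * c" "b' = b + (a * b' - a' * b) * d"
    using det by algebra+
  then have "\<gamma>' = T_power (a * b' - a' * b) ** \<gamma>"
    using assms(3) by (simp add: mat2_eq_iff mat2_mult entry_defs)
  then show ?thesis ..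
qed

definition B_coset :: "int_mat \<Rightarrow> int_mat set" where
  "B_coset \<gamma> = (\<lambda>b. b ** \<gamma>) ` B_group"

lemma B_cosets_eq: "B_cosets = B_coset ` SL2Z"
  by (simp add: B_cosets_def B_coset_def)

lemma mat2_uminus_mult: "(- M) ** N = - (M ** N)" for M N :: int_mat
  by (simp add: mat2_eq_iff mat2_mult)

text \<open>A coset consists of the matrices with a given bottom row up to sign: matrices with equal bottom
rows differ by a power of \<open>T\<close> on the left.\<close>

lemma B_coset_eq:
  assumes "\<gamma> \<in> SL2Z"
  shows "B_coset \<gamma> = {\<gamma>' \<in> SL2Z. \<gamma>' $ 2 = \<gamma> $ 2 \<or> \<gamma>' $ 2 = - (\<gamma> $ 2)}"
proof (intro equalityI subsetI)
  fix \<gamma>' assume "\<gamma>' \<in> B_coset \<gamma>"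
  then obtain b where b: "\<gamma>' = b ** \<gamma>" "b \<in> B_group" unfolding B_coset_def by blast
  then obtain N where "b = T_power N \<or> b = - T_power N" unfolding B_group_def by blast
  then have "\<gamma>' = T_power N ** \<gamma> \<or> \<gamma>' = - (T_power N ** \<gamma>)"
    by (auto simp: b(1) mat2_uminus_mult)
  moreover have "T_power N ** \<gamma> \<in> SL2Z" by (intro SL2Z_mult T_power_SL2Z assms)
  moreover have "(T_power N ** \<gamma>) $ 2 = \<gamma> $ 2"
    by (simp add: vec_eq_iff mat2_mult)
  ultimately show "\<gamma>' \<in> {\<gamma>' \<in> SL2Z. \<gamma>' $ 2 = \<gamma> $ 2 \<or> \<gamma>' $ 2 = - (\<gamma> $ 2)}"
    by (auto intro: SL2Z_uminus)
next
  fix \<gamma>' assume "\<gamma>' \<in> {\<gamma>' \<in> SL2Z. \<gamma>' $ 2 = \<gamma> $ 2 \<or> \<gamma>' $ 2 = - (\<gamma> $ 2)}"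
  then have \<gamma>': "\<gamma>' \<in> SL2Z" and "\<gamma>' $ 2 = \<gamma> $ 2 \<or> (- \<gamma>') $ 2 = \<gamma> $ 2" by auto
  then obtain N where "\<gamma>' = T_power N ** \<gamma> \<or> - \<gamma>' = T_power N ** \<gamma>"
    using same_row_imp_T_power[OF assms] SL2Z_uminus[OF \<gamma>'] by blast
  then have "\<gamma>' = T_power N ** \<gamma> \<or> \<gamma>' = (- T_power N) ** \<gamma>"
    by (metis mat2_uminus_mult minus_minus)
  then show "\<gamma>' \<in> B_coset \<gamma>"
    unfolding B_coset_def B_group_def by auto
qed

lemma B_coset_self: "\<gamma> \<in> SL2Z \<Longrightarrow> \<gamma> \<in> B_coset \<gamma>"
  by (simp add: B_coset_eq)

definition B_invariant :: "(int_mat \<Rightarrow> complex) \<Rightarrow> bool" where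
  "B_invariant g \<longleftrightarrow> (\<forall>\<gamma>\<in>SL2Z. \<forall>\<gamma>'\<in>SL2Z. \<gamma>' $ 2 = \<gamma> $ 2 \<or> \<gamma>' $ 2 = - (\<gamma> $ 2) \<longrightarrow> g \<gamma>' = g \<gamma>)"

lemma some_in_B_coset:
  assumes "\<gamma> \<in> SL2Z"
  shows "(SOME \<gamma>'. \<gamma>' \<in> B_coset \<gamma>) \<in> B_coset \<gamma>"
  using B_coset_self[OF assms] by (rule someI)

lemma B_invariant_some:
  assumes "B_invariant g" "\<gamma> \<in> SL2Z"
  shows "g (SOME \<gamma>'. \<gamma>' \<in> B_coset \<gamma>) = g \<gamma>"
  using some_in_B_coset[OF assms(2)] assms unfolding B_coset_eq[OF assms(2)] B_invariant_def by blast

lemma some_in_B_cosets: "C \<in> B_cosets \<Longrightarrow> (SOME \<gamma>. \<gamma> \<in> C) \<in> SL2Z"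
  using some_in_B_coset unfolding B_cosets_eq by (force simp: B_coset_eq)

lemma coset_sum_cong: "(\<And>\<gamma>. \<gamma> \<in> SL2Z \<Longrightarrow> g \<gamma> = g' \<gamma>) \<Longrightarrow> coset_sum g = coset_sum g'"
  unfolding coset_sum_def by (intro infsum_cong) (simp add: some_in_B_cosets)

definition coprime_pairs :: "(int \<times> int) set" where
  "coprime_pairs = {(c, d). c \<ge> 1 \<and> coprime c d}"

definition pair_rep :: "int \<Rightarrow> int \<Rightarrow> int_mat" where
  "pair_rep c d = (SOME \<gamma>. \<gamma> \<in> SL2Z \<and> \<gamma> $ 2 $ 1 = c \<and> \<gamma> $ 2 $ 2 = d)"

lemma pair_rep:
  assumes "coprime c d"
  shows "pair_rep c d \<in> SL2Z" "pair_rep c d $ 2 $ 1 = c" "pair_rep c d $ 2 $ 2 = d"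
proof -
  obtain u v where uv: "u * c + v * d = 1"
    using bezout_int[of c d] assms by auto
  let ?\<gamma> = "vector [vector [v, - u], vector [c, d]] :: int_mat"
  have "?\<gamma> \<in> SL2Z \<and> ?\<gamma> $ 2 $ 1 = c \<and> ?\<gamma> $ 2 $ 2 = d"
    using uv by (simp add: SL2Z_iff algebra_simps)
  from someI[where P = "\<lambda>\<gamma>. \<gamma> \<in> SL2Z \<and> \<gamma> $ 2 $ 1 = c \<and> \<gamma> $ 2 $ 2 = d", OF this]
  show "pair_rep c d \<in> SL2Z" "pair_rep c d $ 2 $ 1 = c" "pair_rep c d $ 2 $ 2 = d"
    unfolding pair_rep_def by auto
qed

lemma row_eq_iff: "M $ 2 = N $ 2 \<longleftrightarrow> M $ 2 $ 1 = N $ 2 $ 1 \<and> M $ 2 $ 2 = N $ 2 $ 2" for M N :: int_mat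
  by (simp add: vec_eq_iff forall_2)

lemma row_eq_uminus_iff: "M $ 2 = - (N $ 2) \<longleftrightarrow> M $ 2 $ 1 = - N $ 2 $ 1 \<and> M $ 2 $ 2 = - N $ 2 $ 2" for M N :: int_mat
  by (simp add: vec_eq_iff forall_2)

text \<open>The cosets correspond to the coprime pairs up to sign, normalised to \<open>(0, 1)\<close> or \<open>c \<ge> 1\<close>.\<close>

lemma B_cosets_bij:
  "bij_betw (\<lambda>(c, d). B_coset (pair_rep c d)) (insert (0, 1) coprime_pairs) B_cosets"
proof -
  let ?D = "insert (0, 1) coprime_pairs" and ?F = "\<lambda>(c, d). B_coset (pair_rep c d)"
  have cop: "coprime c d" if "(c, d) \<in> ?D" for c d using that by (auto simp: coprime_pairs_def)
  have "inj_on ?F ?D"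
  proof (rule inj_onI)
    fix p p' assume p: "p \<in> ?D" "p' \<in> ?D" and eq: "?F p = ?F p'"
    obtain c d c' d' where cd: "p = (c, d)" "p' = (c', d')" by (cases p; cases p')
    have 1: "coprime c d" "coprime c' d'" using p cop by (auto simp: cd)
    have "pair_rep c d \<in> B_coset (pair_rep c' d')"
      using B_coset_self[OF pair_rep(1)[OF 1(1)]] eq by (simp add: cd)
    then have "(c = c' \<and> d = d') \<or> (c = - c' \<and> d = - d')"
      unfolding B_coset_eq[OF pair_rep(1)[OF 1(2)]] mem_Collect_eq row_eq_iff row_eq_uminus_iff
      by (simp add: pair_rep[OF 1(1)] pair_rep[OF 1(2)])
    then show "p = p'" using p by (auto simp: cd coprime_pairs_def)
  qed
  moreover have "?F ` ?D = B_cosets"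
  proof
    show "?F ` ?D \<subseteq> B_cosets"
      unfolding B_cosets_eq using cop pair_rep(1) by fastforce
    show "B_cosets \<subseteq> ?F ` ?D"
      unfolding B_cosets_eq
    proof clarify
      fix \<gamma> assume \<gamma>: "\<gamma> \<in> SL2Z"
      define c d where "c = \<gamma> $ 2 $ 1" and "d = \<gamma> $ 2 $ 2"
      have cd: "coprime c d"
      proof (rule coprimeI)
        fix x assume "x dvd c" "x dvd d"
        then have "x dvd \<gamma> $ 1 $ 1 * d - \<gamma> $ 1 $ 2 * c" by simp
        then show "is_unit x" using \<gamma> by (simp add: SL2Z_iff c_def d_def)
      qed
      define \<epsilon> :: int where "\<epsilon> = (if c < 0 \<or> (c = 0 \<and> d < 0) then - 1 else 1)"
      have \<epsilon>: "\<epsilon> = 1 \<or> \<epsilon> = - 1" by (simp add: \<epsilon>_def)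
      have cop': "coprime (\<epsilon> * c) (\<epsilon> * d)" using \<epsilon> cd by auto
      have "d = 1 \<or> d = - 1" if "c = 0" using cd that by auto
      then have mem: "(\<epsilon> * c, \<epsilon> * d) \<in> ?D"
        using cop' by (auto simp: \<epsilon>_def coprime_pairs_def split: if_splits)
      have coset_eq: "B_coset \<gamma> = B_coset (pair_rep (\<epsilon> * c) (\<epsilon> * d))"
        using \<epsilon> unfolding B_coset_eq[OF \<gamma>] B_coset_eq[OF pair_rep(1)[OF cop']] row_eq_iff row_eq_uminus_iff pair_rep(2,3)[OF cop']
        by (auto simp: c_def d_def)
      show "B_coset \<gamma> \<in> ?F ` ?D"
        using imageI[OF mem, of ?F] by (simp only: coset_eq prod.case)
    qed
  qed
  ultimately show ?thesis by (simp add: bij_betw_def)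
qed

lemma coset_sum_pairs:
  assumes "B_invariant g"
  shows "((\<lambda>C. g (SOME \<gamma>. \<gamma> \<in> C)) has_sum S) B_cosets \<longleftrightarrow>
         ((\<lambda>(c, d). g (pair_rep c d)) has_sum S) (insert (0, 1) coprime_pairs)"
proof -
  have "((\<lambda>C. g (SOME \<gamma>. \<gamma> \<in> C)) has_sum S) B_cosets \<longleftrightarrow>
    ((\<lambda>p. g (SOME \<gamma>. \<gamma> \<in> (case p of (c, d) \<Rightarrow> B_coset (pair_rep c d)))) has_sum S) (insert (0, 1) coprime_pairs)"
    by (rule has_sum_reindex_bij_betw[OF B_cosets_bij, symmetric])
  also have "\<dots> \<longleftrightarrow> ((\<lambda>(c, d). g (pair_rep c d)) has_sum S) (insert (0, 1) coprime_pairs)"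
  proof (rule has_sum_cong)
    fix p assume "p \<in> insert (0, 1) coprime_pairs"
    then have "coprime (fst p) (snd p)" by (auto simp: coprime_pairs_def)
    from B_invariant_some[OF assms pair_rep(1)[OF this]]
    show "g (SOME \<gamma>. \<gamma> \<in> (case p of (c, d) \<Rightarrow> B_coset (pair_rep c d))) = (case p of (c, d) \<Rightarrow> g (pair_rep c d))"
      by (simp add: case_prod_unfold)
  qed
  finally show ?thesis .
qed

text \<open>Right translation permutes the cosets.\<close>

lemma coset_sum_translate:
  assumes g: "B_invariant g" and \<gamma>0: "\<gamma>0 \<in> SL2Z"
  shows "coset_sum (\<lambda>\<gamma>. g (\<gamma> ** \<gamma>0)) = coset_sum g"
proof -
  obtain \<delta> where \<delta>: "\<delta> \<in> SL2Z" "\<gamma>0 ** \<delta> = mat 1" "\<delta> ** \<gamma>0 = mat 1"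
    using SL2Z_right_inverse[OF \<gamma>0] .
  have im: "(\<lambda>\<gamma>. \<gamma> ** \<delta>) ` B_coset \<gamma> = B_coset (\<gamma> ** \<delta>)" for \<gamma> \<delta> :: int_mat
    unfolding B_coset_def image_image by (simp only: matrix_mul_assoc)
  have "bij_betw (\<lambda>C. (\<lambda>\<gamma>. \<gamma> ** \<gamma>0) ` C) B_cosets B_cosets"
  proof (rule bij_betwI[where g = "\<lambda>C. (\<lambda>\<gamma>. \<gamma> ** \<delta>) ` C"])
    show "(\<lambda>C. (\<lambda>\<gamma>. \<gamma> ** \<gamma>0) ` C) \<in> B_cosets \<rightarrow> B_cosets" "(\<lambda>C. (\<lambda>\<gamma>. \<gamma> ** \<delta>) ` C) \<in> B_cosets \<rightarrow> B_cosets"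
      unfolding B_cosets_eq using im SL2Z_mult \<gamma>0 \<delta>(1) by auto
    show "(\<lambda>\<gamma>. \<gamma> ** \<delta>) ` (\<lambda>\<gamma>. \<gamma> ** \<gamma>0) ` C = C" "(\<lambda>\<gamma>. \<gamma> ** \<gamma>0) ` (\<lambda>\<gamma>. \<gamma> ** \<delta>) ` C = C" for C
      by (simp_all add: image_image matrix_mul_assoc[symmetric] \<delta>)
  qed
  from infsum_reindex_bij_betw[OF this, of "\<lambda>C. g (SOME \<gamma>. \<gamma> \<in> C)"]
  have "coset_sum g = (\<Sum>\<^sub>\<infinity>C\<in>B_cosets. g (SOME \<gamma>. \<gamma> \<in> (\<lambda>\<gamma>. \<gamma> ** \<gamma>0) ` C))"
    by (simp add: coset_sum_def)
  also have "\<dots> = coset_sum (\<lambda>\<gamma>. g (\<gamma> ** \<gamma>0))"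
    unfolding coset_sum_def
  proof (rule infsum_cong)
    fix C assume "C \<in> B_cosets"
    then obtain \<gamma> where \<gamma>: "\<gamma> \<in> SL2Z" "C = B_coset \<gamma>" unfolding B_cosets_eq by auto
    have inv: "B_invariant (\<lambda>\<gamma>. g (\<gamma> ** \<gamma>0))"
      unfolding B_invariant_def
    proof (intro ballI impI)
      fix \<gamma> \<gamma>' assume *: "\<gamma> \<in> SL2Z" "\<gamma>' \<in> SL2Z" "\<gamma>' $ 2 = \<gamma> $ 2 \<or> \<gamma>' $ 2 = - (\<gamma> $ 2)"
      then have "(\<gamma>' ** \<gamma>0) $ 2 = (\<gamma> ** \<gamma>0) $ 2 \<or> (\<gamma>' ** \<gamma>0) $ 2 = - ((\<gamma> ** \<gamma>0) $ 2)"
        unfolding row_eq_iff row_eq_uminus_iff by (auto simp: mat2_mult)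
      with g * SL2Z_mult[OF _ \<gamma>0] show "g (\<gamma>' ** \<gamma>0) = g (\<gamma> ** \<gamma>0)"
        unfolding B_invariant_def by blast
    qed
    show "g (SOME \<gamma>. \<gamma> \<in> (\<lambda>\<gamma>. \<gamma> ** \<gamma>0) ` C) = g ((SOME \<gamma>. \<gamma> \<in> C) ** \<gamma>0)"
      unfolding \<gamma>(2) im B_invariant_some[OF g SL2Z_mult[OF \<gamma>(1) \<gamma>0]] B_invariant_some[OF inv \<gamma>(1)] ..
  qed
  finally show ?thesis by simp
qed

section \<open>The Poincare series of the coordinates of an Eichler integral\<close>

lemma has_sum_finite_sum:
  fixes F :: "'i \<Rightarrow> 'x \<Rightarrow> complex"
  assumes "finite I" "\<And>i. i \<in> I \<Longrightarrow> (F i has_sum S i) X"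
  shows "((\<lambda>x. \<Sum>i\<in>I. F i x) has_sum (\<Sum>i\<in>I. S i)) X"
  using assms by (induction rule: finite_induct) (auto intro: has_sum_add)

definition pair_term :: "(int \<Rightarrow> int \<Rightarrow> complex) \<Rightarrow> int \<Rightarrow> int \<Rightarrow> complex \<Rightarrow> int \<times> int \<Rightarrow> complex" where
  "pair_term p a b z = (\<lambda>(c, d).
     p c d * pair_powers a b z c d)"

lemma pair_term_has_sum:
  assumes "Im z > 0" "a + b \<ge> 4" "\<And>c d. norm (p c d) \<le> B"
  shows "(pair_term p a b z has_sum infsum (pair_term p a b z) ({1..} \<times> UNIV)) ({1..} \<times> UNIV)"
  unfolding pair_term_def by (rule has_sum_infsum, rule pair_sum_summable[OF assms]) auto

lemma qexp_pair_term:
  assumes "a + b \<ge> 4" "\<And>c d. norm (p c d) \<le> B" "\<And>c d m. c \<ge> 1 \<Longrightarrow> p c (d + c * m) = p c d"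
  shows "qexp (\<lambda>z. infsum (pair_term p a b z) ({1..} \<times> UNIV))"
  unfolding pair_term_def by (rule qexp_pair_sum[OF assms])

definition coprime_ind :: "int \<Rightarrow> int \<Rightarrow> complex" where
  "coprime_ind c d = (if c \<ge> 1 \<and> coprime c d then 1 else 0)"

lemma coprime_add_mult: "coprime c (d + c * m) \<longleftrightarrow> coprime c d" for c d m :: int
  by (metis add.commute coprime_iff_gcd_eq_1 gcd_add_mult mult.commute)

text \<open>The upper left entry is an inverse of \<open>d\<close> modulo \<open>c\<close>, hence determined modulo \<open>c\<close> by the bottom row.\<close>

lemma inverse_mod_unique:
  fixes p b c d p' b' :: int
  assumes "p * d - b * c = 1" "p' * d - b' * c = 1"
  shows "p' = p + c * (p * (b' - b) - (p' - p) * b)"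
  using assms by algebra

context cusp_form
begin

text \<open>The coefficients of the period polynomials as functions of the bottom row, with value 0 at the pairs
that are not bottom rows with \<open>c \<ge> 1\<close>; so they can be summed over all pairs of integers.\<close>

definition period_coeff :: "nat \<Rightarrow> int \<Rightarrow> int \<Rightarrow> complex" where
  "period_coeff l c d = (if c \<ge> 1 \<and> coprime c d then coeff (period_poly (pair_rep c d $ 1 $ 1) c d) l else 0)"

lemma period_coeff_bound: "\<exists>B. \<forall>l c d. norm (period_coeff l c d) \<le> B"
proof -
  obtain B where B: "\<forall>p c d l. c \<ge> 1 \<longrightarrow> norm (coeff (period_poly p c d) l) \<le> B"
    using period_poly_bound by (elim exE)
  have "norm (period_coeff l c d) \<le> max B 0" for l c d
    using B unfolding period_coeff_def by (auto simp: max.coboundedI1)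
  then show ?thesis by (intro exI allI)
qed

lemma period_coeff_periodic:
  assumes c: "c \<ge> 1"
  shows "period_coeff l c (d + c * m) = period_coeff l c d"
proof (cases "coprime c d")
  case True
  then have cop: "coprime c (d + c * m)" by (simp add: coprime_add_mult)
  define p b p' b' where "p = pair_rep c d $ 1 $ 1" "b = pair_rep c d $ 1 $ 2"
    "p' = pair_rep c (d + c * m) $ 1 $ 1" "b' = pair_rep c (d + c * m) $ 1 $ 2"
  note entry_defs = this
  have "p * d - b * c = 1" "p' * (d + c * m) - b' * c = 1"
    using pair_rep[OF True] pair_rep[OF cop] by (simp_all add: SL2Z_iff entry_defs)
  then have "p * d - b * c = 1" "p' * d - (b' - p' * m) * c = 1" by (simp_all add: algebra_simps)
  from inverse_mod_unique[OF this] obtain l' where p': "p' = p + c * l'" by blast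
  have "period_poly p' c (d + c * m) = period_poly p c d"
    unfolding p' using c by (intro period_poly_periodic) simp
  then show ?thesis using True cop c by (simp add: period_coeff_def entry_defs)
qed (simp add: period_coeff_def coprime_add_mult)

text \<open>The \<open>i\<close>-th coordinate of the summand of \<open>phi_poly\<close> at \<open>\<gamma>\<close>.\<close>

definition summand :: "nat \<Rightarrow> int \<Rightarrow> int \<Rightarrow> complex \<Rightarrow> int_mat \<Rightarrow> complex" where
  "summand i r s z \<gamma> = G i (moebius \<gamma> z) / (j_factor \<gamma> z ^ i * j_factor \<gamma> (cnj z) ^ (n - i)) /
     (j_factor \<gamma> z powi r * j_factor \<gamma> (cnj z) powi s)"

lemma summand_uminus:
  assumes "even (r + s)" "i \<le> n"
  shows "summand i r s z (- \<gamma>) = summand i r s z \<gamma>"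
proof -
  have "(- x) ^ i * (- y) ^ (n - i) = x ^ i * y ^ (n - i)" for x y :: complex
  proof -
    have "even (i + (n - i))" using n_facts(1) assms(2) by simp
    then show ?thesis by (cases "even i") (auto simp: power_minus_even power_minus_odd)
  qed
  moreover have "(- x) powi r * (- y) powi s = x powi r * y powi s" for x y :: complex
    using assms(1) by (cases "even r") (auto simp: power_int_minus_left)
  ultimately show ?thesis
    unfolding summand_def moebius_uminus j_factor_uminus by (simp only:)
qed

lemma summand_invariant:
  assumes "even (r + s)" "i \<le> n" "Im z > 0"
  shows "B_invariant (summand i r s z)"
  unfolding B_invariant_def
proof (intro ballI impI)
  fix \<gamma> \<gamma>' assume \<gamma>: "\<gamma> \<in> SL2Z" "\<gamma>' \<in> SL2Z" and row: "\<gamma>' $ 2 = \<gamma> $ 2 \<or> \<gamma>' $ 2 = - (\<gamma> $ 2)"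
  have same: "summand i r s z \<gamma>' = summand i r s z \<gamma>" if g': "\<gamma>' \<in> SL2Z" "\<gamma>' $ 2 = \<gamma> $ 2" for \<gamma>'
  proof -
    obtain N where "\<gamma>' = T_power N ** \<gamma>" using same_row_imp_T_power[OF \<gamma>(1) g'] by blast
    then have "moebius \<gamma>' z = moebius \<gamma> z + of_int N"
      using moebius_T_power_mult j_factor_nonzero[OF \<gamma>(1), of z] assms(3) by simp
    moreover have "j_factor \<gamma>' w = j_factor \<gamma> w" for w using g'(2) by (simp add: j_factor_def)
    ultimately show ?thesis by (simp add: summand_def G_periodic)
  qed
  from row show "summand i r s z \<gamma>' = summand i r s z \<gamma>"
  proof
    assume "\<gamma>' $ 2 = - (\<gamma> $ 2)"
    then have "(- \<gamma>') $ 2 = \<gamma> $ 2" by simp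
    from same[OF SL2Z_uminus[OF \<gamma>(2)] this] show ?thesis
      by (simp only: summand_uminus[OF assms(1,2)])
  qed (rule same[OF \<gamma>(2)])
qed

text \<open>The coefficient of \<open>j^(l - u) * (cnj j)^u * T^i\<close> in \<open>(j - cnj j * T)^l * (1 - T)^(n - l)\<close>.\<close>

definition kernel_coeff :: "nat \<Rightarrow> nat \<Rightarrow> nat \<Rightarrow> complex" where
  "kernel_coeff i l u = of_nat (l choose u) * (-1) ^ u * (if u \<le> i then coeff ([:1, -1:] ^ (n - l)) (i - u) else 0)"

lemma summand_expansion:
  assumes cd: "c \<ge> 1" "coprime c d" and z: "Im z > 0" and i: "i \<le> n"
  shows "summand i r s z (pair_rep c d) = G i z * pair_term coprime_ind r s z (c, d) +
    1 / (z - cnj z) ^ n * (\<Sum>l\<le>n. \<Sum>u\<le>l. kernel_coeff i l u *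
      pair_term (period_coeff l) (r - int (l - u)) (s - int u) z (c, d))"
proof -
  define j jb where "j = of_int c * z + of_int d" and "jb = of_int c * cnj z + of_int d"
  note rep = pair_rep[OF cd(2)]
  have jj: "j_factor (pair_rep c d) z = j" "j_factor (pair_rep c d) (cnj z) = jb"
    by (simp_all add: j_factor_def j_def jb_def rep)
  have nz: "j \<noteq> 0" "jb \<noteq> 0" using uhp_linear_nonzero[of z c d] z cd by (simp_all add: j_def jb_def)
  have c1: "pair_rep c d $ 2 $ 1 \<ge> 1" using cd by (simp add: rep)
  have pw: "j ^ (l - u) * jb ^ u / (j powi r * jb powi s) = j powi (- (r - int (l - u))) * jb powi (- (s - int u))" for l u
    using nz by (simp add: power_int_diff)
  have one: "1 / (j powi r * jb powi s) = j powi (- r) * jb powi (- s)"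
    by (simp add: power_int_minus divide_inverse)
  have "G i (moebius (pair_rep c d) z) / (j ^ i * jb ^ (n - i)) = G i z + 1 / (z - cnj z) ^ n * (\<Sum>l\<le>n. \<Sum>u\<le>l.
      kernel_coeff i l u * (coeff (period_poly (pair_rep c d $ 1 $ 1) c d) l * (j ^ (l - u) * jb ^ u)))"
    using G_expansion[OF rep(1) c1 z i] unfolding jj rep(2,3) kernel_coeff_def .
  then have "summand i r s z (pair_rep c d) = (G i z + 1 / (z - cnj z) ^ n * (\<Sum>l\<le>n. \<Sum>u\<le>l.
      kernel_coeff i l u * (coeff (period_poly (pair_rep c d $ 1 $ 1) c d) l * (j ^ (l - u) * jb ^ u)))) / (j powi r * jb powi s)"
    by (simp only: summand_def jj)
  also have "\<dots> = G i z * (1 / (j powi r * jb powi s)) + 1 / (z - cnj z) ^ n * (\<Sum>l\<le>n. \<Sum>u\<le>l.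
      kernel_coeff i l u * (coeff (period_poly (pair_rep c d $ 1 $ 1) c d) l * (j ^ (l - u) * jb ^ u / (j powi r * jb powi s))))"
    by (simp add: add_divide_distrib sum_divide_distrib mult.commute[of "(z - cnj z) ^ n"])
  also have "\<dots> = G i z * pair_term coprime_ind r s z (c, d) +
    1 / (z - cnj z) ^ n * (\<Sum>l\<le>n. \<Sum>u\<le>l. kernel_coeff i l u *
      pair_term (period_coeff l) (r - int (l - u)) (s - int u) z (c, d))"
    using cd unfolding pw one pair_term_def prod.case coprime_ind_def period_coeff_def j_def[symmetric] jb_def[symmetric] by simp
  finally show ?thesis .
qed

definition phi_value :: "nat \<Rightarrow> int \<Rightarrow> int \<Rightarrow> complex \<Rightarrow> complex" where
  "phi_value i r s z = coset_sum (summand i r s z)"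

text \<open>The sum of the expanded summands: the coset of the bottom row \<open>(0, 1)\<close> gives the first \<open>G i z\<close>, the pairs
with \<open>c \<ge> 1\<close> the rest.\<close>

definition phi_expansion :: "nat \<Rightarrow> int \<Rightarrow> int \<Rightarrow> complex \<Rightarrow> complex" where
  "phi_expansion i r s z = G i z + (G i z * infsum (pair_term coprime_ind r s z) ({1..} \<times> UNIV) +
    1 / (z - cnj z) ^ n * (\<Sum>l\<le>n. \<Sum>u\<le>l. kernel_coeff i l u *
      infsum (pair_term (period_coeff l) (r - int (l - u)) (s - int u) z) ({1..} \<times> UNIV)))"

lemma coprime_ind_bound: "norm (coprime_ind c d) \<le> 1"
  by (simp add: coprime_ind_def)

text \<open>Both \<open>r + s\<close> and \<open>k\<close> are even, so \<open>r + s > k\<close> means \<open>r + s \<ge> n + 4\<close>, and a power of \<open>j\<close> of degree at most \<open>n\<close>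
leaves exponents of sum at least 4.\<close>

lemma exponents_ge_4:
  assumes "even (r + s)" "r + s > int k" "l \<le> n" "u \<le> l"
  shows "r + s \<ge> 4" "(r - int (l - u)) + (s - int u) \<ge> 4"
proof -
  have "r + s \<noteq> int k + 1" using assms(1) k(2) by (metis even_of_nat odd_add odd_one)
  then have "r + s \<ge> int n + 4" using assms(2) n_facts(3) by linarith
  then show "r + s \<ge> 4" "(r - int (l - u)) + (s - int u) \<ge> 4" using assms(3,4) by (simp_all add: of_nat_diff)
qed

lemma summand_has_sum:
  assumes rs: "even (r + s)" "r + s > int k" and i: "i \<le> n" and z: "Im z > 0"
  shows "((\<lambda>C. summand i r s z (SOME \<gamma>. \<gamma> \<in> C)) has_sum phi_expansion i r s z) B_cosets"
proof -
  obtain B where B: "\<forall>l c d. norm (period_coeff l c d) \<le> B" using period_coeff_bound by (elim exE)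
  define H where "H p = G i z * pair_term coprime_ind r s z p +
    1 / (z - cnj z) ^ n * (\<Sum>l\<le>n. \<Sum>u\<le>l. kernel_coeff i l u *
      pair_term (period_coeff l) (r - int (l - u)) (s - int u) z p)" for p
  have "(H has_sum (G i z * infsum (pair_term coprime_ind r s z) ({1..} \<times> UNIV) +
    1 / (z - cnj z) ^ n * (\<Sum>l\<le>n. \<Sum>u\<le>l. kernel_coeff i l u *
      infsum (pair_term (period_coeff l) (r - int (l - u)) (s - int u) z) ({1..} \<times> UNIV)))) ({1..} \<times> UNIV)"
    unfolding H_def
    by (intro has_sum_add has_sum_cmult_right has_sum_finite_sum finite_atMost
          pair_term_has_sum[OF z exponents_ge_4(1)[OF rs le0 le0] coprime_ind_bound]
          pair_term_has_sum[OF z exponents_ge_4(2)[OF rs] B[rule_format]]) auto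
  moreover have "H (c, d) = 0" if "\<not> (c \<ge> 1 \<and> coprime c d)" for c d
  proof -
    have "coprime_ind c d = 0" "period_coeff l c d = 0" for l
      using that by (auto simp: coprime_ind_def period_coeff_def)
    then show ?thesis by (simp add: H_def pair_term_def)
  qed
  ultimately have "(H has_sum (phi_expansion i r s z - G i z)) coprime_pairs"
    unfolding phi_expansion_def add_diff_cancel_left'
    by (elim has_sum_cong_neutral[THEN iffD1, rotated -1]) (auto simp: coprime_pairs_def)
  then have 1: "((\<lambda>(c, d). summand i r s z (pair_rep c d)) has_sum (phi_expansion i r s z - G i z)) coprime_pairs"
    by (rule has_sum_cong[THEN iffD1, rotated])
       (auto simp: coprime_pairs_def H_def summand_expansion[OF _ _ z i])
  have inv: "B_invariant (summand i r s z)" by (rule summand_invariant[OF rs(1) i z])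
  have "summand i r s z (pair_rep 0 1) = summand i r s z (mat 1)"
  proof -
    have "coprime (0 :: int) 1" by simp
    note rep = pair_rep[OF this]
    have "pair_rep 0 1 $ 2 = (mat 1 :: int_mat) $ 2"
      unfolding row_eq_iff rep by (simp add: mat_def)
    with inv rep(1) mat_1_SL2Z show ?thesis unfolding B_invariant_def by blast
  qed
  also have "\<dots> = G i z"
  proof -
    have "j_factor (mat 1) w = 1" "moebius (mat 1) w = w" for w
      by (simp_all add: moebius_def j_factor_def mat_def)
    then show ?thesis by (simp add: summand_def)
  qed
  finally have 0: "summand i r s z (pair_rep 0 1) = G i z" .
  have "((\<lambda>(c, d). summand i r s z (pair_rep c d)) has_sum (G i z + (phi_expansion i r s z - G i z))) (insert (0, 1) coprime_pairs)"
    using has_sum_insert[of "(0, 1)" coprime_pairs "\<lambda>(c, d). summand i r s z (pair_rep c d)" "phi_expansion i r s z - G i z"] 1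
    by (simp add: 0 coprime_pairs_def)
  then show ?thesis
    unfolding coset_sum_pairs[OF inv] by simp
qed

end

section \<open>The functions phi and the theorem\<close>

text \<open>Conjugating coefficients is multiplicative. It fixes the polynomials with integer coefficients and
reverses the basis \<open>(X - z)^i (X - cnj z)^(n - i)\<close>.\<close>

lemma coeff_cnj_mult:
  fixes p q p' q' :: "complex poly"
  assumes "\<And>m. coeff p' m = cnj (coeff p m)" "\<And>m. coeff q' m = cnj (coeff q m)"
  shows "coeff (p' * q') m = cnj (coeff (p * q) m)"
  by (simp add: coeff_mult assms)

lemma coeff_cnj_power:
  fixes p p' :: "complex poly"
  assumes "\<And>m. coeff p' m = cnj (coeff p m)"
  shows "coeff (p' ^ j) m = cnj (coeff (p ^ j) m)"
proof (induction j arbitrary: m)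
  case 0
  then show ?case by (simp add: coeff_1)
next
  case (Suc j)
  show ?case unfolding power_Suc by (rule coeff_cnj_mult[OF assms Suc.IH])
qed

lemma coeff_cnj_linear:
  assumes "u' = cnj u" "v' = cnj v"
  shows "coeff [:u', v':] m = cnj (coeff [:u, v:] m)"
  using assms by (auto simp: coeff_pCons split: nat.splits)

lemma coeff_poly_act_cnj: "coeff (poly_act n (map_poly cnj P) \<gamma>) m = cnj (coeff (poly_act n P \<gamma>) m)"
proof -
  have "coeff ([:of_int (\<gamma> $ 1 $ 2), of_int (\<gamma> $ 1 $ 1):] ^ l * [:of_int (\<gamma> $ 2 $ 2), of_int (\<gamma> $ 2 $ 1):] ^ (n - l)) m =
      cnj (coeff ([:of_int (\<gamma> $ 1 $ 2), of_int (\<gamma> $ 1 $ 1):] ^ l * [:of_int (\<gamma> $ 2 $ 2), of_int (\<gamma> $ 2 $ 1):] ^ (n - l)) m)" for l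
    by (intro coeff_cnj_mult coeff_cnj_power coeff_cnj_linear) simp_all
  then show ?thesis
    unfolding poly_act_def coeff_sum coeff_smult cnj_sum complex_cnj_mult
    by (simp add: coeff_map_poly)
qed

lemma coeff_basis_poly_cnj:
  assumes "i \<le> n"
  shows "coeff (basis_poly n z (n - i)) m = cnj (coeff (basis_poly n z i) m)"
proof -
  have "basis_poly n z (n - i) = [:- cnj z, 1:] ^ i * [:- z, 1:] ^ (n - i)"
    using assms by (simp add: basis_poly_def mult.commute)
  moreover have "coeff ([:- cnj z, 1:] ^ i * [:- z, 1:] ^ (n - i)) m =
      cnj (coeff ([:- z, 1:] ^ i * [:- cnj z, 1:] ^ (n - i)) m)"
    by (intro coeff_cnj_mult coeff_cnj_power coeff_cnj_linear) simp_all
  ultimately show ?thesis by (simp only: basis_poly_def)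
qed

lemma phi_coeff_eq:
  assumes z: "Im z > 0" and i: "i \<le> k - 2"
    and eq: "phi_poly k F r s z = (\<Sum>i\<le>k - 2. smult (c i) (basis_poly (k - 2) z i))"
  shows "phi_coeff k F r s i z = c i"
proof -
  define c' where "c' i = (if i \<le> k - 2 then c i else 0)" for i
  have eq': "phi_poly k F r s z = (\<Sum>i\<le>k - 2. smult (c' i) (basis_poly (k - 2) z i))"
    unfolding eq by (rule sum.cong) (simp_all add: c'_def)
  have "(THE c :: nat \<Rightarrow> complex. (\<forall>i>k - 2. c i = 0) \<and>
        phi_poly k F r s z =
          (\<Sum>i\<le>k - 2. smult (c i) ([:- z, 1:] ^ i * [:- cnj z, 1:] ^ (k - 2 - i)))) = c'"
  proof (rule the_equality)
    show "(\<forall>i>k - 2. c' i = 0) \<and>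
        phi_poly k F r s z =
          (\<Sum>i\<le>k - 2. smult (c' i) ([:- z, 1:] ^ i * [:- cnj z, 1:] ^ (k - 2 - i)))"
      using eq' by (simp add: c'_def basis_poly_def)
  next
    fix b :: "nat \<Rightarrow> complex"
    assume b: "(\<forall>i>k - 2. b i = 0) \<and> phi_poly k F r s z =
          (\<Sum>i\<le>k - 2. smult (b i) ([:- z, 1:] ^ i * [:- cnj z, 1:] ^ (k - 2 - i)))"
    then have "(\<Sum>i\<le>k - 2. smult (b i) (basis_poly (k - 2) z i)) = (\<Sum>i\<le>k - 2. smult (c' i) (basis_poly (k - 2) z i))"
      using eq' by (simp add: basis_poly_def)
    from basis_poly_coords_unique[OF z _ this] have "b i = c' i" if "i \<le> k - 2" for i
      using that .
    with b show "b = c'" by (auto simp: fun_eq_iff c'_def not_le)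
  qed
  then show ?thesis
    using z i by (simp add: phi_coeff_def on_uhp_def upper_half_plane_def c'_def)
qed

context cusp_form
begin

lemma phi_value_eq:
  assumes "even (r + s)" "r + s > int k" "i \<le> n" "Im z > 0"
  shows "phi_value i r s z = phi_expansion i r s z"
  unfolding phi_value_def coset_sum_def by (rule infsumI[OF summand_has_sum[OF assms]])

lemma qexp_phi_value:
  assumes rs: "even (r + s)" "r + s > int k" and i: "i \<le> n"
  shows "qexp (phi_value i r s)"
proof -
  obtain B where B: "\<forall>l c d. norm (period_coeff l c d) \<le> B" using period_coeff_bound by (elim exE)
  have 1: "qexp (\<lambda>z. infsum (pair_term coprime_ind r s z) ({1..} \<times> UNIV))"
    by (rule qexp_pair_term[OF exponents_ge_4(1)[OF rs le0 le0] coprime_ind_bound])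
       (simp add: coprime_ind_def coprime_add_mult)
  have 2: "qexp (\<lambda>z. infsum (pair_term (period_coeff l) (r - int (l - u)) (s - int u) z) ({1..} \<times> UNIV))"
    if "l \<le> n" "u \<le> l" for l u
    by (rule qexp_pair_term[OF exponents_ge_4(2)[OF rs that] B[rule_format]]) (rule period_coeff_periodic)
  have "qexp (\<lambda>z. G i z + (G i z * infsum (pair_term coprime_ind r s z) ({1..} \<times> UNIV) +
    1 / (2 * \<i>) ^ n * of_real (Im z) powi (- int n) * (\<Sum>l\<le>n. \<Sum>u\<le>l. kernel_coeff i l u *
      infsum (pair_term (period_coeff l) (r - int (l - u)) (s - int u) z) ({1..} \<times> UNIV))))"
    by (intro qexp_add qexp_mult qexp_G 1 qexp_const qexp_y_powi qexp_sum 2 finite_atMost) auto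
  then show ?thesis
  proof (rule qexp_cong)
    fix z :: complex assume z: "Im z > 0"
    have "z - cnj z = 2 * \<i> * of_real (Im z)" by (simp add: complex_eq_iff)
    then have "1 / (z - cnj z) ^ n = 1 / (2 * \<i>) ^ n * of_real (Im z) powi (- int n)"
      by (simp add: power_mult_distrib power_int_minus divide_inverse)
    then show "phi_value i r s z = G i z + (G i z * infsum (pair_term coprime_ind r s z) ({1..} \<times> UNIV) +
      1 / (2 * \<i>) ^ n * of_real (Im z) powi (- int n) * (\<Sum>l\<le>n. \<Sum>u\<le>l. kernel_coeff i l u *
        infsum (pair_term (period_coeff l) (r - int (l - u)) (s - int u) z) ({1..} \<times> UNIV)))"
      unfolding phi_value_eq[OF rs i z] phi_expansion_def by (simp only:)
  qed
qed

text \<open>Replacing \<open>z\<close> by its image multiplies each summand by a factor independent of the coset and translates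
the coset from the right.\<close>

lemma phi_value_modular:
  assumes "even (r + s)" "i \<le> n" and z: "Im z > 0" and \<gamma>0: "\<gamma>0 \<in> SL2Z"
  shows "phi_value i r s (moebius \<gamma>0 z) =
    j_factor \<gamma>0 z powi (r + int i) * j_factor \<gamma>0 (cnj z) powi (s + int (n - i)) * phi_value i r s z"
proof -
  define j jb where "j = j_factor \<gamma>0 z" and "jb = j_factor \<gamma>0 (cnj z)"
  have nz: "j \<noteq> 0" "jb \<noteq> 0" using j_factor_nonzero[OF \<gamma>0] z by (simp_all add: j_def jb_def)
  define J where "J = j powi (r + int i) * jb powi (s + int (n - i))"
  have J: "J = (j ^ i * jb ^ (n - i)) * (j powi r * jb powi s)"
    using nz by (simp add: J_def power_int_add)
  have J0: "J \<noteq> 0" using nz by (simp add: J)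
  have "summand i r s (moebius \<gamma>0 z) \<gamma> = J * summand i r s z (\<gamma> ** \<gamma>0)" for \<gamma>
  proof -
    have 1: "j_factor (\<gamma> ** \<gamma>0) z = j_factor \<gamma> (moebius \<gamma>0 z) * j"
      "j_factor (\<gamma> ** \<gamma>0) (cnj z) = j_factor \<gamma> (cnj (moebius \<gamma>0 z)) * jb"
      unfolding moebius_cnj[symmetric] using nz by (simp_all add: j_factor_mult j_def jb_def)
    have 2: "moebius (\<gamma> ** \<gamma>0) z = moebius \<gamma> (moebius \<gamma>0 z)"
      using nz by (simp add: moebius_mult j_def)
    show ?thesis
      unfolding summand_def 1 2 power_mult_distrib power_int_mult_distrib J
      using nz by simp
  qed
  then have "summand i r s (moebius \<gamma>0 z) = (\<lambda>\<gamma>. J * summand i r s z (\<gamma> ** \<gamma>0))" by (rule ext)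
  then have "phi_value i r s (moebius \<gamma>0 z) = coset_sum (\<lambda>\<gamma>. J * summand i r s z (\<gamma> ** \<gamma>0))"
    by (simp only: phi_value_def)
  also have "\<dots> = J * coset_sum (\<lambda>\<gamma>. summand i r s z (\<gamma> ** \<gamma>0))"
    unfolding coset_sum_def by (rule infsum_cmult_right')
  also have "coset_sum (\<lambda>\<gamma>. summand i r s z (\<gamma> ** \<gamma>0)) = phi_value i r s z"
    unfolding phi_value_def by (rule coset_sum_translate[OF summand_invariant[OF assms(1,2) z] \<gamma>0])
  finally show ?thesis by (simp add: J_def j_def jb_def)
qed

lemma coeff_phi_poly:
  "coeff (phi_poly k F r s z) m = (if m \<le> n then coset_sum (\<lambda>\<gamma>.
     coeff (poly_act n (F (moebius \<gamma> z)) \<gamma>) m / (j_factor \<gamma> z powi r * j_factor \<gamma> (cnj z) powi s)) else 0)"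
  unfolding phi_poly_def n_def[symmetric] by (auto simp: coeff_sum)

lemma degree_basis_poly: "i \<le> n \<Longrightarrow> degree (basis_poly n z i) \<le> n"
  using degree_mult_powers_le[of "[:- z, 1:]" "[:- cnj z, 1:]" i "n - i"] by (simp add: basis_poly_def)

text \<open>The coefficients of a polynomial are finite linear combinations of its coordinates, with
coefficients that do not depend on the coset; so the sum may be taken in coordinates.\<close>

lemma phi_poly_F_plus:
  assumes rs: "even (r + s)" "r + s > int k" and z: "Im z > 0"
  shows "phi_poly k (F_plus k f) r s z = (\<Sum>i\<le>n. smult (phi_value i r s z) (basis_poly n z i))"
proof (rule poly_eqI)
  fix m
  show "coeff (phi_poly k (F_plus k f) r s z) m = coeff (\<Sum>i\<le>n. smult (phi_value i r s z) (basis_poly n z i)) m"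
  proof (cases "m \<le> n")
    case True
    have "((\<lambda>C. \<Sum>i\<le>n. summand i r s z (SOME \<gamma>. \<gamma> \<in> C) * coeff (basis_poly n z i) m) has_sum
        (\<Sum>i\<le>n. phi_expansion i r s z * coeff (basis_poly n z i) m)) B_cosets"
      by (intro has_sum_finite_sum has_sum_cmult_left summand_has_sum rs z) auto
    then have "coset_sum (\<lambda>\<gamma>. \<Sum>i\<le>n. summand i r s z \<gamma> * coeff (basis_poly n z i) m) =
        (\<Sum>i\<le>n. phi_expansion i r s z * coeff (basis_poly n z i) m)"
      unfolding coset_sum_def by (rule infsumI)
    also have "\<dots> = coeff (\<Sum>i\<le>n. smult (phi_value i r s z) (basis_poly n z i)) m"
      by (simp add: coeff_sum phi_value_eq[OF rs _ z])
    also have "coset_sum (\<lambda>\<gamma>. \<Sum>i\<le>n. summand i r s z \<gamma> * coeff (basis_poly n z i) m) = coset_sum (\<lambda>\<gamma>.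
        coeff (poly_act n (F_plus k f (moebius \<gamma> z)) \<gamma>) m / (j_factor \<gamma> z powi r * j_factor \<gamma> (cnj z) powi s))"
      by (rule coset_sum_cong)
         (simp add: poly_act_F_plus_coords[OF _ z] coeff_sum summand_def sum_divide_distrib)
    finally show ?thesis using True by (simp add: coeff_phi_poly)
  next
    case False
    then have "coeff (basis_poly n z i) m = 0" if "i \<le> n" for i
      using degree_basis_poly[OF that, of z] by (intro coeff_eq_0) simp
    then show ?thesis using False by (simp add: coeff_phi_poly coeff_sum)
  qed
qed

lemma phi_coeff_F_plus:
  assumes "even (r + s)" "r + s > int k" "i \<le> n" "Im z > 0"
  shows "phi_coeff k (F_plus k f) r s i z = phi_value i r s z"
  using assms unfolding n_def
  by (intro phi_coeff_eq phi_poly_F_plus[unfolded n_def]) auto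

text \<open>\<open>F_minus\<close> is \<open>F_plus\<close> with conjugated coefficients. Conjugation exchanges \<open>r\<close> with \<open>s\<close> and reverses the
basis.\<close>

lemma phi_coeff_F_minus:
  assumes rs: "even (r + s)" "r + s > int k" and i: "i \<le> n" and z: "Im z > 0"
  shows "phi_coeff k (F_minus k f) r s i z = cnj (phi_value (n - i) s r z)"
proof -
  have rs': "even (s + r)" "s + r > int k" using rs by (simp_all add: add.commute)
  have "phi_poly k (F_minus k f) r s z = (\<Sum>i\<le>n. smult (cnj (phi_value (n - i) s r z)) (basis_poly n z i))"
  proof (rule poly_eqI)
    fix m
    have "coeff (phi_poly k (F_minus k f) r s z) m = cnj (coeff (phi_poly k (F_plus k f) s r z) m)"
      unfolding coeff_phi_poly F_minus_def coeff_poly_act_cnj coset_sum_def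
      by (simp add: j_factor_cnj mult.commute flip: infsum_cnj)
    also have "\<dots> = (\<Sum>i\<le>n. cnj (phi_value i s r z) * coeff (basis_poly n z (n - i)) m)"
      by (simp add: phi_poly_F_plus[OF rs' z] coeff_sum coeff_basis_poly_cnj)
    also have "\<dots> = (\<Sum>i\<le>n. cnj (phi_value (n - i) s r z) * coeff (basis_poly n z i) m)"
      by (rule sum.reindex_bij_witness[of _ "\<lambda>i. n - i" "\<lambda>i. n - i"]) auto
    finally show "coeff (phi_poly k (F_minus k f) r s z) m =
        coeff (\<Sum>i\<le>n. smult (cnj (phi_value (n - i) s r z)) (basis_poly n z i)) m"
      by (simp add: coeff_sum)
  qed
  then show ?thesis
    using z i unfolding n_def by (intro phi_coeff_eq) auto
qed

lemma phi_coeff_off_uhp: "z \<notin> upper_half_plane \<Longrightarrow> phi_coeff k F r s i z = 0"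
  by (simp add: phi_coeff_def on_uhp_def)

lemma phi_coeff_F_plus_M_weight:
  assumes rs: "even (r + s)" "r + s > int k" and i: "i \<le> n"
  shows "phi_coeff k (F_plus k f) r s i \<in> M_weight (r + int i) (s + int (n - i))"
  unfolding M_weight_iff
proof (intro conjI allI impI ballI)
  show "phi_coeff k (F_plus k f) r s i z = 0" if "z \<notin> upper_half_plane" for z
    using that by (rule phi_coeff_off_uhp)
  show "phi_coeff k (F_plus k f) r s i (moebius \<gamma> z) =
      j_factor \<gamma> z powi (r + int i) * j_factor \<gamma> (cnj z) powi (s + int (n - i)) * phi_coeff k (F_plus k f) r s i z"
    if "\<gamma> \<in> SL2Z" "z \<in> upper_half_plane" for \<gamma> z
    using that phi_value_modular[OF rs(1) i _ that(1), of z] moebius_uhp[OF that(1), of z]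
    by (simp add: upper_half_plane_def phi_coeff_F_plus[OF rs i])
  show "qexp (phi_coeff k (F_plus k f) r s i)"
    by (rule qexp_cong[OF qexp_phi_value[OF rs i]]) (rule phi_coeff_F_plus[OF rs i])
qed

lemma phi_coeff_F_minus_M_weight:
  assumes rs: "even (r + s)" "r + s > int k" and i: "i \<le> n"
  shows "phi_coeff k (F_minus k f) r s i \<in> M_weight (r + int i) (s + int (n - i))"
proof -
  have rs': "even (s + r)" "s + r > int k" using rs by (simp_all add: add.commute)
  have "phi_coeff k (F_minus k f) r s i = (\<lambda>z. cnj (phi_coeff k (F_plus k f) s r (n - i) z))"
  proof
    fix z
    show "phi_coeff k (F_minus k f) r s i z = cnj (phi_coeff k (F_plus k f) s r (n - i) z)"
    proof (cases "z \<in> upper_half_plane")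
      case True
      then show ?thesis
        using phi_coeff_F_minus[OF rs i, of z] phi_coeff_F_plus[OF rs', of "n - i" z]
        by (simp add: upper_half_plane_def)
    qed (simp add: phi_coeff_off_uhp)
  qed
  moreover have "phi_coeff k (F_plus k f) s r (n - i) \<in> M_weight (s + int (n - i)) (r + int (n - (n - i)))"
    by (rule phi_coeff_F_plus_M_weight[OF rs']) simp
  ultimately show ?thesis using i by (simp add: M_weight_cnj)
qed

end

lemma cusp_form_locale:
  assumes "k \<ge> 12" "even k" "f \<in> cusp_forms (int k)"
  obtains a where "cusp_form f k a"
proof -
  obtain a where "a 0 = 0" "\<forall>z\<in>upper_half_plane. (\<lambda>n. a n * nome z ^ n) sums f z"
    using assms(3) unfolding cusp_forms_def by blast
  then have "cusp_form f k a"
    using assms by unfold_locales (auto simp: upper_half_plane_def)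
  then show thesis by (rule that)
qed

theorem theorem2p6:
  shows "cfun.subspace phi_space \<and> phi_space \<subseteq> MI2'"
proof
  show "cfun.subspace phi_space"
    unfolding phi_space_def by (rule cfun.subspace_span)
  show "phi_space \<subseteq> MI2'"
    unfolding MI2'_eq phi_space_def
  proof (rule cfun.span_minimal)
    show "cfun.subspace M_space" unfolding M_space_def by (rule cfun.subspace_span)
    show "{phi_coeff k F r s i | k f F r s i.
        k \<ge> 12 \<and> even k \<and> f \<in> cusp_forms (int k) \<and> F \<in> {F_plus k f, F_minus k f} \<and>
        even (r + s) \<and> r + s > int k \<and> i \<le> k - 2} \<subseteq> M_space"
    proof clarify
      fix k f F r s i
      assume k: "(12 :: nat) \<le> k" "even k" "f \<in> cusp_forms (int k)" and F: "F \<in> {F_plus k f, F_minus k f}"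
        and rs: "even (r + s)" "int k < r + s" and i: "i \<le> k - 2"
      obtain a where "cusp_form f k a" using cusp_form_locale[OF k] .
      then interpret cusp_form f k a .
      have "phi_coeff k F r s i \<in> M_weight (r + int i) (s + int (n - i))"
        using F phi_coeff_F_plus_M_weight[OF rs] phi_coeff_F_minus_M_weight[OF rs] i
        by (auto simp: n_def)
      then show "phi_coeff k F r s i \<in> M_space" using M_weight_subset_M_space by blast
    qed
  qed
qed

end
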